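(* Let $d\in\mathbb{N}$, $a\in\mathbb{R}$, and let $G:\mathbb{R}^d\to\mathbb{R}$ satisfy $G(x)\in L^1(\mathbb{R}^d)$ and $xG(x)\in L^1(\mathbb{R}^d)$. Let $F:\mathbb{R}\times\mathbb{R}^d\to\mathbb{R}$ satisfy the Caratheodory condition and suppose that (i) $|F(u,x)|\le k|u|+h(x)$ for all $u\in\mathbb{R}$, $x\in\mathbb{R}^d$, with a constant $k>0$ and a function $h:\mathbb{R}^d\to\mathbb{R}^+$, $h\in L^2(\mathbb{R}^d)$; (ii) $|F(u_1,x)-F(u_2,x)|\le l|u_1-u_2|$ for all $u_1,u_2\in\mathbb{R}$, $x\in\mathbb{R}^d$, with a constant $l>0$. Assume also that the following orthogonality conditions hold: if $d=1$, $$\Big(G(x),\frac{e^{\pm ie^{a}x}}{\sqrt{2\pi}}\Big)_{L^2(\mathbb{R})}=0,$$ and if $d\ge 2$, $$\Big(G(x),\frac{e^{ipx}}{(2\pi)^{d/2}}\Big)_{L^2(\mathbb{R}^d)}=0,\quad p\in S^d_{e^a};$$ and that $(2\pi)^{d/2}N_a l<1$, where $N_a:=\Big\|\frac{\widehat G(p)}{\ln(|p|/e^a)}\Big\|_{L^\infty(\mathbb{R}^d)}$. Then the map $v\mapsto t_a v=u$ on $L^2(\mathbb{R}^d)$ defined by the equation $$\Big[\tfrac12\ln(-\Delta)\Big]u-au=\int_{\mathbb{R}^d}G(x-y)F(v(y),y)\,dy,\quad x\in\mathbb{R}^d,$$ has a unique fixed point $v_a$, which is the only solution in $L^2(\mathbb{R}^d)$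 of $$\Big[-\tfrac12\ln(-\Delta)\Big]u+au+\int_{\mathbb{R}^d}G(x-y)F(u(y),y)\,dy=0,\quad x\in\mathbb{R}^d.$$ The fixed point $v_a$ is nontrivial in the whole space provided that the intersection of the supports of the Fourier transforms of functions $\operatorname{supp}\widehat{F(0,x)}\cap\operatorname{supp}\widehat G$ is a set of nonzero Lebesgue measure in $\mathbb{R}^d$.
   Context: Fourier transform: $\widehat G(p):=\frac{1}{(2\pi)^{d/2}}\int_{\mathbb{R}^d}G(x)e^{-ipx}\,dx$, $p\in\mathbb{R}^d$ (extended to $L^2(\mathbb{R}^d)$ in the usual way). $\operatorname{supp}$ denotes the support of a function. The logarithmic Laplacian $\ln(-\Delta)$ is the operator on $L^2(\mathbb{R}^d)$ with Fourier symbol $2\ln|p|$, i.e. $\frac12\ln(-\Delta)$ is multiplication by $\ln|p|$ on the Fourier side. $(f_1,f_2)_{L^2(\mathbb{R}^d)}:=\int_{\mathbb{R}^d}f_1(x)\overline{f_2(x)}\,dx$, used also when $f_1\in L^1(\mathbb{R}^d)$ and $f_2\in L^\infty(\mathbb{R}^d)$. $S_r^d$ denotes the sphere in $\mathbb{R}^d$ of radius $r$ centered at the origin. The Caratheodory condition on $F(u,x)$: $x\mapsto F(u,x)$ is measurable for every $u\in\mathbb{R}$ and $u\mapsto F(u,x)$ is continuous for almost every $x\in\mathbb{R}^d$. The condition $xG(x)\in L^1(\mathbb{R}^d)$ means $|x|\,G(x)\in L^1(\mathbb{R}^d)$.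
   Formalization: In the nontriviality claim, the support of a Fourier transform is taken as the set where it is nonzero (up to null sets), not its closure; with closed supports the claim fails, e.g. when one transform is the indicator of a fat Cantor set and the other vanishes exactly there. *)

theory Defs
  imports "HOL-Analysis.Analysis" "HOL-Probability.Essential_Supremum"
begin

text \<open>
  Elements of \<open>L\<^sup>p\<close> are represented by Lebesgue measurable functions; equality in \<open>L\<^sup>p\<close> is
  equality almost everywhere.
\<close>

definition L1 :: "(real ^ 'n \<Rightarrow> 'b :: {banach, second_countable_topology}) set" where
  "L1 = {f. integrable lebesgue f}"

definition L2 :: "(real ^ 'n \<Rightarrow> 'b :: {banach, second_countable_topology}) set" where
  "L2 = {f \<in> borel_measurable lebesgue. integrable lebesgue (\<lambda>x. (norm (f x))\<^sup>2)}"

definition L2_inner :: "(real ^ 'n \<Rightarrow> complex) \<Rightarrow> (real ^ 'n \<Rightarrow> complex) \<Rightarrow> complex" where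
  "L2_inner f1 f2 = (LINT x|lebesgue. f1 x * cnj (f2 x))"

definition Linf_norm :: "(real ^ 'n \<Rightarrow> complex) \<Rightarrow> ereal" where
  "Linf_norm f = esssup lebesgue (\<lambda>p. ereal (cmod (f p)))"

definition fourier :: "(real ^ 'n \<Rightarrow> complex) \<Rightarrow> real ^ 'n \<Rightarrow> complex" where
  "fourier f p = of_real (1 / (2 * pi) powr (real CARD('n) / 2)) *
     (LINT x|lebesgue. f x * exp (- \<i> * of_real (p \<bullet> x)))"

text \<open>
  Squared \<open>L\<^sup>2\<close> distance.  It takes values in the extended nonnegative reals because the Bochner
  integral of a function that is not integrable is \<open>0\<close>.
\<close>

definition L2_dist_sq :: "(real ^ 'n \<Rightarrow> complex) \<Rightarrow> (real ^ 'n \<Rightarrow> complex) \<Rightarrow> ennreal" where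
  "L2_dist_sq f g = (\<integral>\<^sup>+ x. ennreal ((cmod (f x - g x))\<^sup>2) \<partial>lebesgue)"

text \<open>
  Extension of \<^const>\<open>fourier\<close> from \<open>L\<^sup>1 \<inter> L\<^sup>2\<close> to \<open>L\<^sup>2\<close> by continuity: \<open>g\<close> is the \<open>L\<^sup>2\<close> limit of
  the transforms of a sequence in \<open>L\<^sup>1 \<inter> L\<^sup>2\<close> that converges to \<open>f\<close> in \<open>L\<^sup>2\<close>.  By Plancherel such a
  \<open>g\<close> exists for every \<open>f\<close> in \<^const>\<open>L2\<close> and is unique almost everywhere; \<open>fourier_L2 f\<close> picks a
  representative.
\<close>

definition has_L2_fourier :: "(real ^ 'n \<Rightarrow> complex) \<Rightarrow> (real ^ 'n \<Rightarrow> complex) \<Rightarrow> bool" where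
  "has_L2_fourier f g \<longleftrightarrow> f \<in> L2 \<and> g \<in> L2 \<and>
     (\<exists>\<phi> :: nat \<Rightarrow> real ^ 'n \<Rightarrow> complex. (\<forall>n. \<phi> n \<in> L1 \<inter> L2) \<and>
        (\<lambda>n. L2_dist_sq (\<phi> n) f) \<longlonglongrightarrow> 0 \<and>
        (\<lambda>n. L2_dist_sq (fourier (\<phi> n)) g) \<longlonglongrightarrow> 0)"

definition fourier_L2 :: "(real ^ 'n \<Rightarrow> complex) \<Rightarrow> real ^ 'n \<Rightarrow> complex" where
  "fourier_L2 f = (SOME g. has_L2_fourier f g)"

text \<open>
  The graph of the unbounded operator \<open>ln (-\<Delta>)\<close> on \<open>L\<^sup>2\<close>: its domain consists of the \<open>u\<close> in \<open>L\<^sup>2\<close>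
  for which the symbol \<open>2 ln |p|\<close> times the transform of \<open>u\<close> is again in \<open>L\<^sup>2\<close>.
  (The value of \<^const>\<open>ln\<close> at \<open>0\<close> affects only a null set.)
\<close>

definition log_laplacian :: "(real ^ 'n \<Rightarrow> complex) \<Rightarrow> (real ^ 'n \<Rightarrow> complex) \<Rightarrow> bool" where
  "log_laplacian u w \<longleftrightarrow> u \<in> L2 \<and> w \<in> L2 \<and>
     (AE p in lebesgue. fourier_L2 w p = of_real (2 * ln (norm p)) * fourier_L2 u p)"

definition caratheodory :: "(real \<Rightarrow> real ^ 'n \<Rightarrow> real) \<Rightarrow> bool" where
  "caratheodory F \<longleftrightarrow> (\<forall>u. F u \<in> borel_measurable lebesgue) \<and>
     (AE x in lebesgue. continuous_on UNIV (\<lambda>u. F u x))"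

definition nonlocal_term ::
  "(real ^ 'n \<Rightarrow> real) \<Rightarrow> (real \<Rightarrow> real ^ 'n \<Rightarrow> real) \<Rightarrow> (real ^ 'n \<Rightarrow> real) \<Rightarrow> real ^ 'n \<Rightarrow> real" where
  "nonlocal_term G F v x = (LINT y|lebesgue. G (x - y) * F (v y) y)"

definition solves_auxiliary ::
  "real \<Rightarrow> (real ^ 'n \<Rightarrow> real) \<Rightarrow> (real \<Rightarrow> real ^ 'n \<Rightarrow> real) \<Rightarrow>
     (real ^ 'n \<Rightarrow> real) \<Rightarrow> (real ^ 'n \<Rightarrow> real) \<Rightarrow> bool" where
  "solves_auxiliary a G F v u \<longleftrightarrow>
     (\<exists>w. log_laplacian (\<lambda>x. of_real (u x)) w \<and>
        (AE x in lebesgue.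
           1 / 2 * w x - of_real (a * u x) = of_real (nonlocal_term G F v x)))"

definition t_map ::
  "real \<Rightarrow> (real ^ 'n \<Rightarrow> real) \<Rightarrow> (real \<Rightarrow> real ^ 'n \<Rightarrow> real) \<Rightarrow>
     (real ^ 'n \<Rightarrow> real) \<Rightarrow> real ^ 'n \<Rightarrow> real" where
  "t_map a G F v = (SOME u. u \<in> L2 \<and> solves_auxiliary a G F v u)"

definition solves_equation ::
  "real \<Rightarrow> (real ^ 'n \<Rightarrow> real) \<Rightarrow> (real \<Rightarrow> real ^ 'n \<Rightarrow> real) \<Rightarrow> (real ^ 'n \<Rightarrow> real) \<Rightarrow> bool" where
  "solves_equation a G F u \<longleftrightarrow>
     (\<exists>w. log_laplacian (\<lambda>x. of_real (u x)) w \<and>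
        (AE x in lebesgue.
           - (1 / 2) * w x + of_real (a * u x) + of_real (nonlocal_term G F u x) = 0))"

text \<open>
  The support of an almost everywhere defined function is \<open>{p. f p \<noteq> 0}\<close>, i.e.
  \<^const>\<open>support_on\<close> \<open>UNIV\<close>, which is determined up to null sets, rather than its closure.
  With closed supports the intersection of two supports may have positive measure although the
  product of the functions vanishes identically: take the indicator function of a fat Cantor set and
  a smooth function vanishing exactly on that set.
\<close>

abbreviation supp :: "(real ^ 'n \<Rightarrow> complex) \<Rightarrow> (real ^ 'n) set" where
  "supp f \<equiv> support_on UNIV f"

end

theory Submission
  imports Defs "HOL-Probability.Characteristic_Functions"
begin

text \<open>
  On the Fourier side the auxiliary equation becomes multiplication of the transform of the
  nonlinearity \<open>F (v x) x\<close> by \<open>(2 pi)^(d/2) G^(p) / ln (|p| / e^a)\<close>, because \<open>ln |p| - a\<close> vanishes only on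
  a sphere, which is a null set.  The smallness hypothesis makes this multiplier bounded, so by
  Plancherel and the Lipschitz condition \<open>t_map\<close> is a strict contraction of L2; it preserves real functions
  because the multiplier is Hermitian.  If the fixed point vanishes, so does the
  product of the transforms of \<open>F 0\<close> and \<open>G\<close>.

  Plancherel rests on the multiplication formula \<open>\<integral> f^ g = \<integral> f g^\<close>: applied twice, with a Gaussian
  damping factor, it turns \<open>\<integral> |f^|\<^sup>2 exp (- s\<^sup>2 |p|\<^sup>2 / 2)\<close> into the inner product of \<open>f\<close> with a Gaussian mollification
  of \<open>f\<close>.  Young's inequality then bounds the transform, and letting \<open>s\<close> tend to \<open>0\<close> gives
  equality for bounded continuous integrable functions, which are dense.
\<close>

section \<open>The space L2\<close>

text \<open>Elements of L2 are functions rather than classes, and \<open>fourier_L2\<close> is a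
  choice among a.e. equal candidates, so the transform is handled as the relation
  \<open>has_L2_fourier\<close>, which respects a.e. change, linear operations, reflection and
  conjugation. The isometry cannot be had in one stroke: letting s tend to 0 in the integral of
  |f^|^2 calls for |f^|^2 as an integrable majorant. So the inequality comes first, by Fatou, and
  yields f^ in L2; equality follows on the dense class by dominated convergence and passes to all of
  L2 because the inequality already makes the transform well defined there. Completeness is used
  twice, for the transforms of an approximating sequence and for the Picard iteration; in both cases
  the steps decrease geometrically, so no subsequence has to be extracted.\<close>

definition norm2 :: "(real ^ 'n \<Rightarrow> 'b :: euclidean_space) \<Rightarrow> real" where
  "norm2 f = sqrt (LINT x|lebesgue. (norm (f x))\<^sup>2)"

lemma L2_D:
  assumes "f \<in> L2"
  shows "f \<in> borel_measurable lebesgue" "integrable lebesgue (\<lambda>x. (norm (f x))\<^sup>2)"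
  using assms by (auto simp: L2_def)

lemma norm2_nonneg [simp]: "norm2 f \<ge> 0"
  by (simp add: norm2_def)

lemma norm2_power2: "(norm2 f)\<^sup>2 = (LINT x|lebesgue. (norm (f x))\<^sup>2)"
  by (simp add: norm2_def)

lemma nn_integral_norm2:
  fixes f :: "real ^ 'n \<Rightarrow> 'b :: euclidean_space"
  assumes "f \<in> L2"
  shows "(\<integral>\<^sup>+x. ennreal ((norm (f x))\<^sup>2) \<partial>lebesgue) = ennreal ((norm2 f)\<^sup>2)"
  unfolding norm2_power2 using L2_D[OF assms] by (intro nn_integral_eq_integral) auto

text \<open>A small \<open>norm2\<close> alone proves nothing, since the Bochner integral of a
  non-integrable function is 0. A bound on the extended nonnegative integral settles membership and
  norm together.\<close>

lemma L2_nn_integralI: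
  fixes f :: "real ^ 'n \<Rightarrow> 'b :: euclidean_space"
  assumes "f \<in> borel_measurable lebesgue" "c \<ge> 0"
    and "(\<integral>\<^sup>+x. ennreal ((norm (f x))\<^sup>2) \<partial>lebesgue) \<le> ennreal (c\<^sup>2)"
  shows "f \<in> L2" "norm2 f \<le> c"
proof -
  have [measurable]: "f \<in> borel_measurable lebesgue" by fact
  have "(\<integral>\<^sup>+x. ennreal ((norm (f x))\<^sup>2) \<partial>lebesgue) < \<infinity>"
    using assms(3) le_less_trans by fastforce
  then have "integrable lebesgue (\<lambda>x. (norm (f x))\<^sup>2)"
    by (intro integrableI_nonneg) auto
  then show "f \<in> L2" using assms(1) by (auto simp: L2_def)
  from nn_integral_norm2[OF this] assms have "ennreal ((norm2 f)\<^sup>2) \<le> ennreal (c\<^sup>2)" by simp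
  then have "(norm2 f)\<^sup>2 \<le> c\<^sup>2" by (subst (asm) ennreal_le_iff) auto
  then show "norm2 f \<le> c" using assms(2) by (rule power2_le_imp_le)
qed

text \<open>Works across value types and asks for the bound only a.e., so it covers scalings,
  bounded multipliers and the superposition operator alike.\<close>

lemma L2_dominated:
  fixes f :: "real ^ 'n \<Rightarrow> 'b :: euclidean_space" and g :: "real ^ 'n \<Rightarrow> 'c :: euclidean_space"
  assumes "f \<in> L2" "g \<in> borel_measurable lebesgue" "c \<ge> 0"
    and "AE x in lebesgue. norm (g x) \<le> c * norm (f x)"
  shows "g \<in> L2" "norm2 g \<le> c * norm2 f"
proof -
  have [measurable]: "f \<in> borel_measurable lebesgue" using L2_D[OF assms(1)] by simp
  have "(\<integral>\<^sup>+x. ennreal ((norm (g x))\<^sup>2) \<partial>lebesgue)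
      \<le> (\<integral>\<^sup>+x. ennreal (c\<^sup>2) * ennreal ((norm (f x))\<^sup>2) \<partial>lebesgue)"
    using assms(4)
    by (intro nn_integral_mono_AE, eventually_elim)
       (auto simp flip: ennreal_mult power_mult_distrib intro!: ennreal_leI power_mono)
  also have "\<dots> = ennreal (c\<^sup>2) * ennreal ((norm2 f)\<^sup>2)"
    by (subst nn_integral_cmult) (auto simp: nn_integral_norm2[OF assms(1)])
  also have "\<dots> = ennreal ((c * norm2 f)\<^sup>2)"
    by (simp add: power_mult_distrib ennreal_mult)
  finally have le: "(\<integral>\<^sup>+x. ennreal ((norm (g x))\<^sup>2) \<partial>lebesgue) \<le> ennreal ((c * norm2 f)\<^sup>2)" .
  show "g \<in> L2" "norm2 g \<le> c * norm2 f"
    using L2_nn_integralI[OF assms(2) _ le] assms(3) by auto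
qed

lemma L2_cong_AE:
  fixes f g :: "real ^ 'n \<Rightarrow> 'b :: euclidean_space"
  assumes "f \<in> L2" "AE x in lebesgue. f x = g x"
  shows "g \<in> L2" "norm2 g = norm2 f"
proof -
  have g: "g \<in> borel_measurable lebesgue"
    using borel_measurable_AE[OF L2_D(1)[OF assms(1)] assms(2)] .
  have "AE x in lebesgue. norm (g x) \<le> 1 * norm (f x)" using assms(2) by eventually_elim simp
  from L2_dominated[OF assms(1) g _ this] have g2: "g \<in> L2" and le: "norm2 g \<le> norm2 f" by auto
  show "g \<in> L2" by (rule g2)
  have "AE x in lebesgue. norm (f x) \<le> 1 * norm (g x)" using assms(2) by eventually_elim simp
  from L2_dominated(2)[OF g2 L2_D(1)[OF assms(1)] _ this] le show "norm2 g = norm2 f" by simp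
qed

lemma L2_zero [simp]: "(\<lambda>x. 0) \<in> L2"
  by (auto simp: L2_def)

lemma norm2_zero [simp]: "norm2 (\<lambda>x. 0) = 0"
  by (simp add: norm2_def)

lemma norm2_eq_0_iff:
  fixes f :: "real ^ 'n \<Rightarrow> 'b :: euclidean_space"
  assumes "f \<in> L2"
  shows "norm2 f = 0 \<longleftrightarrow> (AE x in lebesgue. f x = 0)"
  unfolding norm2_def using L2_D[OF assms] by (subst real_sqrt_eq_0_iff, subst integral_nonneg_eq_0_iff_AE) auto

lemma L2_scaleR:
  fixes f :: "real ^ 'n \<Rightarrow> 'b :: euclidean_space"
  assumes "f \<in> L2"
  shows "(\<lambda>x. c *\<^sub>R f x) \<in> L2"
  using L2_dominated(1)[OF assms, of "\<lambda>x. c *\<^sub>R f x" "\<bar>c\<bar>"] L2_D[OF assms] by simp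

lemma L2_norm:
  fixes f :: "real ^ 'n \<Rightarrow> 'b :: euclidean_space"
  assumes "f \<in> L2"
  shows "(\<lambda>x. norm (f x)) \<in> L2" "norm2 (\<lambda>x. norm (f x)) = norm2 f"
  using L2_D[OF assms] by (auto simp: L2_def norm2_def)

text \<open>The inequality 2ab <= a^2 + b^2 gives integrability first; only then can the
  extended-valued Cauchy-Schwarz bound be read back as one on the Bochner integral.\<close>

lemma L2_mult:
  fixes f :: "real ^ 'n \<Rightarrow> 'b :: euclidean_space" and g :: "real ^ 'n \<Rightarrow> 'c :: euclidean_space"
  assumes "f \<in> L2" "g \<in> L2"
  shows "integrable lebesgue (\<lambda>x. norm (f x) * norm (g x))"
    "(LINT x|lebesgue. norm (f x) * norm (g x)) \<le> norm2 f * norm2 g"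
proof -
  have [measurable]: "f \<in> borel_measurable lebesgue" "g \<in> borel_measurable lebesgue"
    using L2_D assms by auto
  have "integrable lebesgue (\<lambda>x. (norm (f x))\<^sup>2 + (norm (g x))\<^sup>2)"
    using L2_D[OF assms(1)] L2_D[OF assms(2)] by (intro Bochner_Integration.integrable_add)
  then show int: "integrable lebesgue (\<lambda>x. norm (f x) * norm (g x))"
  proof (rule Bochner_Integration.integrable_bound)
    show "AE x in lebesgue. norm (norm (f x) * norm (g x)) \<le> norm ((norm (f x))\<^sup>2 + (norm (g x))\<^sup>2)"
    proof (rule AE_I2)
      fix x :: "real ^ 'n"
      have "2 * (norm (f x) * norm (g x)) \<le> (norm (f x))\<^sup>2 + (norm (g x))\<^sup>2"
        using sum_squares_bound[of "norm (f x)" "norm (g x)"] by (simp add: mult.assoc)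
      moreover have "0 \<le> norm (f x) * norm (g x)" by simp
      ultimately show "norm (norm (f x) * norm (g x)) \<le> norm ((norm (f x))\<^sup>2 + (norm (g x))\<^sup>2)"
        unfolding real_norm_def by linarith
    qed
  qed measurable
  have "(ennreal (LINT x|lebesgue. norm (f x) * norm (g x)))\<^sup>2
      = (\<integral>\<^sup>+x. ennreal (norm (f x)) * ennreal (norm (g x)) \<partial>lebesgue)\<^sup>2"
    using int by (simp add: nn_integral_eq_integral flip: ennreal_mult)
  also have "\<dots> \<le> (\<integral>\<^sup>+x. (ennreal (norm (f x)))\<^sup>2 \<partial>lebesgue) * (\<integral>\<^sup>+x. (ennreal (norm (g x)))\<^sup>2 \<partial>lebesgue)"
    by (rule Cauchy_Schwarz_nn_integral) auto
  also have "\<dots> = ennreal ((norm2 f * norm2 g)\<^sup>2)"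
    by (simp add: ennreal_power nn_integral_norm2 assms power_mult_distrib ennreal_mult)
  finally have "(LINT x|lebesgue. norm (f x) * norm (g x))\<^sup>2 \<le> (norm2 f * norm2 g)\<^sup>2"
    by (subst (asm) ennreal_power) (auto simp: ennreal_le_iff)
  then show "(LINT x|lebesgue. norm (f x) * norm (g x)) \<le> norm2 f * norm2 g"
    by (rule power2_le_imp_le) simp
qed

lemma L2_add:
  fixes f g :: "real ^ 'n \<Rightarrow> 'b :: euclidean_space"
  assumes "f \<in> L2" "g \<in> L2"
  shows "(\<lambda>x. f x + g x) \<in> L2" "norm2 (\<lambda>x. f x + g x) \<le> norm2 f + norm2 g"
proof -
  note D = L2_D[OF assms(1)] L2_D[OF assms(2)]
  have [measurable]: "f \<in> borel_measurable lebesgue" "g \<in> borel_measurable lebesgue"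
    using D by auto
  let ?b = "\<lambda>x. (norm (f x))\<^sup>2 + 2 * (norm (f x) * norm (g x)) + (norm (g x))\<^sup>2"
  have b: "integrable lebesgue ?b" using D L2_mult(1)[OF assms] by auto
  have le: "(norm (f x + g x))\<^sup>2 \<le> ?b x" for x
  proof -
    have "(norm (f x + g x))\<^sup>2 \<le> (norm (f x) + norm (g x))\<^sup>2"
      by (intro power_mono norm_triangle_ineq) simp
    then show ?thesis by (simp add: power2_sum)
  qed
  have int: "integrable lebesgue (\<lambda>x. (norm (f x + g x))\<^sup>2)"
    by (rule Bochner_Integration.integrable_bound[OF b]) (use le in \<open>auto intro!: AE_I2 order_trans[OF _ abs_ge_self]\<close>)
  then show "(\<lambda>x. f x + g x) \<in> L2" by (auto simp: L2_def)
  have "(norm2 (\<lambda>x. f x + g x))\<^sup>2 \<le> (LINT x|lebesgue. ?b x)"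
    unfolding norm2_power2 by (intro integral_mono int b le)
  also have "\<dots> = (norm2 f)\<^sup>2 + 2 * (LINT x|lebesgue. norm (f x) * norm (g x)) + (norm2 g)\<^sup>2"
    unfolding norm2_power2 using D L2_mult(1)[OF assms] by simp
  also have "\<dots> \<le> (norm2 f + norm2 g)\<^sup>2"
    using L2_mult(2)[OF assms] by (simp add: power2_sum)
  finally show "norm2 (\<lambda>x. f x + g x) \<le> norm2 f + norm2 g"
    by (rule power2_le_imp_le) simp
qed

lemma L2_uminus:
  fixes f :: "real ^ 'n \<Rightarrow> 'b :: euclidean_space"
  shows "f \<in> L2 \<Longrightarrow> (\<lambda>x. - f x) \<in> L2" "norm2 (\<lambda>x. - f x) = norm2 f"
  by (auto simp: L2_def norm2_def)

lemma L2_diff: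
  fixes f g :: "real ^ 'n \<Rightarrow> 'b :: euclidean_space"
  assumes "f \<in> L2" "g \<in> L2"
  shows "(\<lambda>x. f x - g x) \<in> L2" "norm2 (\<lambda>x. f x - g x) \<le> norm2 f + norm2 g"
  using L2_add[OF assms(1) L2_uminus(1)[OF assms(2)]] by (simp_all add: L2_uminus)

lemma norm2_diff_commute:
  fixes f g :: "real ^ 'n \<Rightarrow> 'b :: euclidean_space"
  shows "norm2 (\<lambda>x. f x - g x) = norm2 (\<lambda>x. g x - f x)"
  by (simp add: norm2_def norm_minus_commute)

lemma norm2_triangle:
  fixes f g h :: "real ^ 'n \<Rightarrow> 'b :: euclidean_space"
  assumes "f \<in> L2" "g \<in> L2" "h \<in> L2"
  shows "norm2 (\<lambda>x. f x - h x) \<le> norm2 (\<lambda>x. f x - g x) + norm2 (\<lambda>x. g x - h x)"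
  using L2_add(2)[OF L2_diff(1)[OF assms(1,2)] L2_diff(1)[OF assms(2,3)]] by simp

lemma abs_norm2_diff_le:
  fixes f g :: "real ^ 'n \<Rightarrow> 'b :: euclidean_space"
  assumes "f \<in> L2" "g \<in> L2"
  shows "\<bar>norm2 f - norm2 g\<bar> \<le> norm2 (\<lambda>x. f x - g x)"
  using L2_add(2)[OF L2_diff(1)[OF assms(1,2)] assms(2)]
    L2_add(2)[OF L2_diff(1)[OF assms(2,1)] assms(1)] norm2_diff_commute[of f g] by simp

lemma norm2_diff_eq_0_iff:
  fixes f g :: "real ^ 'n \<Rightarrow> 'b :: euclidean_space"
  assumes "f \<in> L2" "g \<in> L2"
  shows "norm2 (\<lambda>x. f x - g x) = 0 \<longleftrightarrow> (AE x in lebesgue. f x = g x)"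
  using norm2_eq_0_iff[OF L2_diff(1)[OF assms]] by simp

lemma L2_limit_unique:
  fixes f g :: "real ^ 'n \<Rightarrow> 'b :: euclidean_space"
  assumes "f \<in> L2" "g \<in> L2" "\<And>n. s n \<in> L2"
    and "(\<lambda>n. norm2 (\<lambda>x. s n x - f x)) \<longlonglongrightarrow> 0" "(\<lambda>n. norm2 (\<lambda>x. s n x - g x)) \<longlonglongrightarrow> 0"
  shows "AE x in lebesgue. f x = g x"
proof -
  have "(\<lambda>n. norm2 (\<lambda>x. s n x - f x) + norm2 (\<lambda>x. s n x - g x)) \<longlonglongrightarrow> 0"
    using tendsto_add[OF assms(4,5)] by simp
  moreover have "norm2 (\<lambda>x. f x - g x) \<le> norm2 (\<lambda>x. s n x - f x) + norm2 (\<lambda>x. s n x - g x)" for n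
    using norm2_triangle[OF assms(1) assms(3) assms(2), of n] norm2_diff_commute[of f "s n"] by simp
  ultimately have "norm2 (\<lambda>x. f x - g x) \<le> 0"
    by (intro LIMSEQ_le_const) auto
  then show ?thesis using norm2_diff_eq_0_iff[OF assms(1,2)] norm2_nonneg[of "\<lambda>x. f x - g x"] by linarith
qed

lemma norm2_tendsto:
  fixes f :: "real ^ 'n \<Rightarrow> 'b :: euclidean_space"
  assumes "f \<in> L2" "\<And>n. s n \<in> L2" "(\<lambda>n. norm2 (\<lambda>x. s n x - f x)) \<longlonglongrightarrow> 0"
  shows "(\<lambda>n. norm2 (s n)) \<longlonglongrightarrow> norm2 f"
proof -
  have "(\<lambda>n. norm2 (s n) - norm2 f) \<longlonglongrightarrow> 0"
    by (rule Lim_null_comparison[OF _ assms(3)]) (use abs_norm2_diff_le[OF assms(2,1)] in auto)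
  then show ?thesis by (simp add: LIM_zero_cancel)
qed

section \<open>Completeness of L2 along sequences with geometric steps\<close>

lemma L2_partial_sum:
  fixes d :: "nat \<Rightarrow> real ^ 'n \<Rightarrow> 'b :: euclidean_space"
  assumes "\<And>n. d n \<in> L2" "\<And>n. norm2 (d n) \<le> C * q ^ n" "0 \<le> q" "q < 1" "C \<ge> 0"
  shows "(\<lambda>x. \<Sum>k<m. d (n + k) x) \<in> L2" "norm2 (\<lambda>x. \<Sum>k<m. d (n + k) x) \<le> C * q ^ n / (1 - q)"
proof -
  have 1: "(\<lambda>x. \<Sum>k<m. d (n + k) x) \<in> L2 \<and> norm2 (\<lambda>x. \<Sum>k<m. d (n + k) x) \<le> (\<Sum>k<m. C * q ^ (n + k))"
    for m
  proof (induction m)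
    case (Suc m)
    then show ?case
      using L2_add[of "\<lambda>x. \<Sum>k<m. d (n + k) x" "d (n + m)"] assms(1,2)[of "n + m"] by (auto simp: add.commute)
  qed simp
  have "(\<Sum>k<m. C * q ^ (n + k)) = C * q ^ n * (\<Sum>k<m. q ^ k)"
    by (simp add: power_add sum_distrib_left mult.assoc)
  also have "(\<Sum>k<m. q ^ k) = (1 - q ^ m) / (1 - q)"
    using assms by (simp add: sum_gp_strict)
  also have "\<dots> \<le> 1 / (1 - q)" using assms by (intro divide_right_mono) auto
  finally have "(\<Sum>k<m. C * q ^ (n + k)) \<le> C * q ^ n / (1 - q)"
    using assms by (simp add: mult_left_mono)
  with 1[of m] show "(\<lambda>x. \<Sum>k<m. d (n + k) x) \<in> L2"
      "norm2 (\<lambda>x. \<Sum>k<m. d (n + k) x) \<le> C * q ^ n / (1 - q)" by auto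
qed

text \<open>Riesz-Fischer argument: the sums of the step norms are bounded in L2, so by monotone
  convergence they are bounded at almost every point and the sequence converges a.e.; Fatou turns
  this into L2 convergence at the rate \<open>C * q ^ n / (1 - q)\<close>.\<close>

lemma L2_complete_geometric:
  fixes f :: "nat \<Rightarrow> real ^ 'n \<Rightarrow> 'b :: euclidean_space"
  assumes f: "\<And>n. f n \<in> L2" and step: "\<And>n. norm2 (\<lambda>x. f (Suc n) x - f n x) \<le> C * q ^ n"
    and q: "0 \<le> q" "q < 1"
  obtains g where "g \<in> L2" "(\<lambda>n. norm2 (\<lambda>x. f n x - g x)) \<longlonglongrightarrow> 0"
proof -
  have C: "C \<ge> 0" using order_trans[OF norm2_nonneg step[of 0]] by simp
  define d where "d n x = f (Suc n) x - f n x" for n x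
  have d: "d n \<in> L2" for n unfolding d_def using L2_diff(1)[OF f f] .
  have dn: "norm2 (d n) \<le> C * q ^ n" for n unfolding d_def by (rule step)
  have [measurable]: "f n \<in> borel_measurable lebesgue" for n using L2_D[OF f] by simp
  have [measurable]: "d n \<in> borel_measurable lebesgue" for n using L2_D[OF d] by simp
  define S where "S m x = (\<Sum>k<m. norm (d k x))" for m x
  have S: "S m \<in> L2" "norm2 (S m) \<le> C / (1 - q)" for m
    using L2_partial_sum[where d = "\<lambda>k x. norm (d k x)" and C = C and q = q and m = m and n = 0] L2_norm[OF d] dn q C by (auto simp: S_def[abs_def])
  have [measurable]: "S n \<in> borel_measurable lebesgue" for n using L2_D[OF S(1)] by simp
  have S0: "S m x \<ge> 0" for m x by (simp add: S_def sum_nonneg)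
  have Smono: "S m x \<le> S m' x" if "m \<le> m'" for m m' x
    unfolding S_def using that by (intro sum_mono2) auto
  have "(\<integral>\<^sup>+x. (SUP m. ennreal ((norm (S m x))\<^sup>2)) \<partial>lebesgue) = (SUP m. \<integral>\<^sup>+x. ennreal ((norm (S m x))\<^sup>2) \<partial>lebesgue)"
    by (intro nn_integral_monotone_convergence_SUP)
       (auto simp: incseq_def le_fun_def S0 intro!: ennreal_leI power_mono Smono)
  also have "\<dots> \<le> ennreal ((C / (1 - q))\<^sup>2)"
    using S by (intro SUP_least) (simp only: nn_integral_norm2 ennreal_leI power_mono norm2_nonneg)
  finally have "(\<integral>\<^sup>+x. (SUP m. ennreal ((norm (S m x))\<^sup>2)) \<partial>lebesgue) \<noteq> \<infinity>"
    by (auto simp: top_unique)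
  then have "AE x in lebesgue. (SUP m. ennreal ((norm (S m x))\<^sup>2)) \<noteq> \<infinity>"
    by (intro nn_integral_PInf_AE) auto
  then have conv: "AE x in lebesgue. convergent (\<lambda>n. f n x)"
  proof eventually_elim
    case (elim x)
    then obtain B where B: "B \<ge> 0" "(SUP m. ennreal ((norm (S m x))\<^sup>2)) = ennreal B"
      by (metis ennreal_cases infinity_ennreal_def)
    have b: "S m x \<le> sqrt B" for m
    proof -
      have "ennreal ((norm (S m x))\<^sup>2) \<le> ennreal B" unfolding B(2)[symmetric] by (rule SUP_upper) simp
      then have "(S m x)\<^sup>2 \<le> B" using B(1) by (simp add: ennreal_le_iff)
      then show ?thesis by (rule real_le_rsqrt)
    qed
    have "summable (\<lambda>k. norm (d k x))"
    proof (rule bounded_imp_summable[where B = "sqrt B"])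
      show "(\<Sum>k\<le>n. norm (d k x)) \<le> sqrt B" for n
        using b[of "Suc n"] by (simp add: S_def lessThan_Suc_atMost)
    qed simp
    then have "summable (\<lambda>k. d k x)" by (rule summable_norm_cancel)
    then have "(\<lambda>n. f n x - f 0 x) \<longlonglongrightarrow> (\<Sum>k. d k x)"
      using summable_LIMSEQ[of "\<lambda>k. d k x"] sum_lessThan_telescope[of "\<lambda>k. f k x"] by (simp add: d_def)
    from tendsto_add[OF this tendsto_const[of "f 0 x"]] show ?case
      by (auto simp: convergent_def)
  qed
  \<comment> \<open>Where the sequence diverges \<open>lim\<close> is an unspecified value; this
    happens on a null set, and g is measurable all the same.\<close>
  define g where "g x = lim (\<lambda>n. f n x)" for x
  have [measurable]: "g \<in> borel_measurable lebesgue"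
    unfolding g_def by (intro borel_measurable_lim_metric) measurable
  have bound: "(\<integral>\<^sup>+x. ennreal ((norm (g x - f n x))\<^sup>2) \<partial>lebesgue) \<le> ennreal ((C * q ^ n / (1 - q))\<^sup>2)" for n
  proof -
    \<comment> \<open>Writing the limit as a \<open>liminf\<close> lets Fatou's lemma bound g - f n
      by the partial sums that start at n, whose bound is uniform in m.\<close>
    have "AE x in lebesgue. ennreal ((norm (g x - f n x))\<^sup>2) = liminf (\<lambda>m. ennreal ((norm (f (n + m) x - f n x))\<^sup>2))"
      using conv
    proof eventually_elim
      case (elim x)
      then have "(\<lambda>n. f n x) \<longlonglongrightarrow> g x" by (simp add: g_def convergent_LIMSEQ_iff)
      then have "(\<lambda>m. f (n + m) x) \<longlonglongrightarrow> g x"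
        using LIMSEQ_ignore_initial_segment[of _ "g x" n] by (simp add: add.commute)
      then have "(\<lambda>m. ennreal ((norm (f (n + m) x - f n x))\<^sup>2)) \<longlonglongrightarrow> ennreal ((norm (g x - f n x))\<^sup>2)"
        by (intro tendsto_ennrealI tendsto_intros)
      then show ?case by (intro lim_imp_Liminf[symmetric] trivial_limit_sequentially)
    qed
    then have "(\<integral>\<^sup>+x. ennreal ((norm (g x - f n x))\<^sup>2) \<partial>lebesgue)
        = (\<integral>\<^sup>+x. liminf (\<lambda>m. ennreal ((norm (f (n + m) x - f n x))\<^sup>2)) \<partial>lebesgue)"
      by (rule nn_integral_cong_AE)
    also have "\<dots> \<le> liminf (\<lambda>m. \<integral>\<^sup>+x. ennreal ((norm (f (n + m) x - f n x))\<^sup>2) \<partial>lebesgue)"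
      by (rule nn_integral_liminf) measurable
    also have "\<dots> \<le> liminf (\<lambda>m::nat. ennreal ((C * q ^ n / (1 - q))\<^sup>2))"
    proof (intro Liminf_mono always_eventually allI)
      fix m
      have "(\<lambda>x. f (n + m) x - f n x) = (\<lambda>x. \<Sum>k<m. d (n + k) x)"
        using sum_lessThan_telescope[of "\<lambda>k. f (n + k) _" m] by (auto simp: d_def)
      then have "(\<lambda>x. f (n + m) x - f n x) \<in> L2" "norm2 (\<lambda>x. f (n + m) x - f n x) \<le> C * q ^ n / (1 - q)"
        using L2_partial_sum[OF d dn q C] by auto
      then show "(\<integral>\<^sup>+x. ennreal ((norm (f (n + m) x - f n x))\<^sup>2) \<partial>lebesgue) \<le> ennreal ((C * q ^ n / (1 - q))\<^sup>2)"
        by (simp add: nn_integral_norm2 ennreal_leI power_mono)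
    qed
    also have "\<dots> = ennreal ((C * q ^ n / (1 - q))\<^sup>2)" by (simp add: Liminf_const)
    finally show ?thesis .
  qed
  have pos: "C * q ^ n / (1 - q) \<ge> 0" for n using C q by simp
  have gf: "(\<lambda>x. g x - f n x) \<in> L2" "norm2 (\<lambda>x. g x - f n x) \<le> C * q ^ n / (1 - q)" for n
    using L2_nn_integralI[OF _ pos bound[of n]] by measurable
  have "g \<in> L2" using L2_add(1)[OF gf(1)[of 0] f[of 0]] by simp
  moreover have "(\<lambda>n. norm2 (\<lambda>x. f n x - g x)) \<longlonglongrightarrow> 0"
  proof (rule Lim_null_comparison)
    show "\<forall>\<^sub>F n in sequentially. norm (norm2 (\<lambda>x. f n x - g x)) \<le> C * q ^ n / (1 - q)"
      using gf(2) by (auto simp: norm2_diff_commute[of _ g])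
    show "(\<lambda>n. C * q ^ n / (1 - q)) \<longlonglongrightarrow> 0"
      using q by (intro tendsto_eq_intros LIMSEQ_power_zero) auto
  qed
  ultimately show ?thesis by (rule that)
qed


section \<open>Density of bounded continuous integrable functions in L2\<close>

lemma lebesgue_measurable_continuous:
  fixes f :: "real ^ 'n \<Rightarrow> 'b :: topological_space"
  assumes "continuous_on UNIV f"
  shows "f \<in> borel_measurable lebesgue"
  using borel_measurable_continuous_onI[OF assms] by (intro measurable_completion) simp

lemma L2_bounded_finite_support:
  fixes f :: "real ^ 'n \<Rightarrow> 'b :: euclidean_space"
  assumes [measurable]: "f \<in> borel_measurable lebesgue"
    and "\<And>x. norm (f x) \<le> M" "\<And>x. norm x > R \<Longrightarrow> f x = 0"
  shows "f \<in> L2" "integrable lebesgue f"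
proof -
  have fin: "integrable lebesgue (\<lambda>x :: real ^ 'n. c * indicator (cball 0 R) x)" for c :: real
    using emeasure_lborel_cball_finite[of "0 :: real ^ 'n" R]
    by (intro integrable_mult_right integrable_real_indicator) auto
  have M: "M \<ge> 0" using order_trans[OF norm_ge_zero assms(2)] .
  show "integrable lebesgue f"
    by (rule Bochner_Integration.integrable_bound[OF fin[of M]])
       (use assms(2,3) M in \<open>auto simp: indicator_def not_le\<close>)
  have "integrable lebesgue (\<lambda>x. (norm (f x))\<^sup>2)"
    by (rule Bochner_Integration.integrable_bound[OF fin[of "M\<^sup>2"]])
       (use assms(2,3) M in \<open>auto simp: indicator_def not_le power_mono\<close>)
  then show "f \<in> L2" by (auto simp: L2_def)
qed

lemma norm2_dominated_convergence:
  fixes f :: "real ^ 'n \<Rightarrow> 'b :: euclidean_space" and w :: "real ^ 'n \<Rightarrow> real"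
  assumes [measurable]: "\<And>n. s n \<in> borel_measurable lebesgue" "f \<in> borel_measurable lebesgue"
    and w: "w \<in> L2" and conv: "AE x in lebesgue. (\<lambda>n. s n x) \<longlonglongrightarrow> f x"
    and le: "\<And>n. AE x in lebesgue. norm (s n x - f x) \<le> w x"
  shows "(\<lambda>n. norm2 (\<lambda>x. s n x - f x)) \<longlonglongrightarrow> 0"
proof -
  have "(\<lambda>n. LINT x|lebesgue. (norm (s n x - f x))\<^sup>2) \<longlonglongrightarrow> (LINT x::real^'n|lebesgue. (0::real))"
  proof (rule integral_dominated_convergence)
    show "integrable lebesgue (\<lambda>x. (norm (w x))\<^sup>2)" using L2_D[OF w] by simp
    show "AE x in lebesgue. (\<lambda>n. (norm (s n x - f x))\<^sup>2) \<longlonglongrightarrow> 0"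
      using conv by eventually_elim
        (auto simp: LIM_zero_iff intro!: tendsto_eq_intros tendsto_norm_zero)
    show "AE x in lebesgue. norm ((norm (s n x - f x))\<^sup>2) \<le> (norm (w x))\<^sup>2" for n
      using le[of n] by eventually_elim (auto intro!: power_mono simp del: power2_abs)
  qed auto
  then have "(\<lambda>n. sqrt (LINT x|lebesgue. (norm (s n x - f x))\<^sup>2)) \<longlonglongrightarrow> sqrt 0"
    by (intro tendsto_real_sqrt) simp
  then show ?thesis by (simp add: norm2_def)
qed

text \<open>Cutting f to 0 where its value or its argument exceeds n changes it by at most |f|
  pointwise, so dominated convergence applies. A single constant then bounds both values and
  support.\<close>

lemma L2_approx_truncated:
  fixes f :: "real ^ 'n \<Rightarrow> 'b :: euclidean_space"
  assumes "f \<in> L2" "e > 0"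
  obtains g M where "g \<in> borel_measurable lebesgue" "\<And>x. norm (g x) \<le> M"
    "\<And>x. norm x > M \<Longrightarrow> g x = 0" "norm2 (\<lambda>x. g x - f x) < e"
proof -
  have [measurable]: "f \<in> borel_measurable lebesgue" using L2_D[OF assms(1)] by simp
  have [measurable]: "(\<lambda>x::real^'n. norm x) \<in> borel_measurable lebesgue"
    by (intro lebesgue_measurable_continuous continuous_intros)
  define s where "s n x = (if norm x \<le> real n \<and> norm (f x) \<le> real n then f x else 0)" for n x
  have [measurable]: "s n \<in> borel_measurable lebesgue" for n
    unfolding s_def by measurable
  have "(\<lambda>n. norm2 (\<lambda>x. s n x - f x)) \<longlonglongrightarrow> 0"
  proof (rule norm2_dominated_convergence)
    show "(\<lambda>x. norm (f x)) \<in> L2" using L2_norm[OF assms(1)] by simp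
    show "AE x in lebesgue. (\<lambda>n. s n x) \<longlonglongrightarrow> f x"
    proof (rule AE_I2)
      fix x :: "real ^ 'n"
      obtain N where N: "real N \<ge> max (norm x) (norm (f x))" using real_arch_simple by blast
      have "\<forall>\<^sub>F n in sequentially. s n x = f x"
        using eventually_ge_at_top[of N] by eventually_elim (use N in \<open>auto simp: s_def\<close>)
      then show "(\<lambda>n. s n x) \<longlonglongrightarrow> f x" by (rule tendsto_eventually)
    qed
  qed (auto simp: s_def)
  then have "\<forall>\<^sub>F n in sequentially. norm2 (\<lambda>x. s n x - f x) < e"
    using assms(2) by (rule order_tendstoD)
  then obtain n where "norm2 (\<lambda>x. s n x - f x) < e" by (auto simp: eventually_sequentially)
  then show ?thesis by (intro that[of "s n" "real n"]) (auto simp: s_def)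
qed

text \<open>The continuous approximants supplied by measurability converge a.e. but come without a
  majorant. Once f is truncated, capping their values and cutting off their supports provides
  one.\<close>

lemma L2_approx_continuous:
  fixes f :: "real ^ 'n \<Rightarrow> 'b :: euclidean_space"
  assumes f: "f \<in> L2" and e: "e > 0"
  obtains g where "continuous_on UNIV g" "bounded (range g)" "integrable lebesgue g" "g \<in> L2"
    "norm2 (\<lambda>x. g x - f x) < e"
proof -
  obtain t M where t: "t \<in> borel_measurable lebesgue" "\<And>x. norm (t x) \<le> M"
    "\<And>x. norm x > M \<Longrightarrow> t x = 0" "norm2 (\<lambda>x. t x - f x) < e / 2"
    using L2_approx_truncated[OF f half_gt_zero[OF e]] by blast
  note t(1)[measurable]
  have M: "M \<ge> 0" using order_trans[OF norm_ge_zero t(2)] .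
  have tL2: "t \<in> L2" by (rule L2_bounded_finite_support[OF t(1-3)])
  have "t measurable_on UNIV" using t(1) by (intro lebesgue_measurable_imp_measurable_on) auto
  then obtain N g where N: "negligible N" and g: "\<And>n. continuous_on UNIV (g n)"
    and conv: "\<And>x. x \<notin> N \<Longrightarrow> (\<lambda>n. g n x) \<longlonglongrightarrow> t x"
    by (auto simp: measurable_on_def)
  \<comment> \<open>Retraction onto the ball of radius M: it is continuous, caps the values of the
    approximants and fixes every value of t.\<close>
  define c where "c = closest_point (cball (0::'b) M)"
  have cc: "continuous_on UNIV c" unfolding c_def
    using M by (intro continuous_on_closest_point) auto
  have cM: "norm (c y) \<le> M" for y
    using closest_point_in_set[of "cball (0::'b) M" y] M by (simp add: c_def)
  have ct: "c (t x) = t x" for x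
    unfolding c_def using t(2) by (intro closest_point_self) auto
  \<comment> \<open>Cutoff equal to 1 on the ball of radius M, beyond which t vanishes, and 0
    outside radius M + 1; multiplying by it leaves the limit t unchanged.\<close>
  define \<eta> where "\<eta> x = max 0 (min 1 (M + 1 - norm x))" for x :: "real ^ 'n"
  define s where "s n x = \<eta> x *\<^sub>R c (g n x)" for n x
  have \<eta>: "0 \<le> \<eta> x" "\<eta> x \<le> 1" "norm x > M + 1 \<Longrightarrow> \<eta> x = 0" "norm x \<le> M \<Longrightarrow> \<eta> x = 1" for x
    by (auto simp: \<eta>_def)
  have cont: "continuous_on UNIV (s n)" for n
    unfolding s_def \<eta>_def
    by (intro continuous_intros continuous_on_compose2[OF cc g]) auto
  note [measurable] = lebesgue_measurable_continuous[OF cont]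
  have sM: "norm (s n x) \<le> M" for n x
    using mult_mono[OF \<eta>(2)[of x] cM[of "g n x"]] \<eta>(1)[of x] by (simp add: s_def)
  have s0: "norm x > M + 1 \<Longrightarrow> s n x = 0" for n x by (simp add: s_def \<eta>)
  have "(\<lambda>n. norm2 (\<lambda>x. s n x - t x)) \<longlonglongrightarrow> 0"
  proof (rule norm2_dominated_convergence)
    let ?w = "\<lambda>x :: real ^ 'n. 2 * M * indicator (cball 0 (M + 1)) x"
    show "?w \<in> L2"
    proof (rule L2_bounded_finite_support[where M = "2 * M" and R = "M + 1"])
      show "?w \<in> borel_measurable lebesgue"
        using borel_measurable_indicator[of "cball (0 :: real ^ 'n) (M + 1)" lebesgue]
        by (intro borel_measurable_times borel_measurable_const) simp
      show "norm (?w x) \<le> 2 * M" for x using M by (simp add: indicator_def)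
      show "?w x = 0" if "norm x > M + 1" for x using that by simp
    qed
    show "AE x in lebesgue. norm (s n x - t x) \<le> ?w x" for n
    proof (rule AE_I2)
      show "norm (s n x - t x) \<le> ?w x" for x
        using norm_triangle_ineq4[of "s n x" "t x"] sM[of n x] t(2)[of x] s0[of x n] t(3)[of x]
        by (cases "norm x > M + 1") (auto simp: indicator_def)
    qed
    have "AE x in lebesgue. x \<notin> N"
      using N by (simp add: negligible_iff_null_sets AE_not_in)
    then show "AE x in lebesgue. (\<lambda>n. s n x) \<longlonglongrightarrow> t x"
    proof eventually_elim
      case (elim x)
      have "isCont c (t x)" using cc by (simp add: continuous_on_eq_continuous_at)
      from isCont_tendsto_compose[OF this conv[OF elim]] have "(\<lambda>n. c (g n x)) \<longlonglongrightarrow> t x"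
        by (simp add: ct)
      then have "(\<lambda>n. s n x) \<longlonglongrightarrow> \<eta> x *\<^sub>R t x" unfolding s_def by (intro tendsto_intros)
      moreover have "\<eta> x *\<^sub>R t x = t x" using t(3)[of x] \<eta>(4)[of x] by (cases "norm x \<le> M") auto
      ultimately show ?case by simp
    qed
  qed measurable
  then have "\<forall>\<^sub>F n in sequentially. norm2 (\<lambda>x. s n x - t x) < e / 2"
    using e by (intro order_tendstoD) auto
  then obtain n where n: "norm2 (\<lambda>x. s n x - t x) < e / 2" by (auto simp: eventually_sequentially)
  have sL: "s n \<in> L2" "integrable lebesgue (s n)"
    by (rule L2_bounded_finite_support[where M = M and R = "M + 1"]; (rule sM s0)?; measurable)+
  show ?thesis
  proof (rule that[of "s n"])
    show "bounded (range (s n))" unfolding bounded_iff using sM by blast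
    show "norm2 (\<lambda>x. s n x - f x) < e"
      using norm2_triangle[OF sL(1) tL2 f] n t(4) by simp
  qed (rule cont sL)+
qed

section \<open>Affine substitutions for \<open>lebesgue\<close> and \<open>lborel\<close>, and Borel
  representatives\<close>

lemma
  fixes t :: "'a :: euclidean_space" and c :: real
  assumes "c \<noteq> 0"
  shows lebesgue_affine: "lebesgue = density (distr lebesgue lebesgue (\<lambda>x. t + c *\<^sub>R x)) (\<lambda>_. \<bar>c\<bar> ^ DIM('a))"
    and lebesgue_affine_measurable': "(\<lambda>x. t + c *\<^sub>R x) \<in> lebesgue \<rightarrow>\<^sub>M lebesgue"
  using lebesgue_affine_euclidean[of "\<lambda>_::'a. c" t] lebesgue_affine_measurable[of "\<lambda>_::'a. c" t] assms
  \<comment> \<open>The general map scales each basis coordinate separately; with all factors equal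
    to c the sum collapses to \<open>t + c *\<^sub>R x\<close> and the Jacobian to a power.\<close>
  unfolding scaleR_scaleR[symmetric] scaleR_sum_right[symmetric] euclidean_representation prod_constant
  by (simp_all add: ennreal_power)

lemma lebesgue_reflect:
  fixes t :: "'a :: euclidean_space"
  shows "distr lebesgue lebesgue (\<lambda>x. t - x) = lebesgue" "(\<lambda>x. t - x) \<in> lebesgue \<rightarrow>\<^sub>M lebesgue"
  using lebesgue_affine[of "-1" t] lebesgue_affine_measurable'[of "-1" t] by (simp_all add: density_1)

lemma AE_lebesgue_reflect:
  fixes t :: "'a :: euclidean_space"
  assumes "AE x in lebesgue. P x"
  shows "AE x in lebesgue. P (t - x)"
  by (rule AE_distrD[OF lebesgue_reflect(2)]) (simp only: lebesgue_reflect(1) assms)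

text \<open>Holds without measurability: the reflection is an involution, so f and its reflection
  are measurable together, and otherwise both Bochner integrals are 0. This keeps
  \<open>fourier_reflect\<close> free of hypotheses.\<close>

lemma integral_lebesgue_reflect:
  fixes f :: "'a :: euclidean_space \<Rightarrow> 'b :: {banach, second_countable_topology}"
  shows "(LINT x|lebesgue. f (t - x)) = (LINT x|lebesgue. f x)"
proof (cases "f \<in> borel_measurable lebesgue")
  case True
  then show ?thesis
    using integral_distr[OF lebesgue_reflect(2) True, of t] unfolding lebesgue_reflect(1) by simp
next
  case False
  have "(\<lambda>x. f (t - x)) \<notin> borel_measurable lebesgue"
  proof
    assume "(\<lambda>x. f (t - x)) \<in> borel_measurable lebesgue"
    from measurable_compose[OF lebesgue_reflect(2)[of t] this] False show False by simp
  qed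
  with False show ?thesis
    by (metis borel_measurable_integrable not_integrable_integral_eq)
qed

lemma integrable_lebesgue_reflect:
  fixes f :: "'a :: euclidean_space \<Rightarrow> 'b :: {banach, second_countable_topology}"
  assumes "integrable lebesgue f"
  shows "integrable lebesgue (\<lambda>x. f (t - x))"
  by (rule integrable_distr[OF lebesgue_reflect(2)]) (simp only: lebesgue_reflect(1) assms)

lemma L2_reflect:
  fixes f :: "real ^ 'n \<Rightarrow> 'b :: euclidean_space"
  assumes "f \<in> L2"
  shows "(\<lambda>x. f (- x)) \<in> L2" "norm2 (\<lambda>x. f (- x)) = norm2 f"
  using measurable_compose[OF lebesgue_reflect(2)[of 0] L2_D(1)[OF assms]]
    integrable_lebesgue_reflect[OF L2_D(2)[OF assms], of 0]
    integral_lebesgue_reflect[of "\<lambda>x. (norm (f x))\<^sup>2" 0]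
  by (auto simp: L2_def norm2_def)

lemma integral_lborel_affine:
  fixes f :: "'a :: euclidean_space \<Rightarrow> 'b :: {banach, second_countable_topology}"
  assumes [measurable]: "f \<in> borel_measurable borel" and "c \<noteq> 0"
  shows "integrable lborel (\<lambda>x. f (t + c *\<^sub>R x)) \<longleftrightarrow> integrable lborel f"
    and "(LINT x|lborel. f x) = \<bar>c\<bar> ^ DIM('a) *\<^sub>R (LINT x|lborel. f (t + c *\<^sub>R x))"
proof -
  have c: "\<bar>c\<bar> ^ DIM('a) \<noteq> 0" using assms(2) by simp
  have "integrable lborel f \<longleftrightarrow> integrable lborel (\<lambda>x. \<bar>c\<bar> ^ DIM('a) *\<^sub>R f (t + c *\<^sub>R x))"
    by (subst lborel_affine[OF assms(2), of t])
       (simp add: ennreal_power integrable_density integrable_distr_eq)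
  then show "integrable lborel (\<lambda>x. f (t + c *\<^sub>R x)) \<longleftrightarrow> integrable lborel f"
    using c integrable_scaleR_right[of "\<bar>c\<bar> ^ DIM('a)" lborel "\<lambda>x. f (t + c *\<^sub>R x)"]
      integrable_scaleR_right[of "inverse (\<bar>c\<bar> ^ DIM('a))" lborel "\<lambda>x. \<bar>c\<bar> ^ DIM('a) *\<^sub>R f (t + c *\<^sub>R x)"]
    by auto
  show "(LINT x|lborel. f x) = \<bar>c\<bar> ^ DIM('a) *\<^sub>R (LINT x|lborel. f (t + c *\<^sub>R x))"
    by (subst lborel_affine[OF assms(2), of t])
       (simp add: ennreal_power integral_density integral_distr)
qed

text \<open>A real Borel representative is taken for each coordinate; the exceptional null sets are
  finite in number.\<close>

lemma lebesgue_ex_borel: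
  fixes f :: "'a :: euclidean_space \<Rightarrow> 'b :: euclidean_space"
  assumes "f \<in> borel_measurable lebesgue"
  obtains g where "g \<in> borel_measurable borel" "AE x in lebesgue. f x = g x"
proof -
  have "\<exists>g. g \<in> borel_measurable lborel \<and> (AE x in lborel. f x \<bullet> b = g x)" for b
    using completion_ex_borel_measurable_real[of "\<lambda>x. f x \<bullet> b" lborel] assms by auto
  then obtain g where g: "\<And>b. g b \<in> borel_measurable lborel" "\<And>b. AE x in lborel. f x \<bullet> b = g b x"
    by metis
  show ?thesis
  proof (rule that[of "\<lambda>x. \<Sum>b\<in>Basis. g b x *\<^sub>R b"])
    show "(\<lambda>x. \<Sum>b\<in>Basis. g b x *\<^sub>R b) \<in> borel_measurable borel" using g(1) by simp
    have "AE x in lborel. \<forall>b\<in>Basis. f x \<bullet> b = g b x"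
      using g(2) by (intro AE_finite_allI) auto
    then have "AE x in lborel. f x = (\<Sum>b\<in>Basis. g b x *\<^sub>R b)"
    proof eventually_elim
      case (elim x)
      have "f x = (\<Sum>b\<in>Basis. (f x \<bullet> b) *\<^sub>R b)" by (rule euclidean_representation[symmetric])
      also have "\<dots> = (\<Sum>b\<in>Basis. g b x *\<^sub>R b)" using elim by simp
      finally show ?case .
    qed
    then show "AE x in lebesgue. f x = (\<Sum>b\<in>Basis. g b x *\<^sub>R b)" by (rule AE_completion)
  qed
qed

section \<open>Convolution\<close>

text \<open>Total by the convention that the Bochner integral of a non-integrable function is 0. For
  g in L1 and f in L2 such points x form a null set, by \<open>conv_L2\<close>.\<close>

definition conv :: "('a \<Rightarrow> complex) \<Rightarrow> ('a \<Rightarrow> complex) \<Rightarrow> 'a :: euclidean_space \<Rightarrow> complex" where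
  "conv g f x = (LINT y|lebesgue. g (x - y) * f y)"

lemma nn_integral_lborel_affine:
  fixes f :: "'a :: euclidean_space \<Rightarrow> ennreal"
  assumes [measurable]: "f \<in> borel_measurable borel"
  shows "(\<integral>\<^sup>+x. f (t - x) \<partial>lborel) = (\<integral>\<^sup>+x. f x \<partial>lborel)"
    and "(\<integral>\<^sup>+x. f (x - t) \<partial>lborel) = (\<integral>\<^sup>+x. f x \<partial>lborel)"
proof -
  show "(\<integral>\<^sup>+x. f (t - x) \<partial>lborel) = (\<integral>\<^sup>+x. f x \<partial>lborel)"
    by (subst (2) lborel_affine[of "- 1" t]) (simp_all add: nn_integral_density nn_integral_distr)
  show "(\<integral>\<^sup>+x. f (x - t) \<partial>lborel) = (\<integral>\<^sup>+x. f x \<partial>lborel)"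
    by (subst (2) lborel_affine[of 1 "- t"]) (simp_all add: nn_integral_density nn_integral_distr)
qed

lemma integral_lborel_translate:
  fixes f :: "'a :: euclidean_space \<Rightarrow> 'b :: {banach, second_countable_topology}"
  assumes [measurable]: "f \<in> borel_measurable borel"
  shows "integrable lborel (\<lambda>x. f (x - t)) \<longleftrightarrow> integrable lborel f"
    and "(LINT x|lborel. f (x - t)) = (LINT x|lborel. f x)"
  using integral_lborel_affine[of f 1 "- t"] by simp_all

lemma integral_borel_eq:
  fixes f :: "'a :: euclidean_space \<Rightarrow> 'b :: {banach, second_countable_topology}"
  assumes "f \<in> borel_measurable borel"
  shows "(LINT x|lebesgue. f x) = (LINT x|lborel. f x)"
    and "integrable lebesgue f \<longleftrightarrow> integrable lborel f"
  using assms by (simp_all add: integral_completion integrable_completion)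

text \<open>Lets one pass to Borel representatives, for which Fubini applies to \<open>(x, y) \<mapsto> g (x - y) * f y\<close>.\<close>

lemma conv_cong_AE:
  assumes [measurable]: "g \<in> borel_measurable lebesgue" "g' \<in> borel_measurable lebesgue"
      "f \<in> borel_measurable lebesgue" "f' \<in> borel_measurable lebesgue"
    and "AE x in lebesgue. g x = g' x" "AE x in lebesgue. f x = f' x"
  shows "integrable lebesgue (\<lambda>y. g (x - y) * f y) \<longleftrightarrow> integrable lebesgue (\<lambda>y. g' (x - y) * f' y)"
    and "conv g f x = conv g' f' x"
proof -
  have [measurable]: "(\<lambda>y. g (x - y)) \<in> borel_measurable lebesgue" "(\<lambda>y. g' (x - y)) \<in> borel_measurable lebesgue"
    by (intro measurable_compose[OF lebesgue_reflect(2)]; measurable)+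
  have eq: "AE y in lebesgue. g (x - y) * f y = g' (x - y) * f' y"
    using AE_lebesgue_reflect[OF assms(5), of x] assms(6) by eventually_elim simp
  show "integrable lebesgue (\<lambda>y. g (x - y) * f y) \<longleftrightarrow> integrable lebesgue (\<lambda>y. g' (x - y) * f' y)"
    by (rule integrable_cong_AE[OF _ _ eq]) measurable
  show "conv g f x = conv g' f' x"
    unfolding conv_def by (rule integral_cong_AE[OF _ _ eq]) measurable
qed

lemma conv_borel:
  assumes [measurable]: "g \<in> borel_measurable borel" "f \<in> borel_measurable borel"
  shows "conv g f x = (LINT y|lborel. g (x - y) * f y)"
    and "conv g f \<in> borel_measurable borel"
proof -
  show eq: "conv g f x = (LINT y|lborel. g (x - y) * f y)" for x
    unfolding conv_def by (rule integral_borel_eq) measurable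
  have "(\<lambda>x. LINT y|lborel. g (x - y) * f y) \<in> borel_measurable borel"
    by measurable
  then show "conv g f \<in> borel_measurable borel" by (simp add: eq[abs_def] cong: measurable_cong)
qed

text \<open>Split |g f| as sqrt |g| times sqrt |g| |f| and apply Cauchy-Schwarz in y; Tonelli and
  translation invariance produce the second factor of the L1 norm. Extended nonnegative integrals
  presuppose no finiteness, so the estimate can prove that the convolution exists.\<close>

lemma young_nn:
  fixes g f :: "'a :: euclidean_space \<Rightarrow> complex"
  assumes [measurable]: "g \<in> borel_measurable borel" "f \<in> borel_measurable borel"
  shows "(\<integral>\<^sup>+x. (\<integral>\<^sup>+y. ennreal (cmod (g (x - y) * f y)) \<partial>lborel)\<^sup>2 \<partial>lborel)
    \<le> (\<integral>\<^sup>+x. ennreal (cmod (g x)) \<partial>lborel)\<^sup>2 * (\<integral>\<^sup>+x. ennreal ((cmod (f x))\<^sup>2) \<partial>lborel)"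
proof -
  let ?G = "\<integral>\<^sup>+x. ennreal (cmod (g x)) \<partial>lborel"
  have "(\<integral>\<^sup>+y. ennreal (cmod (g (x - y) * f y)) \<partial>lborel)\<^sup>2
      \<le> ?G * (\<integral>\<^sup>+y. ennreal (cmod (g (x - y))) * ennreal ((cmod (f y))\<^sup>2) \<partial>lborel)" for x
  proof -
    have "(\<integral>\<^sup>+y. ennreal (cmod (g (x - y) * f y)) \<partial>lborel)
        = (\<integral>\<^sup>+y. ennreal (sqrt (cmod (g (x - y)))) * ennreal (sqrt (cmod (g (x - y))) * cmod (f y)) \<partial>lborel)"
      by (intro nn_integral_cong) (simp add: norm_mult mult.assoc[symmetric] flip: ennreal_mult)
    then have "(\<integral>\<^sup>+y. ennreal (cmod (g (x - y) * f y)) \<partial>lborel)\<^sup>2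
        \<le> (\<integral>\<^sup>+y. (ennreal (sqrt (cmod (g (x - y)))))\<^sup>2 \<partial>lborel) *
          (\<integral>\<^sup>+y. (ennreal (sqrt (cmod (g (x - y))) * cmod (f y)))\<^sup>2 \<partial>lborel)"
      using Cauchy_Schwarz_nn_integral[of "\<lambda>y. ennreal (sqrt (cmod (g (x - y))))" lborel
          "\<lambda>y. ennreal (sqrt (cmod (g (x - y))) * cmod (f y))"] by simp
    also have "(\<integral>\<^sup>+y. (ennreal (sqrt (cmod (g (x - y)))))\<^sup>2 \<partial>lborel) = (\<integral>\<^sup>+y. ennreal (cmod (g (x - y))) \<partial>lborel)"
      by (simp add: ennreal_power)
    also have "\<dots> = ?G" by (rule nn_integral_lborel_affine(1)[of "\<lambda>z. ennreal (cmod (g z))"]) measurable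
    also have "(\<integral>\<^sup>+y. (ennreal (sqrt (cmod (g (x - y))) * cmod (f y)))\<^sup>2 \<partial>lborel)
        = (\<integral>\<^sup>+y. ennreal (cmod (g (x - y))) * ennreal ((cmod (f y))\<^sup>2) \<partial>lborel)"
      by (simp add: ennreal_power power_mult_distrib ennreal_mult)
    finally show ?thesis .
  qed
  then have "(\<integral>\<^sup>+x. (\<integral>\<^sup>+y. ennreal (cmod (g (x - y) * f y)) \<partial>lborel)\<^sup>2 \<partial>lborel)
      \<le> (\<integral>\<^sup>+x. ?G * (\<integral>\<^sup>+y. ennreal (cmod (g (x - y))) * ennreal ((cmod (f y))\<^sup>2) \<partial>lborel) \<partial>lborel)"
    by (intro nn_integral_mono)
  also have "\<dots> = ?G * (\<integral>\<^sup>+x. (\<integral>\<^sup>+y. ennreal (cmod (g (x - y))) * ennreal ((cmod (f y))\<^sup>2) \<partial>lborel) \<partial>lborel)"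
    by (rule nn_integral_cmult) measurable
  also have "(\<integral>\<^sup>+x. (\<integral>\<^sup>+y. ennreal (cmod (g (x - y))) * ennreal ((cmod (f y))\<^sup>2) \<partial>lborel) \<partial>lborel)
      = (\<integral>\<^sup>+y. (\<integral>\<^sup>+x. ennreal (cmod (g (x - y))) * ennreal ((cmod (f y))\<^sup>2) \<partial>lborel) \<partial>lborel)"
    by (rule lborel_pair.Fubini'[symmetric]) measurable
  also have "\<dots> = (\<integral>\<^sup>+y. ?G * ennreal ((cmod (f y))\<^sup>2) \<partial>lborel)"
    by (simp add: nn_integral_multc nn_integral_lborel_affine(2)[of "\<lambda>z. ennreal (cmod (g z))"])
  also have "\<dots> = ?G * (\<integral>\<^sup>+y. ennreal ((cmod (f y))\<^sup>2) \<partial>lborel)"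
    by (rule nn_integral_cmult) measurable
  finally show ?thesis by (simp add: power2_eq_square mult.assoc)
qed

text \<open>The outer integral in \<open>young_nn\<close> is finite, hence the inner one is finite
  for almost every x; there the convolution converges absolutely and its modulus is at most the
  inner integral.\<close>

lemma conv_L2:
  fixes g f :: "real ^ 'n \<Rightarrow> complex"
  assumes g: "integrable lebesgue g" and f: "f \<in> L2"
  shows "AE x in lebesgue. integrable lebesgue (\<lambda>y. g (x - y) * f y)"
    and "conv g f \<in> L2" and "norm2 (conv g f) \<le> (LINT x|lebesgue. cmod (g x)) * norm2 f"
proof -
  have gm: "g \<in> borel_measurable lebesgue" and fm: "f \<in> borel_measurable lebesgue"
    using g L2_D[OF f] by auto
  obtain g' where g'[measurable]: "g' \<in> borel_measurable borel" and g'eq: "AE x in lebesgue. g x = g' x"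
    using lebesgue_ex_borel[OF gm] .
  obtain f' where f'[measurable]: "f' \<in> borel_measurable borel" and f'eq: "AE x in lebesgue. f x = f' x"
    using lebesgue_ex_borel[OF fm] .
  have m: "g' \<in> borel_measurable lebesgue" "f' \<in> borel_measurable lebesgue"
    by (intro measurable_completion; simp)+
  let ?C = "LINT x|lebesgue. cmod (g x)"
  have C0: "?C \<ge> 0" by simp
  have "(\<integral>\<^sup>+x. ennreal (cmod (g' x)) \<partial>lborel) = (\<integral>\<^sup>+x. ennreal (cmod (g' x)) \<partial>lebesgue)"
    by (simp add: nn_integral_completion)
  also have "\<dots> = (\<integral>\<^sup>+x. ennreal (cmod (g x)) \<partial>lebesgue)"
    using g'eq by (intro nn_integral_cong_AE) (auto elim: eventually_mono)
  also have "\<dots> = ennreal ?C" using g by (intro nn_integral_eq_integral) auto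
  finally have 1: "(\<integral>\<^sup>+x. ennreal (cmod (g' x)) \<partial>lborel) = ennreal ?C" .
  have "(\<integral>\<^sup>+x. ennreal ((cmod (f' x))\<^sup>2) \<partial>lborel) = (\<integral>\<^sup>+x. ennreal ((cmod (f' x))\<^sup>2) \<partial>lebesgue)"
    by (simp add: nn_integral_completion)
  also have "\<dots> = (\<integral>\<^sup>+x. ennreal ((cmod (f x))\<^sup>2) \<partial>lebesgue)"
    using f'eq by (intro nn_integral_cong_AE) (auto elim: eventually_mono)
  also have "\<dots> = ennreal ((norm2 f)\<^sup>2)" by (rule nn_integral_norm2[OF f])
  finally have 2: "(\<integral>\<^sup>+x. ennreal ((cmod (f' x))\<^sup>2) \<partial>lborel) = ennreal ((norm2 f)\<^sup>2)" .
  have Y: "(\<integral>\<^sup>+x. (\<integral>\<^sup>+y. ennreal (cmod (g' (x - y) * f' y)) \<partial>lborel)\<^sup>2 \<partial>lborel) \<le> ennreal ((?C * norm2 f)\<^sup>2)"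
    using young_nn[OF g' f'] unfolding 1 2 by (simp add: ennreal_power power_mult_distrib ennreal_mult C0)
  then have "(\<integral>\<^sup>+x. (\<integral>\<^sup>+y. ennreal (cmod (g' (x - y) * f' y)) \<partial>lborel)\<^sup>2 \<partial>lborel) \<noteq> \<infinity>"
    by (auto simp: top_unique)
  then have "AE x in lborel. (\<integral>\<^sup>+y. ennreal (cmod (g' (x - y) * f' y)) \<partial>lborel)\<^sup>2 \<noteq> \<infinity>"
    by (intro nn_integral_PInf_AE) measurable
  then have int': "AE x in lborel. integrable lborel (\<lambda>y. g' (x - y) * f' y)"
  proof eventually_elim
    case (elim x)
    then have "(\<integral>\<^sup>+y. ennreal (cmod (g' (x - y) * f' y)) \<partial>lborel) < \<infinity>"
      by (auto simp: power2_eq_square ennreal_mult_eq_top_iff less_top)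
    then show ?case by (intro integrableI_bounded) auto
  qed
  show "AE x in lebesgue. integrable lebesgue (\<lambda>y. g (x - y) * f y)"
    using AE_completion[OF int']
  proof eventually_elim
    case (elim x)
    then have "integrable lebesgue (\<lambda>y. g' (x - y) * f' y)" by (subst integral_borel_eq) auto
    then show ?case using conv_cong_AE(1)[OF gm m(1) fm m(2) g'eq f'eq] by simp
  qed
  have eq: "conv g f = conv g' f'" using conv_cong_AE(2)[OF gm m(1) fm m(2) g'eq f'eq] by auto
  have "(\<integral>\<^sup>+x. ennreal ((cmod (conv g' f' x))\<^sup>2) \<partial>lborel)
      \<le> (\<integral>\<^sup>+x. (\<integral>\<^sup>+y. ennreal (cmod (g' (x - y) * f' y)) \<partial>lborel)\<^sup>2 \<partial>lborel)"
  proof (rule nn_integral_mono_AE)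
    show "AE x in lborel. ennreal ((cmod (conv g' f' x))\<^sup>2) \<le> (\<integral>\<^sup>+y. ennreal (cmod (g' (x - y) * f' y)) \<partial>lborel)\<^sup>2"
      using int'
    proof eventually_elim
      case (elim x)
      have "ennreal (cmod (conv g' f' x)) \<le> (\<integral>\<^sup>+y. ennreal (cmod (g' (x - y) * f' y)) \<partial>lborel)"
        unfolding conv_borel(1)[OF g' f'] by (rule integral_norm_bound_ennreal[OF elim])
      then have "(ennreal (cmod (conv g' f' x)))\<^sup>2 \<le> (\<integral>\<^sup>+y. ennreal (cmod (g' (x - y) * f' y)) \<partial>lborel)\<^sup>2"
        by (rule power_mono) simp
      then show ?case by (simp add: ennreal_power)
    qed
  qed
  with Y have "(\<integral>\<^sup>+x. ennreal ((norm (conv g' f' x))\<^sup>2) \<partial>lebesgue) \<le> ennreal ((?C * norm2 f)\<^sup>2)"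
    by (simp add: nn_integral_completion)
  moreover have "conv g' f' \<in> borel_measurable lebesgue"
    using conv_borel(2)[OF g' f'] by (intro measurable_completion) simp
  ultimately show "conv g f \<in> L2" "norm2 (conv g f) \<le> ?C * norm2 f"
    unfolding eq using C0 by (auto intro!: L2_nn_integralI[where c = "?C * norm2 f"])
qed

section \<open>The Fourier transform on L1\<close>

lemma cmod_exp_i_of_real [simp]: "cmod (exp (\<i> * of_real t)) = 1" "cmod (exp (- (\<i> * of_real t))) = 1"
  using norm_exp_i_times[of t] norm_exp_i_times[of "- t"] by simp_all

abbreviation fconst :: "'n::finite itself \<Rightarrow> real" where
  "fconst _ \<equiv> (2 * pi) powr (real CARD('n) / 2)"

lemma measurable_lebesgue_exp [measurable]:
  "(\<lambda>x::real^'n. exp (- (\<i> * of_real (p \<bullet> x)))) \<in> borel_measurable lebesgue"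
  by (intro lebesgue_measurable_continuous continuous_intros)

lemma fourier_integrable:
  fixes f :: "real ^ 'n \<Rightarrow> complex"
  assumes "integrable lebesgue f"
  shows "integrable lebesgue (\<lambda>x. f x * exp (- (\<i> * of_real (p \<bullet> x))))"
proof (rule Bochner_Integration.integrable_bound[OF assms])
  show "(\<lambda>x. f x * exp (- (\<i> * of_real (p \<bullet> x)))) \<in> borel_measurable lebesgue"
    using assms by (intro borel_measurable_times measurable_lebesgue_exp) auto
qed (simp add: norm_mult)

lemma fourier_eq:
  fixes f :: "real ^ 'n \<Rightarrow> complex"
  shows "fourier f p = of_real (1 / fconst TYPE('n)) * (LINT x|lebesgue. f x * exp (- (\<i> * of_real (p \<bullet> x))))"
  by (simp add: fourier_def)

lemma fourier_cong_AE:
  fixes f g :: "real ^ 'n \<Rightarrow> complex"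
  assumes "f \<in> borel_measurable lebesgue" "g \<in> borel_measurable lebesgue" "AE x in lebesgue. f x = g x"
  shows "fourier f = fourier g"
proof
  fix p
  have "(LINT x|lebesgue. f x * exp (- (\<i> * of_real (p \<bullet> x)))) = (LINT x|lebesgue. g x * exp (- (\<i> * of_real (p \<bullet> x))))"
    using assms by (intro integral_cong_AE borel_measurable_times measurable_lebesgue_exp) (auto elim: eventually_mono)
  then show "fourier f p = fourier g p" by (simp only: fourier_eq)
qed

lemma fourier_borel:
  fixes f :: "real ^ 'n \<Rightarrow> complex"
  assumes [measurable]: "f \<in> borel_measurable borel"
  shows "fourier f p = of_real (1 / fconst TYPE('n)) * (LINT x|lborel. f x * exp (- (\<i> * of_real (p \<bullet> x))))"
  unfolding fourier_eq by (subst integral_borel_eq) auto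

text \<open>With a Borel representative of f the transform is a parameter-dependent integral of a
  jointly Borel function.\<close>

lemma fourier_measurable:
  fixes f :: "real ^ 'n \<Rightarrow> complex"
  assumes "f \<in> borel_measurable lebesgue"
  shows "fourier f \<in> borel_measurable borel"
proof -
  obtain g where g[measurable]: "g \<in> borel_measurable borel" and eq: "AE x in lebesgue. f x = g x"
    using lebesgue_ex_borel[OF assms] .
  have "g \<in> borel_measurable lebesgue" by (intro measurable_completion) simp
  from fourier_cong_AE[OF assms this eq]
  have "fourier f = (\<lambda>p. of_real (1 / fconst TYPE('n)) * (LINT x|lborel. g x * exp (- (\<i> * of_real (p \<bullet> x)))))"
    using fourier_borel[OF g] by auto
  then show ?thesis by simp
qed

lemma fourier_bound:
  fixes f :: "real ^ 'n \<Rightarrow> complex"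
  shows "cmod (fourier f p) \<le> 1 / fconst TYPE('n) * (LINT x|lebesgue. cmod (f x))"
proof -
  have "cmod (LINT x|lebesgue. f x * exp (- (\<i> * of_real (p \<bullet> x)))) \<le> (LINT x|lebesgue. cmod (f x * exp (- (\<i> * of_real (p \<bullet> x)))))"
    by (rule integral_norm_bound)
  also have "\<dots> = (LINT x|lebesgue. cmod (f x))" by (simp add: norm_mult)
  finally show ?thesis unfolding fourier_eq norm_mult by (intro mult_mono) (auto simp: norm_divide)
qed

lemma fourier_add:
  fixes f g :: "real ^ 'n \<Rightarrow> complex"
  assumes "integrable lebesgue f" "integrable lebesgue g"
  shows "fourier (\<lambda>x. f x + g x) p = fourier f p + fourier g p"
  using fourier_integrable[OF assms(1), of p] fourier_integrable[OF assms(2), of p]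
  by (simp add: fourier_eq distrib_right distrib_left add_divide_distrib)

lemma fourier_scale:
  fixes f :: "real ^ 'n \<Rightarrow> complex"
  shows "fourier (\<lambda>x. c * f x) p = c * fourier f p"
  by (simp add: fourier_eq mult.assoc)

lemma fourier_diff:
  fixes f g :: "real ^ 'n \<Rightarrow> complex"
  assumes "integrable lebesgue f" "integrable lebesgue g"
  shows "fourier (\<lambda>x. f x - g x) p = fourier f p - fourier g p"
  using fourier_add[OF assms(1), of "\<lambda>x. (- 1) * g x"] assms(2) fourier_scale[of "- 1" g p] by simp

lemma fourier_cnj:
  fixes f :: "real ^ 'n \<Rightarrow> complex"
  shows "fourier (\<lambda>x. cnj (f x)) p = cnj (fourier f (- p))"
proof -
  have "(LINT x|lebesgue. cnj (f x) * exp (- (\<i> * of_real (p \<bullet> x))))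
      = (LINT x|lebesgue. cnj (f x * exp (- (\<i> * of_real (- p \<bullet> x)))))"
    by (simp add: exp_cnj)
  also have "\<dots> = cnj (LINT x|lebesgue. f x * exp (- (\<i> * of_real (- p \<bullet> x))))"
    by (rule Bochner_Integration.integral_cnj)
  finally show ?thesis by (simp add: fourier_eq)
qed

lemma fourier_reflect:
  fixes f :: "real ^ 'n \<Rightarrow> complex"
  shows "fourier (\<lambda>x. f (- x)) p = fourier f (- p)"
  using integral_lebesgue_reflect[of "\<lambda>x. f (- x) * exp (- (\<i> * of_real (p \<bullet> x)))" 0]
  by (simp add: fourier_eq)

text \<open>Fubini for the kernel f(x) exp(-i p x) g(p), whose modulus is |f(x)| |g(p)|. The phase
  is symmetric in x and p, so either order of integration leaves a Fourier transform inside.\<close>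

lemma fourier_multiplication:
  fixes f g :: "real ^ 'n \<Rightarrow> complex"
  assumes f: "integrable lebesgue f" and g: "integrable lebesgue g"
  shows "(LINT p|lebesgue. fourier f p * g p) = (LINT x|lebesgue. f x * fourier g x)"
proof -
  let ?e = "\<lambda>x p :: real ^ 'n. exp (- (\<i> * of_real (p \<bullet> x)))"
  have gm: "g \<in> borel_measurable lebesgue" and fm: "f \<in> borel_measurable lebesgue"
    using g f by auto
  obtain g' where g'[measurable]: "g' \<in> borel_measurable borel" and g'eq: "AE x in lebesgue. g x = g' x"
    using lebesgue_ex_borel[OF gm] .
  obtain f' where f'[measurable]: "f' \<in> borel_measurable borel" and f'eq: "AE x in lebesgue. f x = f' x"
    using lebesgue_ex_borel[OF fm] .
  have m: "g' \<in> borel_measurable lebesgue" "f' \<in> borel_measurable lebesgue"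
    by (intro measurable_completion; simp)+
  have int: "integrable lborel g'" "integrable lborel f'"
    using g f integrable_cong_AE[OF gm m(1) g'eq] integrable_cong_AE[OF fm m(2) f'eq]
    by (auto simp: integral_borel_eq)
  note Ff = fourier_cong_AE[OF fm m(2) f'eq] and Fg = fourier_cong_AE[OF gm m(1) g'eq]
  have [measurable]: "fourier f' \<in> borel_measurable borel" "fourier g' \<in> borel_measurable borel"
    using fourier_measurable m by auto
  have [measurable]: "fourier f' \<in> borel_measurable lebesgue" "fourier g' \<in> borel_measurable lebesgue"
    by (intro measurable_completion; simp)+
  have "integrable (lborel \<Otimes>\<^sub>M lborel) (\<lambda>(x, p). f' x * ?e x p * g' p)"
  proof (rule lborel_pair.Fubini_integrable)
    have eq: "(LINT p|lborel. cmod (f' x * ?e x p * g' p)) = (LINT p|lborel. cmod (g' p)) * cmod (f' x)" for x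
      by (simp add: norm_mult mult.commute)
    show "integrable lborel (\<lambda>x. LINT p|lborel. norm (case (x, p) of (x, p) \<Rightarrow> f' x * ?e x p * g' p))"
      using int by (simp add: eq)
    show "AE x in lborel. integrable lborel (\<lambda>p. case (x, p) of (x, p) \<Rightarrow> f' x * ?e x p * g' p)"
    proof (rule AE_I2)
      fix x
      have "integrable lborel (\<lambda>p. f' x * (?e x p * g' p))"
        by (intro integrable_mult_right Bochner_Integration.integrable_bound[OF int(1)]) (auto simp: norm_mult)
      then show "integrable lborel (\<lambda>p. case (x, p) of (x, p) \<Rightarrow> f' x * ?e x p * g' p)"
        by (simp add: mult.assoc)
    qed
  qed measurable
  from lborel_pair.Fubini_integral[OF this]
  have fub: "(LINT p|lborel. LINT x|lborel. f' x * ?e x p * g' p) = (LINT x|lborel. LINT p|lborel. f' x * ?e x p * g' p)"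
    by simp
  have 1: "(LINT x|lborel. f' x * ?e x p * g' p) = of_real (fconst TYPE('n)) * (fourier f' p * g' p)" for p
    by (simp add: fourier_borel)
  have 2: "(LINT p|lborel. f' x * ?e x p * g' p) = of_real (fconst TYPE('n)) * (f' x * fourier g' x)" for x
    by (simp add: fourier_borel inner_commute mult_ac)
  have "of_real (fconst TYPE('n)) * (LINT p|lborel. fourier f' p * g' p)
      = of_real (fconst TYPE('n)) * (LINT x|lborel. f' x * fourier g' x)"
    using fub unfolding 1 2 integral_mult_right_zero .
  then have "(LINT p|lborel. fourier f' p * g' p) = (LINT x|lborel. f' x * fourier g' x)"
    by simp
  then have "(LINT p|lebesgue. fourier f' p * g' p) = (LINT x|lebesgue. f' x * fourier g' x)"
    by (simp add: integral_borel_eq)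
  moreover have "(LINT p|lebesgue. fourier f' p * g p) = (LINT p|lebesgue. fourier f' p * g' p)"
    using gm m g'eq by (intro integral_cong_AE) (auto elim: eventually_mono)
  moreover have "(LINT p|lebesgue. f p * fourier g' p) = (LINT p|lebesgue. f' p * fourier g' p)"
    using fm m f'eq by (intro integral_cong_AE) (auto elim: eventually_mono)
  ultimately show ?thesis by (simp add: Ff Fg)
qed

text \<open>The factor (2 pi)^(d/2) reflects the normalisation: the product of transforms carries (2
  pi)^(-d/2) twice, the transform of the convolution only once.\<close>

lemma fourier_conv:
  fixes f g :: "real ^ 'n \<Rightarrow> complex"
  assumes g: "integrable lebesgue g" and f: "integrable lebesgue f"
  shows "integrable lebesgue (conv g f)"
    and "fourier (conv g f) p = of_real (fconst TYPE('n)) * fourier g p * fourier f p"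
proof -
  let ?e = "\<lambda>x p :: real ^ 'n. exp (- (\<i> * of_real (p \<bullet> x)))"
  have gm: "g \<in> borel_measurable lebesgue" and fm: "f \<in> borel_measurable lebesgue"
    using g f by auto
  obtain g' where g'[measurable]: "g' \<in> borel_measurable borel" and g'eq: "AE x in lebesgue. g x = g' x"
    using lebesgue_ex_borel[OF gm] .
  obtain f' where f'[measurable]: "f' \<in> borel_measurable borel" and f'eq: "AE x in lebesgue. f x = f' x"
    using lebesgue_ex_borel[OF fm] .
  have m: "g' \<in> borel_measurable lebesgue" "f' \<in> borel_measurable lebesgue"
    by (intro measurable_completion; simp)+
  have int: "integrable lborel g'" "integrable lborel f'"
    using g f integrable_cong_AE[OF gm m(1) g'eq] integrable_cong_AE[OF fm m(2) f'eq]
    by (auto simp: integral_borel_eq)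
  note Ff = fourier_cong_AE[OF fm m(2) f'eq] and Fg = fourier_cong_AE[OF gm m(1) g'eq]
  have eq: "conv g f = conv g' f'" using conv_cong_AE(2)[OF gm m(1) fm m(2) g'eq f'eq] by auto
  have [measurable]: "conv g' f' \<in> borel_measurable borel" by (rule conv_borel(2)[OF g' f'])
  have int_shift: "integrable lborel (\<lambda>x. g' (x - y))" for y
    using int(1) by (simp add: integral_lborel_translate)
  have int2: "integrable (lborel \<Otimes>\<^sub>M lborel) (\<lambda>(y, x). g' (x - y) * f' y * ?e x p)" for p
  proof (rule lborel_pair.Fubini_integrable)
    have eq: "(LINT x|lborel. cmod (g' (x - y) * f' y * ?e x p)) = (LINT x|lborel. cmod (g' x)) * cmod (f' y)" for y
      using integral_lborel_translate(2)[of "\<lambda>z. cmod (g' z)" y] by (simp add: norm_mult)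
    show "integrable lborel (\<lambda>y. LINT x|lborel. norm (case (y, x) of (y, x) \<Rightarrow> g' (x - y) * f' y * ?e x p))"
      using int by (simp add: eq)
    show "AE y in lborel. integrable lborel (\<lambda>x. case (y, x) of (y, x) \<Rightarrow> g' (x - y) * f' y * ?e x p)"
    proof (rule AE_I2)
      fix y
      have "integrable lborel (\<lambda>x. f' y * (g' (x - y) * ?e x p))"
        by (intro integrable_mult_right Bochner_Integration.integrable_bound[OF int_shift[of y]]) (auto simp: norm_mult)
      then show "integrable lborel (\<lambda>x. case (y, x) of (y, x) \<Rightarrow> g' (x - y) * f' y * ?e x p)"
        by (simp add: mult_ac)
    qed
  qed measurable
  \<comment> \<open>At p = 0 the exponential is 1, so integrability on the product space yields that
    of the convolution itself.\<close>
  have "integrable lborel (\<lambda>x. LINT y|lborel. g' (x - y) * f' y * ?e x 0)"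
    using lborel_pair.integrable_snd[OF int2[of 0]] by simp
  then have "integrable lborel (conv g' f')" by (simp add: conv_borel(1)[OF g' f', abs_def])
  then show "integrable lebesgue (conv g f)" unfolding eq by (subst integral_borel_eq) auto
  have "(LINT x|lborel. conv g' f' x * ?e x p) = (LINT x|lborel. LINT y|lborel. g' (x - y) * f' y * ?e x p)"
    by (simp add: conv_borel(1)[OF g' f'])
  also have "\<dots> = (LINT y|lborel. LINT x|lborel. g' (x - y) * f' y * ?e x p)"
    using lborel_pair.Fubini_integral[OF int2[of p]] by simp
  also have "\<dots> = (LINT y|lborel. f' y * ?e y p * (LINT x|lborel. g' x * ?e x p))"
  proof (rule Bochner_Integration.integral_cong[OF refl])
    fix y
    have "(LINT x|lborel. g' (x - y) * f' y * ?e x p) = (LINT x|lborel. f' y * ?e y p * (g' (x - y) * ?e (x - y) p))"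
      by (simp add: inner_diff_right algebra_simps flip: exp_add)
    also have "\<dots> = f' y * ?e y p * (LINT x|lborel. g' (x - y) * ?e (x - y) p)"
      by simp
    also have "(LINT x|lborel. g' (x - y) * ?e (x - y) p) = (LINT x|lborel. g' x * ?e x p)"
      by (rule integral_lborel_translate(2)[of "\<lambda>z. g' z * ?e z p"]) measurable
    finally show "(LINT x|lborel. g' (x - y) * f' y * ?e x p) = f' y * ?e y p * (LINT x|lborel. g' x * ?e x p)" .
  qed
  also have "\<dots> = (LINT x|lborel. g' x * ?e x p) * (LINT y|lborel. f' y * ?e y p)"
    by simp
  finally have "(LINT x|lborel. conv g' f' x * ?e x p) = (LINT x|lborel. g' x * ?e x p) * (LINT y|lborel. f' y * ?e y p)" .
  then show "fourier (conv g f) p = of_real (fconst TYPE('n)) * fourier g p * fourier f p"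
    unfolding eq Ff Fg by (simp add: fourier_borel)
qed

section \<open>The Gaussian\<close>

lemma borel_measurable_cnj [measurable]: "cnj \<in> borel_measurable borel"
  by (intro borel_measurable_continuous_onI continuous_intros)

text \<open>A product over coordinates, so that its integrals reduce to the known characteristic
  function of the one-dimensional normal law; \<open>gauss_eq\<close> recovers the radial
  form.\<close>

definition gauss :: "'a :: euclidean_space \<Rightarrow> real" where
  "gauss x = (\<Prod>b\<in>Basis. std_normal_density (x \<bullet> b))"

lemma norm_power2_Basis:
  fixes x :: "'a :: euclidean_space"
  shows "(norm x)\<^sup>2 = (\<Sum>b\<in>Basis. (x \<bullet> b)\<^sup>2)"
  unfolding power2_norm_eq_inner by (subst euclidean_inner) (simp only: power2_eq_square)

lemma gauss_eq:
  fixes x :: "real ^ 'n"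
  shows "gauss x = exp (- (norm x)\<^sup>2 / 2) / fconst TYPE('n)"
proof -
  have "sqrt (2 * pi) ^ n = (2 * pi) powr (real n / 2)" for n
    by (simp add: powr_half_sqrt[symmetric] powr_powr flip: powr_realpow)
  then show ?thesis
    unfolding norm_power2_Basis
    by (simp add: gauss_def std_normal_density_def prod_dividef exp_sum sum_negf sum_divide_distrib[symmetric] flip: exp_sum)
qed

lemma gauss_pos [simp]: "gauss x > 0"
  by (simp add: gauss_def prod_pos normal_density_pos)

lemma gauss_measurable [measurable]: "gauss \<in> borel_measurable (borel :: ('a :: euclidean_space) measure)"
  unfolding gauss_def by measurable

lemma std_normal_fourier:
  "integrable lborel (\<lambda>x. of_real (std_normal_density x) * exp (\<i> * of_real (t * x)))"
  "(LINT x|lborel. of_real (std_normal_density x) * exp (\<i> * of_real (t * x))) = complex_of_real (exp (- t\<^sup>2 / 2))"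
proof -
  have "integrable lborel (\<lambda>x. std_normal_density x)" by (rule integrable_normal_density) simp
  then show "integrable lborel (\<lambda>x. of_real (std_normal_density x) * exp (\<i> * of_real (t * x)))"
    by (rule Bochner_Integration.integrable_bound) (auto simp: norm_mult)
  have "char std_normal_distribution t = (LINT x|lborel. std_normal_density x *\<^sub>R exp (\<i> * of_real (t * x)))"
    unfolding char_def by (subst integral_density) (auto simp: normal_density_nonneg)
  then show "(LINT x|lborel. of_real (std_normal_density x) * exp (\<i> * of_real (t * x))) = complex_of_real (exp (- t\<^sup>2 / 2))"
    by (simp add: char_std_normal_distribution scaleR_conv_of_real)
qed

text \<open>\<open>lborel\<close> is the image of a product of one-dimensional Lebesgue measures, on
  which the integrand factors over the basis. The sign in the exponent is that of the characteristic
  function, opposite to \<open>fourier\<close>.\<close>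

lemma gauss_fourier:
  fixes t :: "'a :: euclidean_space"
  shows "integrable lborel (\<lambda>x. of_real (gauss x) * exp (\<i> * of_real (t \<bullet> x)))"
    and "(LINT x|lborel. of_real (gauss x) * exp (\<i> * of_real (t \<bullet> x))) = complex_of_real (exp (- (norm t)\<^sup>2 / 2))"
proof -
  interpret product_sigma_finite "\<lambda>_::'a. lborel :: real measure" by standard
  let ?h = "\<lambda>b x. of_real (std_normal_density x) * exp (\<i> * of_real ((t \<bullet> b) * x)) :: complex"
  let ?F = "\<lambda>x::'a. of_real (gauss x) * exp (\<i> * of_real (t \<bullet> x)) :: complex"
  have F: "?F x = (\<Prod>b\<in>Basis. ?h b (x \<bullet> b))" for x
    by (subst euclidean_inner) (simp add: gauss_def prod.distrib sum_distrib_left flip: exp_sum)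
  have [measurable]: "?F \<in> borel_measurable borel" by measurable
  have eq: "?F (\<Sum>b\<in>Basis. y b *\<^sub>R b) = (\<Prod>b\<in>Basis. ?h b (y b))" for y
    unfolding F by (intro prod.cong) auto
  have [measurable]: "(\<lambda>f. \<Sum>b\<in>Basis. f b *\<^sub>R b) \<in> (\<Pi>\<^sub>M b\<in>Basis. lborel) \<rightarrow>\<^sub>M (borel :: 'a measure)"
    by measurable
  have "integrable (\<Pi>\<^sub>M b\<in>Basis. lborel) (\<lambda>y. \<Prod>b\<in>Basis. ?h b (y b))"
    by (intro product_integrable_prod std_normal_fourier) auto
  then show "integrable lborel ?F"
    by (subst lborel_eq, subst integrable_distr_eq) (simp_all only: eq, measurable)
  have "(LINT x|lborel. ?F x) = (LINT y|(\<Pi>\<^sub>M b\<in>Basis. lborel). (\<Prod>b\<in>Basis. ?h b (y b)))"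
    by (subst lborel_eq, subst integral_distr) (simp_all only: eq, measurable)
  also have "\<dots> = (\<Prod>b\<in>Basis. LINT x|lborel. ?h b x)"
    by (intro product_integral_prod std_normal_fourier) auto
  also have "\<dots> = (\<Prod>b\<in>Basis. complex_of_real (exp (- (t \<bullet> b)\<^sup>2 / 2)))"
    by (simp only: std_normal_fourier)
  also have "\<dots> = complex_of_real (exp (\<Sum>b\<in>Basis. - (t \<bullet> b)\<^sup>2 / 2))"
    by (simp add: exp_sum)
  also have "(\<Sum>b\<in>Basis. - (t \<bullet> b)\<^sup>2 / 2) = - (norm t)\<^sup>2 / 2"
    unfolding norm_power2_Basis by (simp add: sum_negf sum_divide_distrib)
  finally show "(LINT x|lborel. ?F x) = complex_of_real (exp (- (norm t)\<^sup>2 / 2))" .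
qed

lemma gauss_integral:
  "integrable lborel (gauss :: 'a :: euclidean_space \<Rightarrow> real)" "(LINT x::'a|lborel. gauss x) = 1"
proof -
  have *: "integrable lborel (\<lambda>x::'a. complex_of_real (gauss x))"
    "(LINT x::'a|lborel. complex_of_real (gauss x)) = 1"
    using gauss_fourier[of "0 :: 'a"] by simp_all
  from *(1) show "integrable lborel (gauss :: 'a \<Rightarrow> real)" by (simp add: complex_of_real_integrable_eq)
  show "(LINT x::'a|lborel. gauss x) = 1" using *(2) by (simp add: integral_complex_of_real)
qed

text \<open>Centred normal density of standard deviation s in each coordinate: an approximate
  identity as s tends to 0, of mass 1 for every positive s.\<close>

definition kern :: "real \<Rightarrow> real ^ 'n \<Rightarrow> complex" where
  "kern s x = of_real (gauss (x /\<^sub>R s) / s ^ CARD('n))"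

lemma kern_measurable [measurable]: "kern s \<in> borel_measurable borel"
  unfolding kern_def by measurable

lemma kern_L1:
  assumes "s > 0"
  shows "integrable lebesgue (kern s :: real ^ 'n \<Rightarrow> complex)"
    "(LINT x::real^'n|lebesgue. cmod (kern s x)) = 1"
proof -
  let ?k = "\<lambda>x :: real ^ 'n. gauss (x /\<^sub>R s) / s ^ CARD('n)"
  have "integrable lborel (\<lambda>x :: real ^ 'n. ?k (0 + s *\<^sub>R x))"
    using assms gauss_integral(1)[where 'a = "real ^ 'n"] by simp
  then have 1: "integrable lborel ?k"
    using assms by (subst (asm) integral_lborel_affine(1)) auto
  have 2: "(LINT x|lborel. ?k x) = 1"
    using assms gauss_integral(2)[where 'a = "real ^ 'n"]
    by (subst integral_lborel_affine(2)[of _ s 0]) auto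
  have "integrable lborel (kern s :: real ^ 'n \<Rightarrow> complex)"
    unfolding kern_def using 1 by (simp add: complex_of_real_integrable_eq del: of_real_divide)
  then show "integrable lebesgue (kern s :: real ^ 'n \<Rightarrow> complex)" by (subst integral_borel_eq) auto
  have "cmod (kern s x) = ?k x" for x
    using assms unfolding kern_def norm_of_real by (simp add: less_imp_le)
  then show "(LINT x::real^'n|lebesgue. cmod (kern s x)) = 1"
    using 2 by (subst integral_borel_eq) auto
qed

text \<open>The substitution y = x - s z moves s from the kernel into the argument of f, so that a
  limit in s can be taken under a fixed Gaussian weight.\<close>

lemma conv_kern_eq:
  fixes f :: "real ^ 'n \<Rightarrow> complex"
  assumes f: "f \<in> borel_measurable lebesgue" and s: "s > 0"
  shows "conv (kern s) f x = (LINT z|lebesgue. of_real (gauss z) * f (x - s *\<^sub>R z))"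
proof -
  obtain f' where f'[measurable]: "f' \<in> borel_measurable borel" and f'eq: "AE x in lebesgue. f x = f' x"
    using lebesgue_ex_borel[OF f] .
  have m: "f' \<in> borel_measurable lebesgue" "(kern s :: real ^ 'n \<Rightarrow> complex) \<in> borel_measurable lebesgue"
      "(\<lambda>z :: real ^ 'n. complex_of_real (gauss z)) \<in> borel_measurable lebesgue"
    by (intro measurable_completion; simp)+
  have T: "(\<lambda>z. x - s *\<^sub>R z) \<in> lebesgue \<rightarrow>\<^sub>M lebesgue"
    using lebesgue_affine_measurable'[of "- s" x] s by simp
  have "AE z in lebesgue. f (x - s *\<^sub>R z) = f' (x - s *\<^sub>R z)"
  proof -
    \<comment> \<open>A positive constant density does not change null sets, so an a.e. statement
      for \<open>lebesgue\<close> holds for the image measure and can be pulled back along the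
      affine map.\<close>
    have L: "lebesgue = density (distr lebesgue lebesgue (\<lambda>z. x - s *\<^sub>R z)) (\<lambda>_. ennreal (s ^ CARD('n)))"
      using lebesgue_affine[of "- s" x] s by simp
    have "AE y in density (distr lebesgue lebesgue (\<lambda>z. x - s *\<^sub>R z)) (\<lambda>_. ennreal (s ^ CARD('n))). f y = f' y"
      by (subst L[symmetric]) (rule f'eq)
    then have "AE y in distr lebesgue lebesgue (\<lambda>z. x - s *\<^sub>R z). f y = f' y"
      using s by (subst (asm) AE_density) auto
    then show ?thesis by (rule AE_distrD[OF T])
  qed
  then have "(LINT z|lebesgue. of_real (gauss z) * f (x - s *\<^sub>R z)) = (LINT z|lebesgue. of_real (gauss z) * f' (x - s *\<^sub>R z))"
    by (intro integral_cong_AE borel_measurable_times m measurable_compose[OF T] f) (auto elim: eventually_mono)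
  also have "\<dots> = (LINT z|lborel. of_real (gauss z) * f' (x - s *\<^sub>R z))"
    by (rule integral_borel_eq) measurable
  also have "\<dots> = (LINT y|lborel. kern s (x - y) * f' y)"
    using s by (subst (2) integral_lborel_affine(2)[of _ "- s" x])
      (auto simp: kern_def scaleR_conv_of_real[where 'a = complex])
  also have "\<dots> = conv (kern s) f' x" by (simp add: conv_borel)
  also have "\<dots> = conv (kern s) f x" by (rule conv_cong_AE(2)[OF m(2) m(2) f m(1) _ f'eq, symmetric]) simp
  finally show ?thesis by simp
qed

section \<open>Plancherel on a dense class\<close>

text \<open>The damping weight is a constant multiple of \<open>kern (1 / s)\<close>, hence
  integrable, and g is bounded.\<close>

lemma damped_integrable:
  fixes g :: "real ^ 'n \<Rightarrow> complex"
  assumes [measurable]: "g \<in> borel_measurable borel" and B: "\<And>p. cmod (g p) \<le> B" and s: "s > 0"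
  shows "integrable lebesgue (\<lambda>p. g p * of_real (exp (- (s * norm p)\<^sup>2 / 2)))"
proof -
  have "integrable lborel (\<lambda>p :: real ^ 'n. of_real (fconst TYPE('n)) * kern (1 / s) p * of_real ((1 / s) ^ CARD('n)))"
    using kern_L1(1)[of "1 / s", where 'n = 'n] s by (simp add: integral_borel_eq)
  moreover have "of_real (exp (- (s * norm p)\<^sup>2 / 2)) = of_real (fconst TYPE('n)) * kern (1 / s) p * of_real ((1 / s) ^ CARD('n))"
    for p :: "real ^ 'n"
    using s by (simp add: kern_def gauss_eq power_mult_distrib)
  ultimately have w: "integrable lborel (\<lambda>p :: real ^ 'n. complex_of_real (exp (- (s * norm p)\<^sup>2 / 2)))" by simp
  have B0: "B \<ge> 0" using order_trans[OF norm_ge_zero B] .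
  have "integrable lborel (\<lambda>p. g p * of_real (exp (- (s * norm p)\<^sup>2 / 2)))"
  proof (rule Bochner_Integration.integrable_bound)
    show "integrable lborel (\<lambda>p :: real ^ 'n. of_real B * complex_of_real (exp (- (s * norm p)\<^sup>2 / 2)))"
      by (intro integrable_mult_right w)
    show "AE p in lborel. cmod (g p * of_real (exp (- (s * norm p)\<^sup>2 / 2)))
        \<le> cmod (of_real B * complex_of_real (exp (- (s * norm p)\<^sup>2 / 2)))"
      using B B0 by (auto simp: norm_mult)
  qed measurable
  then show ?thesis by (subst integral_borel_eq) auto
qed

text \<open>Take g to be the conjugate of f^ times the damping weight: the integral of f^ g is the
  left side, and the transform of g is the conjugate of the mollified f. The weight makes g
  integrable, which the conjugate of f^ alone need not be.\<close>

lemma damped_plancherel: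
  fixes f :: "real ^ 'n \<Rightarrow> complex"
  assumes f: "integrable lebesgue f" and s: "s > 0"
  shows "(LINT p|lebesgue. of_real ((cmod (fourier f p))\<^sup>2 * exp (- (s * norm p)\<^sup>2 / 2)))
    = (LINT x|lebesgue. f x * cnj (conv (kern s) f x))"
proof -
  let ?w = "\<lambda>p :: real ^ 'n. complex_of_real (exp (- (s * norm p)\<^sup>2 / 2))"
  have fm: "f \<in> borel_measurable lebesgue" using f by auto
  have [measurable]: "fourier f \<in> borel_measurable borel" by (rule fourier_measurable[OF fm])
  let ?g = "\<lambda>p. cnj (fourier f p) * ?w p"
  have g: "integrable lebesgue ?g"
  proof (rule damped_integrable[OF _ _ s])
    show "(\<lambda>p. cnj (fourier f p)) \<in> borel_measurable borel"
      by measurable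
    show "cmod (cnj (fourier f p)) \<le> 1 / fconst TYPE('n) * (LINT x|lebesgue. cmod (f x))" for p
      unfolding complex_mod_cnj by (rule fourier_bound)
  qed
  have gx: "fourier ?g x = cnj (conv (kern s) f x)" for x
  proof -
    \<comment> \<open>Plane wave times damping weight; its transform at y is the kernel at x - y, up
      to the factor (2 pi)^(d/2).\<close>
    let ?e = "\<lambda>p :: real ^ 'n. exp (\<i> * of_real (x \<bullet> p)) * ?w p"
    have e: "integrable lebesgue ?e"
      by (rule damped_integrable[OF _ _ s, where B = 1]) auto
    have eF: "fourier ?e y = of_real (fconst TYPE('n)) * kern s (x - y)" for y
    proof -
      let ?H = "\<lambda>p. ?w p * exp (\<i> * of_real ((x - y) \<bullet> p))"
      let ?t = "(x - y) /\<^sub>R s"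
      have [measurable]: "?H \<in> borel_measurable borel" by measurable
      have "exp (\<i> * of_real (x \<bullet> p)) * exp (- (\<i> * of_real (y \<bullet> p))) = exp (\<i> * of_real ((x - y) \<bullet> p))" for p
        unfolding mult_exp_exp by (simp add: inner_diff_left right_diff_distrib)
      note ee = this
      have eH: "?e p * exp (- (\<i> * of_real (y \<bullet> p))) = ?H p" for p
        unfolding ee[symmetric] by (simp only: mult_ac)
      have "fourier ?e y = of_real (1 / fconst TYPE('n)) * (LINT p|lborel. ?e p * exp (- (\<i> * of_real (y \<bullet> p))))"
        by (rule fourier_borel) measurable
      also have "(LINT p|lborel. ?e p * exp (- (\<i> * of_real (y \<bullet> p)))) = (LINT p|lborel. ?H p)"
        unfolding eH ..
      \<comment> \<open>Rescaling p = q / s turns the weight into a multiple of the standard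
        Gaussian, whose transform is known.\<close>
      also have "(LINT p|lborel. ?H p) = \<bar>1 / s\<bar> ^ DIM(real^'n) *\<^sub>R (LINT q|lborel. ?H (0 + (1 / s) *\<^sub>R q))"
        using s by (intro integral_lborel_affine(2)) auto
      also have "(\<lambda>q. ?H (0 + (1 / s) *\<^sub>R q))
          = (\<lambda>q. of_real (fconst TYPE('n)) * (of_real (gauss q) * exp (\<i> * of_real (?t \<bullet> q))))"
      proof
        fix q :: "real ^ 'n"
        have "s * norm (0 + (1 / s) *\<^sub>R q) = norm q" using s by simp
        moreover have "(x - y) \<bullet> (0 + (1 / s) *\<^sub>R q) = ?t \<bullet> q" by (simp add: divide_inverse)
        ultimately show "?H (0 + (1 / s) *\<^sub>R q) = of_real (fconst TYPE('n)) * (of_real (gauss q) * exp (\<i> * of_real (?t \<bullet> q)))"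
          by (simp add: gauss_eq)
      qed
      also have "(LINT q|lborel. of_real (fconst TYPE('n)) * (of_real (gauss q) * exp (\<i> * of_real (?t \<bullet> q))))
          = complex_of_real (fconst TYPE('n) * exp (- (norm ?t)\<^sup>2 / 2))"
        unfolding integral_mult_right_zero gauss_fourier(2) by simp
      finally have "fourier ?e y = of_real (1 / fconst TYPE('n) * (\<bar>1 / s\<bar> ^ CARD('n) * (fconst TYPE('n) * exp (- (norm ?t)\<^sup>2 / 2))))"
        by (simp add: scaleR_conv_of_real[where 'a = complex])
      also have "\<dots> = of_real (fconst TYPE('n)) * kern s (x - y)"
        using s by (simp add: kern_def gauss_eq power_one_over)
      finally show ?thesis .
    qed
    \<comment> \<open>Conjugation puts f^ itself in place of its conjugate, which permits the second
      use of the multiplication formula.\<close>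
    have "cnj (fourier ?g x) = fourier (\<lambda>p. cnj (?g p)) (- x)"
      by (subst fourier_cnj) simp
    also have "\<dots> = of_real (1 / fconst TYPE('n)) * (LINT p|lebesgue. fourier f p * ?e p)"
      unfolding fourier_eq[of "\<lambda>p. cnj (?g p)"] by (simp add: mult_ac)
    also have "(LINT p|lebesgue. fourier f p * ?e p) = (LINT y|lebesgue. f y * fourier ?e y)"
      by (rule fourier_multiplication[OF f e])
    also have "\<dots> = (LINT y|lebesgue. of_real (fconst TYPE('n)) * (kern s (x - y) * f y))"
      unfolding eF by (simp only: mult_ac)
    also have "\<dots> = of_real (fconst TYPE('n)) * conv (kern s) f x"
      unfolding conv_def by (rule integral_mult_right_zero)
    also have "of_real (1 / fconst TYPE('n)) * (of_real (fconst TYPE('n)) * conv (kern s) f x) = conv (kern s) f x"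
      by simp
    finally show ?thesis unfolding complex_cnj_cancel_iff[symmetric, of "fourier ?g x"] complex_cnj_cnj .
  qed
  have 1: "(LINT p|lebesgue. fourier f p * ?g p) = (LINT x|lebesgue. f x * fourier ?g x)"
    by (rule fourier_multiplication[OF f g])
  have 2: "fourier f p * ?g p = of_real ((cmod (fourier f p))\<^sup>2 * exp (- (s * norm p)\<^sup>2 / 2))" for p
    by (simp only: of_real_mult complex_norm_square mult.assoc)
  show ?thesis using 1 unfolding 2 gx .
qed

text \<open>By Cauchy-Schwarz, and Young with a kernel of mass 1, the damped integrals are at most
  the squared norm of f, uniformly in s; Fatou removes the damping. The result is only an
  inequality, but it puts f^ in L2 for every f in both L1 and L2.\<close>

lemma fourier_contraction:
  fixes f :: "real ^ 'n \<Rightarrow> complex"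
  assumes f: "integrable lebesgue f" "f \<in> L2"
  shows "fourier f \<in> L2" "norm2 (fourier f) \<le> norm2 f"
proof -
  have fm: "f \<in> borel_measurable lebesgue" using f by auto
  have [measurable]: "fourier f \<in> borel_measurable borel" by (rule fourier_measurable[OF fm])
  have Fm: "fourier f \<in> borel_measurable lebesgue" by (intro measurable_completion) simp
  define s where "s n = 1 / real (Suc n)" for n
  have s: "s n > 0" for n by (simp add: s_def)
  have s0: "s \<longlonglongrightarrow> 0" unfolding s_def by (rule LIMSEQ_Suc[OF lim_1_over_n])
  let ?h = "\<lambda>n p. (cmod (fourier f p))\<^sup>2 * exp (- (s n * norm p)\<^sup>2 / 2)"
  have hm: "?h n \<in> borel_measurable lebesgue" for n by (intro measurable_completion) simp
  have le: "(\<integral>\<^sup>+p. ennreal (?h n p) \<partial>lebesgue) \<le> ennreal ((norm2 f)\<^sup>2)" for n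
  proof -
    note K = conv_L2[OF kern_L1(1)[OF s[of n], where 'n = 'n] f(2)]
    have "cmod (LINT x|lebesgue. f x * cnj (conv (kern (s n)) f x)) \<le> (LINT x|lebesgue. norm (f x) * norm (conv (kern (s n)) f x))"
      using integral_norm_bound[of lebesgue "\<lambda>x. f x * cnj (conv (kern (s n)) f x)"] by (simp add: norm_mult)
    also have "\<dots> \<le> norm2 f * norm2 (conv (kern (s n)) f)" by (rule L2_mult(2)[OF f(2) K(2)])
    also have "\<dots> \<le> norm2 f * norm2 f"
      using K(3) by (intro mult_left_mono) (simp_all add: kern_L1(2)[OF s])
    finally have "cmod (LINT p|lebesgue. complex_of_real (?h n p)) \<le> (norm2 f)\<^sup>2"
      unfolding damped_plancherel[OF f(1) s] by (simp add: power2_eq_square)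
    then have *: "(LINT p|lebesgue. ?h n p) \<le> (norm2 f)\<^sup>2"
      unfolding integral_complex_of_real norm_of_real by simp
    have "integrable lebesgue (?h n)"
    proof -
      have "integrable lebesgue (\<lambda>p. complex_of_real (?h n p))"
      proof -
        have "(\<lambda>p. complex_of_real ((cmod (fourier f p))\<^sup>2)) \<in> borel_measurable borel" by measurable
        moreover have "cmod (complex_of_real ((cmod (fourier f p))\<^sup>2)) \<le> (1 / fconst TYPE('n) * (LINT x|lebesgue. cmod (f x)))\<^sup>2" for p
          using power_mono[OF fourier_bound[of f p] norm_ge_zero, of 2] by (simp add: norm_power)
        ultimately show ?thesis unfolding of_real_mult using s by (rule damped_integrable)
      qed
      then show ?thesis by (simp only: complex_of_real_integrable_eq)
    qed
    then show ?thesis using * by (subst nn_integral_eq_integral) (auto intro: ennreal_leI)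
  qed
  have "(\<integral>\<^sup>+p. ennreal ((norm (fourier f p))\<^sup>2) \<partial>lebesgue) = (\<integral>\<^sup>+p. liminf (\<lambda>n. ennreal (?h n p)) \<partial>lebesgue)"
  proof (rule nn_integral_cong)
    fix p
    have "(\<lambda>n. ennreal (?h n p)) \<longlonglongrightarrow> ennreal ((cmod (fourier f p))\<^sup>2 * exp (- (0 * norm p)\<^sup>2 / 2))"
      by (intro tendsto_ennrealI tendsto_intros s0) auto
    then show "ennreal ((norm (fourier f p))\<^sup>2) = liminf (\<lambda>n. ennreal (?h n p))"
      by (subst lim_imp_Liminf[OF trivial_limit_sequentially]) auto
  qed
  also have "\<dots> \<le> liminf (\<lambda>n. \<integral>\<^sup>+p. ennreal (?h n p) \<partial>lebesgue)"
    by (intro nn_integral_liminf measurable_compose[OF hm measurable_ennreal])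
  also have "\<dots> \<le> liminf (\<lambda>n::nat. ennreal ((norm2 f)\<^sup>2))"
    by (intro Liminf_mono always_eventually allI le)
  also have "\<dots> = ennreal ((norm2 f)\<^sup>2)" by (simp add: Liminf_const)
  finally show "fourier f \<in> L2" "norm2 (fourier f) \<le> norm2 f"
    using L2_nn_integralI[OF Fm norm2_nonneg] by auto
qed

text \<open>Continuity makes the mollifications converge to f at every point and boundedness keeps
  them below one constant B, so B |f| is a majorant for the inner products. On the Fourier side the
  majorant is |f^|^2, integrable by \<open>fourier_contraction\<close>.\<close>

lemma fourier_isometry_continuous:
  fixes f :: "real ^ 'n \<Rightarrow> complex"
  assumes f: "integrable lebesgue f" "f \<in> L2" and cont: "continuous_on UNIV f" and bdd: "bounded (range f)"
  shows "norm2 (fourier f) = norm2 f"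
proof -
  have fm: "f \<in> borel_measurable lebesgue" using f by auto
  have [measurable]: "f \<in> borel_measurable borel" by (rule borel_measurable_continuous_onI[OF cont])
  have [measurable]: "fourier f \<in> borel_measurable borel" by (rule fourier_measurable[OF fm])
  obtain B where B: "\<And>x. cmod (f x) \<le> B" using bdd by (auto simp: bounded_iff)
  have B0: "B \<ge> 0" using order_trans[OF norm_ge_zero B] .
  define s where "s n = 1 / real (Suc n)" for n
  have s: "s n > 0" for n by (simp add: s_def)
  have s0: "s \<longlonglongrightarrow> 0" unfolding s_def by (rule LIMSEQ_Suc[OF lim_1_over_n])
  let ?h = "\<lambda>n p. (cmod (fourier f p))\<^sup>2 * exp (- (s n * norm p)\<^sup>2 / 2)"
  have gi: "integrable lebesgue (\<lambda>z :: real ^ 'n. B * gauss z)"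
    using gauss_integral(1)[where 'a = "real ^ 'n"] by (subst integral_borel_eq) auto
  have gm: "(\<lambda>z :: real ^ 'n. complex_of_real (gauss z)) \<in> borel_measurable lebesgue"
    by (intro measurable_completion) simp
  have cb: "cmod (conv (kern (s n)) f x) \<le> B" for n x
  proof -
    have "cmod (conv (kern (s n)) f x) \<le> (LINT z|lebesgue. cmod (of_real (gauss z) * f (x - s n *\<^sub>R z)))"
      unfolding conv_kern_eq[OF fm s] by (rule integral_norm_bound)
    also have "\<dots> \<le> (LINT z :: real ^ 'n|lebesgue. B * gauss z)"
    proof (rule integral_mono_AE'[OF gi])
      show "AE z in lebesgue. cmod (of_real (gauss z) * f (x - s n *\<^sub>R z)) \<le> B * gauss z"
        using B by (auto simp: norm_mult less_imp_le mult.commute intro!: mult_right_mono)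
    qed (use B0 in \<open>auto intro!: AE_I2 mult_nonneg_nonneg less_imp_le[OF gauss_pos]\<close>)
    also have "\<dots> = B" using gauss_integral(2)[where 'a = "real ^ 'n"] by (simp add: integral_borel_eq)
    finally show ?thesis .
  qed
  have cl: "(\<lambda>n. conv (kern (s n)) f x) \<longlonglongrightarrow> f x" for x
  proof -
    have "(\<lambda>n. LINT z|lebesgue. of_real (gauss z) * f (x - s n *\<^sub>R z)) \<longlonglongrightarrow> (LINT z :: real ^ 'n|lebesgue. of_real (gauss z) * f x)"
    proof (rule integral_dominated_convergence)
      show "integrable lebesgue (\<lambda>z :: real ^ 'n. B * gauss z)" by (rule gi)
      show "AE z in lebesgue. (\<lambda>n. of_real (gauss z) * f (x - s n *\<^sub>R z)) \<longlonglongrightarrow> of_real (gauss z) * f x"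
      proof (rule AE_I2)
        fix z :: "real ^ 'n"
        have "(\<lambda>n. x - s n *\<^sub>R z) \<longlonglongrightarrow> x - 0 *\<^sub>R z" by (intro tendsto_intros s0)
        moreover have "isCont f x" using cont by (simp add: continuous_on_eq_continuous_at)
        ultimately show "(\<lambda>n. of_real (gauss z) * f (x - s n *\<^sub>R z)) \<longlonglongrightarrow> of_real (gauss z) * f x"
          by (intro tendsto_intros isCont_tendsto_compose[of x f]) auto
      qed
      show "AE z in lebesgue. cmod (of_real (gauss z) * f (x - s n *\<^sub>R z)) \<le> B * gauss z" for n
        using B by (auto simp: norm_mult less_imp_le mult.commute intro!: mult_right_mono)
      show "(\<lambda>z. of_real (gauss z) * f (x - s n *\<^sub>R z)) \<in> borel_measurable lebesgue" for n
        by (intro measurable_completion) simp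
      show "(\<lambda>z :: real ^ 'n. of_real (gauss z) * f x) \<in> borel_measurable lebesgue"
        by (intro measurable_completion) simp
    qed
    moreover have "(LINT z :: real ^ 'n|lebesgue. complex_of_real (gauss z)) = 1"
      using gauss_integral(2)[where 'a = "real ^ 'n"] by (simp add: integral_borel_eq integral_complex_of_real)
    ultimately show ?thesis by (simp add: conv_kern_eq[OF fm s])
  qed
  have cm: "conv (kern (s n)) f \<in> borel_measurable lebesgue" for n
    using L2_D(1)[OF conv_L2(2)[OF kern_L1(1)[OF s] f(2)]] .
  have "(\<lambda>n. LINT x|lebesgue. f x * cnj (conv (kern (s n)) f x)) \<longlonglongrightarrow> (LINT x|lebesgue. f x * cnj (f x))"
  proof (rule integral_dominated_convergence)
    show "integrable lebesgue (\<lambda>x. cmod (f x) * B)" using f(1) by auto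
    show "AE x in lebesgue. (\<lambda>n. f x * cnj (conv (kern (s n)) f x)) \<longlonglongrightarrow> f x * cnj (f x)"
      by (intro AE_I2 tendsto_intros cl)
    show "AE x in lebesgue. norm (f x * cnj (conv (kern (s n)) f x)) \<le> cmod (f x) * B" for n
      using cb by (auto simp: norm_mult intro!: mult_left_mono)
    show "(\<lambda>x. f x * cnj (conv (kern (s n)) f x)) \<in> borel_measurable lebesgue" for n
      by (intro borel_measurable_times fm measurable_compose[OF cm borel_measurable_cnj])
    show "(\<lambda>x. f x * cnj (f x)) \<in> borel_measurable lebesgue"
      by (intro borel_measurable_times fm measurable_compose[OF fm borel_measurable_cnj])
  qed
  moreover have "(LINT x|lebesgue. f x * cnj (f x)) = of_real ((norm2 f)\<^sup>2)"
    unfolding norm2_power2 by (simp add: complex_norm_square[symmetric] flip: integral_complex_of_real)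
  ultimately have 1: "(\<lambda>n. LINT p|lebesgue. complex_of_real (?h n p)) \<longlonglongrightarrow> of_real ((norm2 f)\<^sup>2)"
    by (simp only: damped_plancherel[OF f(1) s])
  have F: "integrable lebesgue (\<lambda>p. (norm (fourier f p))\<^sup>2)"
    using L2_D(2)[OF fourier_contraction(1)[OF f]] .
  have "(\<lambda>n. LINT p|lebesgue. ?h n p) \<longlonglongrightarrow> (LINT p|lebesgue. (norm (fourier f p))\<^sup>2)"
  proof (rule integral_dominated_convergence[OF _ _ F])
    show "AE p in lebesgue. (\<lambda>n. ?h n p) \<longlonglongrightarrow> (cmod (fourier f p))\<^sup>2"
    proof (rule AE_I2)
      fix p :: "real ^ 'n"
      have "(\<lambda>n. ?h n p) \<longlonglongrightarrow> (cmod (fourier f p))\<^sup>2 * exp (- (0 * norm p)\<^sup>2 / 2)"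
        by (intro tendsto_intros s0) auto
      then show "(\<lambda>n. ?h n p) \<longlonglongrightarrow> (cmod (fourier f p))\<^sup>2" by simp
    qed
    show "AE p in lebesgue. norm (?h n p) \<le> (cmod (fourier f p))\<^sup>2" for n
      by (auto simp: mult_left_le)
    show "?h n \<in> borel_measurable lebesgue" for n by (intro measurable_completion) simp
    show "(\<lambda>p. (cmod (fourier f p))\<^sup>2) \<in> borel_measurable lebesgue" by (intro measurable_completion) simp
  qed
  then have "(\<lambda>n. LINT p|lebesgue. ?h n p) \<longlonglongrightarrow> (norm2 (fourier f))\<^sup>2" by (simp add: norm2_power2)
  then have "(\<lambda>n. complex_of_real (LINT p|lebesgue. ?h n p)) \<longlonglongrightarrow> of_real ((norm2 (fourier f))\<^sup>2)"
    by (rule tendsto_of_real)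
  with 1 have "complex_of_real ((norm2 f)\<^sup>2) = of_real ((norm2 (fourier f))\<^sup>2)"
    by (intro LIMSEQ_unique) (simp_all only: integral_complex_of_real)
  then show ?thesis by (simp add: power2_eq_iff_nonneg flip: of_real_power)
qed

section \<open>The Fourier transform on L2\<close>

lemma L2_dist_sq_eq:
  fixes f g :: "real ^ 'n \<Rightarrow> complex"
  assumes "f \<in> L2" "g \<in> L2"
  shows "L2_dist_sq f g = ennreal ((norm2 (\<lambda>x. f x - g x))\<^sup>2)"
  unfolding L2_dist_sq_def by (rule nn_integral_norm2[OF L2_diff(1)[OF assms]])

lemma L2_dist_sq_tendsto_0_iff:
  fixes f :: "real ^ 'n \<Rightarrow> complex"
  assumes "f \<in> L2" "\<And>n. s n \<in> L2"
  shows "(\<lambda>n. L2_dist_sq (s n) f) \<longlonglongrightarrow> 0 \<longleftrightarrow> (\<lambda>n. norm2 (\<lambda>x. s n x - f x)) \<longlonglongrightarrow> 0"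
proof -
  have "(\<lambda>n. L2_dist_sq (s n) f) \<longlonglongrightarrow> 0 \<longleftrightarrow> (\<lambda>n. (norm2 (\<lambda>x. s n x - f x))\<^sup>2) \<longlonglongrightarrow> 0"
    unfolding L2_dist_sq_eq[OF assms(2,1)] ennreal_0[symmetric] by (rule tendsto_ennreal_iff) auto
  also have "\<dots> \<longleftrightarrow> (\<lambda>n. norm2 (\<lambda>x. s n x - f x)) \<longlonglongrightarrow> 0"
  proof
    assume "(\<lambda>n. (norm2 (\<lambda>x. s n x - f x))\<^sup>2) \<longlonglongrightarrow> 0"
    then have "(\<lambda>n. sqrt ((norm2 (\<lambda>x. s n x - f x))\<^sup>2)) \<longlonglongrightarrow> sqrt 0" by (rule tendsto_real_sqrt)
    then show "(\<lambda>n. norm2 (\<lambda>x. s n x - f x)) \<longlonglongrightarrow> 0" by simp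
  next
    assume "(\<lambda>n. norm2 (\<lambda>x. s n x - f x)) \<longlonglongrightarrow> 0"
    from tendsto_power[OF this, of 2] show "(\<lambda>n. (norm2 (\<lambda>x. s n x - f x))\<^sup>2) \<longlonglongrightarrow> 0" by simp
  qed
  finally show ?thesis .
qed

text \<open>The extended squared distance may be traded for \<open>norm2\<close> because
  \<open>fourier_contraction\<close> places the transforms of the approximating sequence in
  L2.\<close>

lemma has_L2_fourier_iff:
  fixes f g :: "real ^ 'n \<Rightarrow> complex"
  shows "has_L2_fourier f g \<longleftrightarrow> f \<in> L2 \<and> g \<in> L2 \<and>
    (\<exists>\<phi>. (\<forall>n. integrable lebesgue (\<phi> n) \<and> \<phi> n \<in> L2) \<and> (\<lambda>n. norm2 (\<lambda>x. \<phi> n x - f x)) \<longlonglongrightarrow> 0 \<and>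
      (\<lambda>n. norm2 (\<lambda>p. fourier (\<phi> n) p - g p)) \<longlonglongrightarrow> 0)"
proof -
  have "(\<lambda>n. L2_dist_sq (\<phi> n) f) \<longlonglongrightarrow> 0 \<longleftrightarrow> (\<lambda>n. norm2 (\<lambda>x. \<phi> n x - f x)) \<longlonglongrightarrow> 0"
    "(\<lambda>n. L2_dist_sq (fourier (\<phi> n)) g) \<longlonglongrightarrow> 0 \<longleftrightarrow> (\<lambda>n. norm2 (\<lambda>p. fourier (\<phi> n) p - g p)) \<longlonglongrightarrow> 0"
    if "f \<in> L2" "g \<in> L2" "\<forall>n. integrable lebesgue (\<phi> n) \<and> \<phi> n \<in> L2" for \<phi> :: "nat \<Rightarrow> real ^ 'n \<Rightarrow> complex"
    using that by (intro L2_dist_sq_tendsto_0_iff; simp add: fourier_contraction)+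
  then show ?thesis
    unfolding has_L2_fourier_def by (auto simp: L1_def)
qed

lemma has_L2_fourierD:
  assumes "has_L2_fourier f g"
  shows "f \<in> L2" "g \<in> L2"
  using assms by (auto simp: has_L2_fourier_def)

lemma has_L2_fourierE:
  fixes f g :: "real ^ 'n \<Rightarrow> complex"
  assumes "has_L2_fourier f g"
  obtains \<phi> where "\<And>n. integrable lebesgue (\<phi> n)" "\<And>n. \<phi> n \<in> L2" "\<And>n. fourier (\<phi> n) \<in> L2"
    "(\<lambda>n. norm2 (\<lambda>x. \<phi> n x - f x)) \<longlonglongrightarrow> 0" "(\<lambda>n. norm2 (\<lambda>p. fourier (\<phi> n) p - g p)) \<longlonglongrightarrow> 0"
proof -
  from assms obtain \<phi> where "\<forall>n. integrable lebesgue (\<phi> n) \<and> \<phi> n \<in> L2"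
    "(\<lambda>n. norm2 (\<lambda>x. \<phi> n x - f x)) \<longlonglongrightarrow> 0" "(\<lambda>n. norm2 (\<lambda>p. fourier (\<phi> n) p - g p)) \<longlonglongrightarrow> 0"
    unfolding has_L2_fourier_iff by blast
  then show ?thesis using that[of \<phi>] fourier_contraction(1) by blast
qed

lemma has_L2_fourierI:
  fixes f g :: "real ^ 'n \<Rightarrow> complex"
  assumes "f \<in> L2" "g \<in> L2" "\<And>n. integrable lebesgue (\<phi> n)" "\<And>n. \<phi> n \<in> L2"
    "(\<lambda>n. norm2 (\<lambda>x. \<phi> n x - f x)) \<longlonglongrightarrow> 0" "(\<lambda>n. norm2 (\<lambda>p. fourier (\<phi> n) p - g p)) \<longlonglongrightarrow> 0"
  shows "has_L2_fourier f g"
  unfolding has_L2_fourier_iff using assms by blast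

lemma has_L2_fourier_cong:
  fixes f g :: "real ^ 'n \<Rightarrow> complex"
  assumes "has_L2_fourier f g" "AE x in lebesgue. f x = f' x" "AE x in lebesgue. g x = g' x"
  shows "has_L2_fourier f' g'"
proof -
  note D = has_L2_fourierD[OF assms(1)]
  obtain \<phi> where \<phi>: "\<And>n. integrable lebesgue (\<phi> n)" "\<And>n. \<phi> n \<in> L2" "\<And>n. fourier (\<phi> n) \<in> L2"
    "(\<lambda>n. norm2 (\<lambda>x. \<phi> n x - f x)) \<longlonglongrightarrow> 0" "(\<lambda>n. norm2 (\<lambda>p. fourier (\<phi> n) p - g p)) \<longlonglongrightarrow> 0"
    using has_L2_fourierE[OF assms(1)] by blast
  have "norm2 (\<lambda>x. \<phi> n x - f' x) = norm2 (\<lambda>x. \<phi> n x - f x)" for n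
    using L2_cong_AE(2)[OF L2_diff(1)[OF \<phi>(2) D(1)], of n "\<lambda>x. \<phi> n x - f' x"] assms(2)
    by (auto elim: eventually_mono)
  moreover have "norm2 (\<lambda>x. fourier (\<phi> n) x - g' x) = norm2 (\<lambda>x. fourier (\<phi> n) x - g x)" for n
    using L2_cong_AE(2)[OF L2_diff(1)[OF \<phi>(3) D(2)], of n "\<lambda>x. fourier (\<phi> n) x - g' x"] assms(3)
    by (auto elim: eventually_mono)
  ultimately show ?thesis
    using \<phi> L2_cong_AE(1)[OF D(1) assms(2)] L2_cong_AE(1)[OF D(2) assms(3)]
    by (intro has_L2_fourierI[of f' g' \<phi>]) auto
qed

lemma L2_scale_complex:
  fixes f :: "real ^ 'n \<Rightarrow> complex"
  assumes "f \<in> L2"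
  shows "(\<lambda>x. c * f x) \<in> L2" "norm2 (\<lambda>x. c * f x) \<le> cmod c * norm2 f"
  using L2_dominated[OF assms, of "\<lambda>x. c * f x" "cmod c"] L2_D[OF assms] by (simp_all add: norm_mult)

lemma norm2_add_tendsto_0:
  fixes f g :: "nat \<Rightarrow> real ^ 'n \<Rightarrow> complex"
  assumes "\<And>n. f n \<in> L2" "\<And>n. g n \<in> L2" "(\<lambda>n. norm2 (f n)) \<longlonglongrightarrow> 0" "(\<lambda>n. norm2 (g n)) \<longlonglongrightarrow> 0"
  shows "(\<lambda>n. norm2 (\<lambda>x. f n x + g n x)) \<longlonglongrightarrow> 0"
proof (rule Lim_null_comparison)
  show "\<forall>\<^sub>F n in sequentially. norm (norm2 (\<lambda>x. f n x + g n x)) \<le> norm2 (f n) + norm2 (g n)"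
    using L2_add(2)[OF assms(1,2)] by simp
  show "(\<lambda>n. norm2 (f n) + norm2 (g n)) \<longlonglongrightarrow> 0" using tendsto_add[OF assms(3,4)] by simp
qed

lemma norm2_bounded_tendsto_0:
  fixes f :: "nat \<Rightarrow> real ^ 'n \<Rightarrow> complex"
  assumes "\<And>n. norm2 (g n) \<le> C * norm2 (f n)" "(\<lambda>n. norm2 (f n)) \<longlonglongrightarrow> 0"
  shows "(\<lambda>n. norm2 (g n)) \<longlonglongrightarrow> 0"
proof (rule Lim_null_comparison)
  show "\<forall>\<^sub>F n in sequentially. norm (norm2 (g n)) \<le> C * norm2 (f n)" using assms(1) by simp
  show "(\<lambda>n. C * norm2 (f n)) \<longlonglongrightarrow> 0" using tendsto_mult_left[OF assms(2), of C] by simp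
qed

lemma has_L2_fourier_add:
  fixes f g :: "real ^ 'n \<Rightarrow> complex"
  assumes "has_L2_fourier f1 g1" "has_L2_fourier f2 g2"
  shows "has_L2_fourier (\<lambda>x. f1 x + f2 x) (\<lambda>p. g1 p + g2 p)"
proof -
  note D = has_L2_fourierD[OF assms(1)] has_L2_fourierD[OF assms(2)]
  obtain \<phi> where \<phi>: "\<And>n. integrable lebesgue (\<phi> n)" "\<And>n. \<phi> n \<in> L2" "\<And>n. fourier (\<phi> n) \<in> L2"
    "(\<lambda>n. norm2 (\<lambda>x. \<phi> n x - f1 x)) \<longlonglongrightarrow> 0" "(\<lambda>n. norm2 (\<lambda>p. fourier (\<phi> n) p - g1 p)) \<longlonglongrightarrow> 0"
    using has_L2_fourierE[OF assms(1)] by blast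
  obtain \<psi> where \<psi>: "\<And>n. integrable lebesgue (\<psi> n)" "\<And>n. \<psi> n \<in> L2" "\<And>n. fourier (\<psi> n) \<in> L2"
    "(\<lambda>n. norm2 (\<lambda>x. \<psi> n x - f2 x)) \<longlonglongrightarrow> 0" "(\<lambda>n. norm2 (\<lambda>p. fourier (\<psi> n) p - g2 p)) \<longlonglongrightarrow> 0"
    using has_L2_fourierE[OF assms(2)] by blast
  show ?thesis
  proof (rule has_L2_fourierI[where \<phi> = "\<lambda>n x. \<phi> n x + \<psi> n x"])
    show "(\<lambda>n. norm2 (\<lambda>x. \<phi> n x + \<psi> n x - (f1 x + f2 x))) \<longlonglongrightarrow> 0"
      using norm2_add_tendsto_0[OF L2_diff(1)[OF \<phi>(2) D(1)] L2_diff(1)[OF \<psi>(2) D(3)] \<phi>(4) \<psi>(4)]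
      by (simp add: algebra_simps)
    show "(\<lambda>n. norm2 (\<lambda>x. fourier (\<lambda>x. \<phi> n x + \<psi> n x) x - (g1 x + g2 x))) \<longlonglongrightarrow> 0"
      using norm2_add_tendsto_0[OF L2_diff(1)[OF \<phi>(3) D(2)] L2_diff(1)[OF \<psi>(3) D(4)] \<phi>(5) \<psi>(5)]
      by (simp add: fourier_add[OF \<phi>(1) \<psi>(1)] algebra_simps)
  qed (use D \<phi> \<psi> in \<open>auto intro: L2_add\<close>)
qed

lemma has_L2_fourier_scale:
  fixes f g :: "real ^ 'n \<Rightarrow> complex"
  assumes "has_L2_fourier f g"
  shows "has_L2_fourier (\<lambda>x. c * f x) (\<lambda>p. c * g p)"
proof -
  note D = has_L2_fourierD[OF assms(1)]
  obtain \<phi> where \<phi>: "\<And>n. integrable lebesgue (\<phi> n)" "\<And>n. \<phi> n \<in> L2" "\<And>n. fourier (\<phi> n) \<in> L2"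
    "(\<lambda>n. norm2 (\<lambda>x. \<phi> n x - f x)) \<longlonglongrightarrow> 0" "(\<lambda>n. norm2 (\<lambda>p. fourier (\<phi> n) p - g p)) \<longlonglongrightarrow> 0"
    using has_L2_fourierE[OF assms(1)] by blast
  show ?thesis
  proof (rule has_L2_fourierI[where \<phi> = "\<lambda>n x. c * \<phi> n x"])
    show "(\<lambda>n. norm2 (\<lambda>x. c * \<phi> n x - c * f x)) \<longlonglongrightarrow> 0"
      using norm2_bounded_tendsto_0[OF L2_scale_complex(2)[OF L2_diff(1)[OF \<phi>(2) D(1)]] \<phi>(4), of c]
      by (simp add: right_diff_distrib)
    show "(\<lambda>n. norm2 (\<lambda>x. fourier (\<lambda>x. c * \<phi> n x) x - c * g x)) \<longlonglongrightarrow> 0"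
      using norm2_bounded_tendsto_0[OF L2_scale_complex(2)[OF L2_diff(1)[OF \<phi>(3) D(2)]] \<phi>(5), of c]
      by (simp add: fourier_scale right_diff_distrib)
  qed (use D \<phi> in \<open>auto intro: L2_scale_complex\<close>)
qed

lemma has_L2_fourier_diff:
  fixes f1 f2 g1 g2 :: "real ^ 'n \<Rightarrow> complex"
  assumes "has_L2_fourier f1 g1" "has_L2_fourier f2 g2"
  shows "has_L2_fourier (\<lambda>x. f1 x - f2 x) (\<lambda>p. g1 p - g2 p)"
  using has_L2_fourier_add[OF assms(1) has_L2_fourier_scale[OF assms(2), of "- 1"]] by simp

lemma has_L2_fourier_reflect:
  fixes f g :: "real ^ 'n \<Rightarrow> complex"
  assumes "has_L2_fourier f g"
  shows "has_L2_fourier (\<lambda>x. f (- x)) (\<lambda>p. g (- p))"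
proof -
  note D = has_L2_fourierD[OF assms(1)]
  obtain \<phi> where \<phi>: "\<And>n. integrable lebesgue (\<phi> n)" "\<And>n. \<phi> n \<in> L2" "\<And>n. fourier (\<phi> n) \<in> L2"
    "(\<lambda>n. norm2 (\<lambda>x. \<phi> n x - f x)) \<longlonglongrightarrow> 0" "(\<lambda>n. norm2 (\<lambda>p. fourier (\<phi> n) p - g p)) \<longlonglongrightarrow> 0"
    using has_L2_fourierE[OF assms(1)] by blast
  show ?thesis
  proof (rule has_L2_fourierI[where \<phi> = "\<lambda>n x. \<phi> n (- x)"])
    show "(\<lambda>n. norm2 (\<lambda>x. \<phi> n (- x) - f (- x))) \<longlonglongrightarrow> 0"
      using \<phi>(4) L2_reflect(2)[OF L2_diff(1)[OF \<phi>(2) D(1)]] by simp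
    show "(\<lambda>n. norm2 (\<lambda>x. fourier (\<lambda>x. \<phi> n (- x)) x - g (- x))) \<longlonglongrightarrow> 0"
      using \<phi>(5) L2_reflect(2)[OF L2_diff(1)[OF \<phi>(3) D(2)]] by (simp add: fourier_reflect)
    show "integrable lebesgue (\<lambda>x. \<phi> n (- x))" for n
      using integrable_lebesgue_reflect[OF \<phi>(1)[of n], of 0] by simp
  qed (use D \<phi> in \<open>auto intro: L2_reflect\<close>)
qed

lemma L2_cnj:
  fixes f :: "real ^ 'n \<Rightarrow> complex"
  assumes "f \<in> L2"
  shows "(\<lambda>x. cnj (f x)) \<in> L2"
  using L2_D[OF assms] by (auto simp: L2_def)

lemma norm2_cnj_diff:
  fixes f g :: "real ^ 'n \<Rightarrow> complex"
  shows "norm2 (\<lambda>x. cnj (f x) - cnj (g x)) = norm2 (\<lambda>x. f x - g x)"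
  unfolding norm2_def complex_cnj_diff[symmetric] complex_mod_cnj ..

lemma has_L2_fourier_cnj:
  fixes f g :: "real ^ 'n \<Rightarrow> complex"
  assumes "has_L2_fourier f g"
  shows "has_L2_fourier (\<lambda>x. cnj (f x)) (\<lambda>p. cnj (g (- p)))"
proof -
  note D = has_L2_fourierD[OF assms(1)]
  obtain \<phi> where \<phi>: "\<And>n. integrable lebesgue (\<phi> n)" "\<And>n. \<phi> n \<in> L2" "\<And>n. fourier (\<phi> n) \<in> L2"
    "(\<lambda>n. norm2 (\<lambda>x. \<phi> n x - f x)) \<longlonglongrightarrow> 0" "(\<lambda>n. norm2 (\<lambda>p. fourier (\<phi> n) p - g p)) \<longlonglongrightarrow> 0"
    using has_L2_fourierE[OF assms(1)] by blast
  show ?thesis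
  proof (rule has_L2_fourierI[where \<phi> = "\<lambda>n x. cnj (\<phi> n x)"])
    show "(\<lambda>n. norm2 (\<lambda>x. cnj (\<phi> n x) - cnj (f x))) \<longlonglongrightarrow> 0"
      using \<phi>(4) by (simp only: norm2_cnj_diff)
    show "(\<lambda>n. norm2 (\<lambda>x. fourier (\<lambda>x. cnj (\<phi> n x)) x - cnj (g (- x)))) \<longlonglongrightarrow> 0"
      using \<phi>(5) L2_reflect(2)[OF L2_diff(1)[OF \<phi>(3) D(2)]]
      by (simp only: fourier_cnj norm2_cnj_diff)
  qed (use D \<phi> in \<open>auto intro: L2_reflect L2_cnj\<close>)
qed

lemma has_L2_fourier_contraction:
  fixes f g :: "real ^ 'n \<Rightarrow> complex"
  assumes "has_L2_fourier f g"
  shows "norm2 g \<le> norm2 f"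
proof -
  note D = has_L2_fourierD[OF assms(1)]
  obtain \<phi> where \<phi>: "\<And>n. integrable lebesgue (\<phi> n)" "\<And>n. \<phi> n \<in> L2" "\<And>n. fourier (\<phi> n) \<in> L2"
    "(\<lambda>n. norm2 (\<lambda>x. \<phi> n x - f x)) \<longlonglongrightarrow> 0" "(\<lambda>n. norm2 (\<lambda>p. fourier (\<phi> n) p - g p)) \<longlonglongrightarrow> 0"
    using has_L2_fourierE[OF assms(1)] by blast
  show ?thesis
    using norm2_tendsto[OF D(2) \<phi>(3,5)] norm2_tendsto[OF D(1) \<phi>(2,4)] fourier_contraction(2)[OF \<phi>(1,2)]
    by (intro LIMSEQ_le) auto
qed

lemma has_L2_fourier_unique:
  fixes f g :: "real ^ 'n \<Rightarrow> complex"
  assumes "has_L2_fourier f g" "has_L2_fourier f' g'" "AE x in lebesgue. f x = f' x"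
  shows "AE p in lebesgue. g p = g' p"
proof -
  note D = has_L2_fourierD[OF assms(1)] has_L2_fourierD[OF assms(2)]
  have "norm2 (\<lambda>p. g p - g' p) \<le> norm2 (\<lambda>x. f x - f' x)"
    by (rule has_L2_fourier_contraction[OF has_L2_fourier_diff[OF assms(1,2)]])
  also have "\<dots> = 0" using norm2_diff_eq_0_iff[OF D(1,3)] assms(3) by simp
  finally have "norm2 (\<lambda>p. g p - g' p) = 0" using norm2_nonneg[of "\<lambda>p. g p - g' p"] by linarith
  then show ?thesis using norm2_diff_eq_0_iff[OF D(2,4)] by simp
qed

text \<open>Continuous approximants within 2^(-n) of f have transforms with geometrically decreasing
  steps, so these converge; the norm identity holds for each approximant and survives the
  limit.\<close>

lemma has_L2_fourier_exists_isometric: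
  fixes f :: "real ^ 'n \<Rightarrow> complex"
  assumes f: "f \<in> L2"
  obtains g where "has_L2_fourier f g" "norm2 g = norm2 f"
proof -
  have "\<exists>g. continuous_on UNIV g \<and> bounded (range g) \<and> integrable lebesgue g \<and> g \<in> L2 \<and>
      norm2 (\<lambda>x. g x - f x) < (1 / 2) ^ n" for n
  proof -
    have "(0::real) < (1 / 2) ^ n" by simp
    from L2_approx_continuous[OF f this] show ?thesis by blast
  qed
  then have "\<exists>\<phi>. \<forall>n. continuous_on UNIV (\<phi> n) \<and> bounded (range (\<phi> n)) \<and> integrable lebesgue (\<phi> n) \<and> \<phi> n \<in> L2 \<and>
      norm2 (\<lambda>x. \<phi> n x - f x) < (1 / 2) ^ n"
    by (rule choice[OF allI])
  then obtain \<phi> where \<phi>: "\<And>n. continuous_on UNIV (\<phi> n)" "\<And>n. bounded (range (\<phi> n))"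
      "\<And>n. integrable lebesgue (\<phi> n)" "\<And>n. \<phi> n \<in> L2" "\<And>n. norm2 (\<lambda>x. \<phi> n x - f x) < (1 / 2) ^ n"
    by blast
  have F: "fourier (\<phi> n) \<in> L2" "norm2 (fourier (\<phi> n)) = norm2 (\<phi> n)" for n
    using fourier_contraction(1)[OF \<phi>(3,4)] fourier_isometry_continuous[OF \<phi>(3,4,1,2)] by auto
  \<comment> \<open>The triangle inequality through f gives \<open>(1/2)^(n+1) + (1/2)^n\<close>,
    rounded up to twice \<open>(1/2)^n\<close>.\<close>
  have step: "norm2 (\<lambda>p. fourier (\<phi> (Suc n)) p - fourier (\<phi> n) p) \<le> 2 * (1 / 2) ^ n" for n
  proof -
    have "norm2 (\<lambda>p. fourier (\<phi> (Suc n)) p - fourier (\<phi> n) p) = norm2 (fourier (\<lambda>x. \<phi> (Suc n) x - \<phi> n x))"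
      by (rule arg_cong[of _ _ norm2]) (intro ext fourier_diff[symmetric] \<phi>)
    also have "\<dots> \<le> norm2 (\<lambda>x. \<phi> (Suc n) x - \<phi> n x)"
      by (intro fourier_contraction(2) Bochner_Integration.integrable_diff \<phi> L2_diff(1))
    also have "\<dots> \<le> norm2 (\<lambda>x. \<phi> (Suc n) x - f x) + norm2 (\<lambda>x. f x - \<phi> n x)"
      by (rule norm2_triangle[OF \<phi>(4) f \<phi>(4)])
    also have "\<dots> \<le> (1 / 2) ^ Suc n + (1 / 2) ^ n"
      using \<phi>(5)[of "Suc n"] \<phi>(5)[of n] norm2_diff_commute[of f "\<phi> n"] by linarith
    also have "\<dots> \<le> 2 * (1 / 2) ^ n" by simp
    finally show ?thesis .
  qed
  have half: "0 \<le> (1 / 2 :: real)" "1 / 2 < (1 :: real)" by simp_all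
  obtain g where g: "g \<in> L2" "(\<lambda>n. norm2 (\<lambda>p. fourier (\<phi> n) p - g p)) \<longlonglongrightarrow> 0"
    using L2_complete_geometric[OF F(1) step half] by blast
  have \<phi>f: "(\<lambda>n. norm2 (\<lambda>x. \<phi> n x - f x)) \<longlonglongrightarrow> 0"
  proof (rule Lim_null_comparison)
    show "\<forall>\<^sub>F n in sequentially. norm (norm2 (\<lambda>x. \<phi> n x - f x)) \<le> (1 / 2) ^ n"
      using \<phi>(5) by (simp add: less_imp_le)
    show "(\<lambda>n. (1 / 2) ^ n :: real) \<longlonglongrightarrow> 0" by (rule LIMSEQ_power_zero) simp
  qed
  have "norm2 g = norm2 f"
    using norm2_tendsto[OF g(1) F(1) g(2)] norm2_tendsto[OF f \<phi>(4) \<phi>f] unfolding F(2) by (rule LIMSEQ_unique)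
  then show ?thesis by (intro that[OF has_L2_fourierI[OF f g(1) \<phi>(3,4) \<phi>f g(2)]])
qed

text \<open>One isometric transform exists, and every transform of f agrees with it a.e.\<close>

lemma has_L2_fourier_isometry:
  fixes f g :: "real ^ 'n \<Rightarrow> complex"
  assumes "has_L2_fourier f g"
  shows "norm2 g = norm2 f"
proof -
  note D = has_L2_fourierD[OF assms(1)]
  obtain g' where g': "has_L2_fourier f g'" "norm2 g' = norm2 f"
    using has_L2_fourier_exists_isometric[OF D(1)] .
  have "AE p in lebesgue. g' p = g p" using has_L2_fourier_unique[OF g'(1) assms] by simp
  from L2_cong_AE(2)[OF has_L2_fourierD(2)[OF g'(1)] this] g'(2) show ?thesis by simp
qed

lemma has_L2_fourier_fourier_L2:
  fixes f :: "real ^ 'n \<Rightarrow> complex"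
  assumes "f \<in> L2"
  shows "has_L2_fourier f (fourier_L2 f)"
proof -
  obtain g where "has_L2_fourier f g" using has_L2_fourier_exists_isometric[OF assms] .
  then show ?thesis unfolding fourier_L2_def by (rule someI[of "has_L2_fourier f"])
qed

lemma fourier_L2_eqI:
  fixes f g :: "real ^ 'n \<Rightarrow> complex"
  assumes "has_L2_fourier f g" "AE x in lebesgue. f x = f' x"
  shows "AE p in lebesgue. fourier_L2 f' p = g p"
proof -
  have "f' \<in> L2" using L2_cong_AE(1)[OF has_L2_fourierD(1)[OF assms(1)] assms(2)] .
  from has_L2_fourier_unique[OF assms(1) has_L2_fourier_fourier_L2[OF this] assms(2)]
  show ?thesis by (rule eventually_mono) simp
qed

section \<open>Adjoint relation, inversion, surjectivity and the convolution theorem on L2\<close>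

lemma L2_mult_complex:
  fixes f g :: "real ^ 'n \<Rightarrow> complex"
  assumes "f \<in> L2" "g \<in> L2"
  shows "integrable lebesgue (\<lambda>x. f x * g x)" "cmod (LINT x|lebesgue. f x * g x) \<le> norm2 f * norm2 g"
proof -
  show "integrable lebesgue (\<lambda>x. f x * g x)"
    by (rule Bochner_Integration.integrable_bound[OF L2_mult(1)[OF assms]])
       (use L2_D[OF assms(1)] L2_D[OF assms(2)] in \<open>auto simp: norm_mult\<close>)
  have "cmod (LINT x|lebesgue. f x * g x) \<le> (LINT x|lebesgue. cmod (f x * g x))" by (rule integral_norm_bound)
  then show "cmod (LINT x|lebesgue. f x * g x) \<le> norm2 f * norm2 g"
    using L2_mult(2)[OF assms] by (simp add: norm_mult)
qed

lemma L2_mult_tendsto: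
  fixes f g :: "real ^ 'n \<Rightarrow> complex"
  assumes f: "f \<in> L2" "\<And>n. s n \<in> L2" "(\<lambda>n. norm2 (\<lambda>x. s n x - f x)) \<longlonglongrightarrow> 0"
    and g: "g \<in> L2" "\<And>n. t n \<in> L2" "(\<lambda>n. norm2 (\<lambda>x. t n x - g x)) \<longlonglongrightarrow> 0"
  shows "(\<lambda>n. LINT x|lebesgue. s n x * t n x) \<longlonglongrightarrow> (LINT x|lebesgue. f x * g x)"
proof -
  have "(\<lambda>n. (LINT x|lebesgue. s n x * t n x) - (LINT x|lebesgue. f x * g x)) \<longlonglongrightarrow> 0"
  proof (rule Lim_null_comparison)
    show "\<forall>\<^sub>F n in sequentially. norm ((LINT x|lebesgue. s n x * t n x) - (LINT x|lebesgue. f x * g x))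
        \<le> norm2 (s n) * norm2 (\<lambda>x. t n x - g x) + norm2 (\<lambda>x. s n x - f x) * norm2 g"
    proof (intro always_eventually allI)
      fix n
      have "(LINT x|lebesgue. s n x * t n x) - (LINT x|lebesgue. f x * g x)
          = (LINT x|lebesgue. s n x * (t n x - g x)) + (LINT x|lebesgue. (s n x - f x) * g x)"
        using L2_mult_complex(1)[OF f(2) g(2)] L2_mult_complex(1)[OF f(1) g(1)] L2_mult_complex(1)[OF f(2) g(1)]
        by (simp add: algebra_simps)
      also have "norm \<dots> \<le> norm2 (s n) * norm2 (\<lambda>x. t n x - g x) + norm2 (\<lambda>x. s n x - f x) * norm2 g"
        by (intro norm_triangle_le add_mono L2_mult_complex(2) f g L2_diff(1))
      finally show "norm ((LINT x|lebesgue. s n x * t n x) - (LINT x|lebesgue. f x * g x))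
        \<le> norm2 (s n) * norm2 (\<lambda>x. t n x - g x) + norm2 (\<lambda>x. s n x - f x) * norm2 g" .
    qed
    have "(\<lambda>n. norm2 (s n) * norm2 (\<lambda>x. t n x - g x) + norm2 (\<lambda>x. s n x - f x) * norm2 g)
        \<longlonglongrightarrow> norm2 f * 0 + 0 * norm2 g"
      by (intro tendsto_intros f g norm2_tendsto)
    then show "(\<lambda>n. norm2 (s n) * norm2 (\<lambda>x. t n x - g x) + norm2 (\<lambda>x. s n x - f x) * norm2 g) \<longlonglongrightarrow> 0"
      by simp
  qed
  then show ?thesis by (simp add: LIM_zero_cancel)
qed

lemma has_L2_fourier_multiplication:
  fixes f1 f2 g1 g2 :: "real ^ 'n \<Rightarrow> complex"
  assumes "has_L2_fourier f1 g1" "has_L2_fourier f2 g2"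
  shows "(LINT p|lebesgue. g1 p * f2 p) = (LINT x|lebesgue. f1 x * g2 x)"
proof -
  note D = has_L2_fourierD[OF assms(1)] has_L2_fourierD[OF assms(2)]
  obtain \<phi> where \<phi>: "\<And>n. integrable lebesgue (\<phi> n)" "\<And>n. \<phi> n \<in> L2" "\<And>n. fourier (\<phi> n) \<in> L2"
    "(\<lambda>n. norm2 (\<lambda>x. \<phi> n x - f1 x)) \<longlonglongrightarrow> 0" "(\<lambda>n. norm2 (\<lambda>p. fourier (\<phi> n) p - g1 p)) \<longlonglongrightarrow> 0"
    using has_L2_fourierE[OF assms(1)] by blast
  obtain \<psi> where \<psi>: "\<And>n. integrable lebesgue (\<psi> n)" "\<And>n. \<psi> n \<in> L2" "\<And>n. fourier (\<psi> n) \<in> L2"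
    "(\<lambda>n. norm2 (\<lambda>x. \<psi> n x - f2 x)) \<longlonglongrightarrow> 0" "(\<lambda>n. norm2 (\<lambda>p. fourier (\<psi> n) p - g2 p)) \<longlonglongrightarrow> 0"
    using has_L2_fourierE[OF assms(2)] by blast
  have "(\<lambda>n. LINT p|lebesgue. fourier (\<phi> n) p * \<psi> n p) \<longlonglongrightarrow> (LINT p|lebesgue. g1 p * f2 p)"
    by (rule L2_mult_tendsto[OF D(2) \<phi>(3,5) D(3) \<psi>(2,4)])
  moreover have "(\<lambda>n. LINT p|lebesgue. fourier (\<phi> n) p * \<psi> n p) \<longlonglongrightarrow> (LINT x|lebesgue. f1 x * g2 x)"
    using L2_mult_tendsto[OF D(1) \<phi>(2,4) D(4) \<psi>(3,5)] by (simp only: fourier_multiplication[OF \<phi>(1) \<psi>(1)])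
  ultimately show ?thesis by (rule LIMSEQ_unique)
qed

lemma L2_polarization:
  fixes f g :: "real ^ 'n \<Rightarrow> complex"
  assumes "f \<in> L2" "g \<in> L2"
  shows "(norm2 (\<lambda>x. f x - g x))\<^sup>2 = (norm2 f)\<^sup>2 - 2 * Re (LINT x|lebesgue. f x * cnj (g x)) + (norm2 g)\<^sup>2"
proof -
  have i: "integrable lebesgue (\<lambda>x. f x * cnj (g x))" by (rule L2_mult_complex(1)[OF assms(1) L2_cnj[OF assms(2)]])
  define r where "r x = Re (f x * cnj (g x))" for x
  have r: "integrable lebesgue r" "(LINT x|lebesgue. r x) = Re (LINT x|lebesgue. f x * cnj (g x))"
    unfolding r_def[abs_def] using integrable_Re[OF i] integral_Re[OF i] by simp_all
  have "(norm (f x - g x))\<^sup>2 = (norm (f x))\<^sup>2 - 2 * r x + (norm (g x))\<^sup>2" for x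
    unfolding cmod_power2 r_def by (simp add: power2_eq_square algebra_simps)
  then have "(norm2 (\<lambda>x. f x - g x))\<^sup>2 = (LINT x|lebesgue. (norm (f x))\<^sup>2 - 2 * r x + (norm (g x))\<^sup>2)"
    unfolding norm2_power2 by (simp only:)
  also have "\<dots> = (norm2 f)\<^sup>2 - 2 * (LINT x|lebesgue. r x) + (norm2 g)\<^sup>2"
    unfolding norm2_power2 using r(1) L2_D(2)[OF assms(1)] L2_D(2)[OF assms(2)] by simp
  finally show ?thesis unfolding r(2) .
qed

text \<open>Isometry and the adjoint relation give \<open>\<parallel>F* F f - f\<parallel>\<^sup>2 = \<parallel>F f\<parallel>\<^sup>2 - 2 \<parallel>F f\<parallel>\<^sup>2 + \<parallel>f\<parallel>\<^sup>2 = 0\<close>.\<close>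

lemma has_L2_fourier_inversion:
  fixes f g :: "real ^ 'n \<Rightarrow> complex"
  assumes fg: "has_L2_fourier f g" and gh: "has_L2_fourier g h"
  shows "AE x in lebesgue. h (- x) = f x"
proof -
  note D = has_L2_fourierD[OF fg] has_L2_fourierD[OF gh]
  have hr: "(\<lambda>x. h (- x)) \<in> L2" "norm2 (\<lambda>x. h (- x)) = norm2 h" using L2_reflect[OF D(4)] by auto
  \<comment> \<open>Multiplication formula for f and the conjugate of g, whose transform is the
    conjugate of the reflected h; this is the adjoint relation.\<close>
  have "(LINT p|lebesgue. g p * cnj (g p)) = (LINT x|lebesgue. f x * cnj (h (- x)))"
    by (rule has_L2_fourier_multiplication[OF fg has_L2_fourier_cnj[OF gh]])
  moreover have "(LINT p|lebesgue. g p * cnj (g p)) = of_real ((norm2 g)\<^sup>2)"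
    unfolding norm2_power2 complex_norm_square[symmetric] by (rule integral_complex_of_real)
  ultimately have "(LINT x|lebesgue. f x * cnj (h (- x))) = of_real ((norm2 g)\<^sup>2)" by (simp only:)
  then have "Re (LINT x|lebesgue. f x * cnj (h (- x))) = (norm2 g)\<^sup>2" by (simp only: Re_complex_of_real)
  then have "(norm2 (\<lambda>x. f x - h (- x)))\<^sup>2 = 0"
    using L2_polarization[OF D(1) hr(1)] hr(2) has_L2_fourier_isometry[OF fg] has_L2_fourier_isometry[OF gh]
    by simp
  then have "norm2 (\<lambda>x. f x - h (- x)) = 0" by simp
  then have "AE x in lebesgue. f x = h (- x)" using norm2_diff_eq_0_iff[OF D(1) hr(1)] by simp
  then show ?thesis by (rule eventually_mono) simp
qed

text \<open>The preimage is h(-x), with h the transform of g: if k is the transform of h, inversion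
  says k(-x) = g(x), and k(-x) is the transform of h(-x).\<close>

lemma has_L2_fourier_surj:
  fixes g :: "real ^ 'n \<Rightarrow> complex"
  assumes "g \<in> L2"
  obtains f where "has_L2_fourier f g"
proof -
  obtain h where h: "has_L2_fourier g h" using has_L2_fourier_fourier_L2[OF assms] by blast
  obtain k where k: "has_L2_fourier h k" using has_L2_fourier_fourier_L2 has_L2_fourierD(2)[OF h] by blast
  have "AE x in lebesgue. k (- x) = g x" by (rule has_L2_fourier_inversion[OF h k])
  from has_L2_fourier_cong[OF has_L2_fourier_reflect[OF k] _ this, of "\<lambda>x. h (- x)"]
  show ?thesis by (intro that) simp
qed

text \<open>Convolution with G and multiplication by (2 pi)^(d/2) G^ are both bounded on L2 by the
  L1 norm of G, so the identity extends from the approximants by continuity.\<close>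

lemma has_L2_fourier_conv:
  fixes f g G :: "real ^ 'n \<Rightarrow> complex"
  assumes G: "integrable lebesgue G" and fg: "has_L2_fourier f g"
  shows "has_L2_fourier (conv G f) (\<lambda>p. of_real (fconst TYPE('n)) * fourier G p * g p)"
proof -
  note D = has_L2_fourierD[OF fg]
  obtain \<phi> where \<phi>: "\<And>n. integrable lebesgue (\<phi> n)" "\<And>n. \<phi> n \<in> L2" "\<And>n. fourier (\<phi> n) \<in> L2"
    "(\<lambda>n. norm2 (\<lambda>x. \<phi> n x - f x)) \<longlonglongrightarrow> 0" "(\<lambda>n. norm2 (\<lambda>p. fourier (\<phi> n) p - g p)) \<longlonglongrightarrow> 0"
    using has_L2_fourierE[OF fg] by blast
  let ?m = "\<lambda>p. of_real (fconst TYPE('n)) * fourier G p"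
  let ?C = "LINT x|lebesgue. cmod (G x)"
  have C0: "?C \<ge> 0" by simp
  have mb: "cmod (?m p) \<le> ?C" for p
  proof -
    have "cmod (?m p) = fconst TYPE('n) * cmod (fourier G p)" by (simp add: norm_mult)
    also have "\<dots> \<le> fconst TYPE('n) * (1 / fconst TYPE('n) * ?C)" by (intro mult_left_mono fourier_bound) simp
    also have "\<dots> = ?C" by simp
    finally show ?thesis .
  qed
  have mm: "?m \<in> borel_measurable lebesgue"
    using fourier_measurable[OF borel_measurable_integrable[OF G]]
    by (intro measurable_completion borel_measurable_times borel_measurable_const) simp
  have mult: "(\<lambda>p. ?m p * u p) \<in> L2" "norm2 (\<lambda>p. ?m p * u p) \<le> ?C * norm2 u" if "u \<in> L2" for u
  proof -
    have "(\<lambda>p. ?m p * u p) \<in> borel_measurable lebesgue" using mm L2_D(1)[OF that] by (rule borel_measurable_times)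
    moreover have "AE p in lebesgue. norm (?m p * u p) \<le> ?C * norm (u p)"
      by (intro AE_I2, subst norm_mult) (rule mult_right_mono[OF mb norm_ge_zero])
    ultimately show "(\<lambda>p. ?m p * u p) \<in> L2" "norm2 (\<lambda>p. ?m p * u p) \<le> ?C * norm2 u"
      by (rule L2_dominated[OF that _ C0])+
  qed
  show ?thesis
  proof (rule has_L2_fourierI[where \<phi> = "\<lambda>n. conv G (\<phi> n)"])
    show "conv G f \<in> L2" by (rule conv_L2(2)[OF G D(1)])
    show "conv G (\<phi> n) \<in> L2" for n by (rule conv_L2(2)[OF G \<phi>(2)])
    show "integrable lebesgue (conv G (\<phi> n))" for n by (rule fourier_conv(1)[OF G \<phi>(1)])
    show "(\<lambda>p. ?m p * g p) \<in> L2" by (rule mult[OF D(2)])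
    \<comment> \<open>\<open>conv\<close> distributes over the difference only where both integrals
      converge, hence the detour through a.e. equality.\<close>
    have eq: "norm2 (\<lambda>x. conv G (\<phi> n) x - conv G f x) = norm2 (conv G (\<lambda>x. \<phi> n x - f x))" for n
    proof (rule L2_cong_AE(2))
      show "conv G (\<lambda>x. \<phi> n x - f x) \<in> L2" by (rule conv_L2(2)[OF G L2_diff(1)[OF \<phi>(2) D(1)]])
      show "AE x in lebesgue. conv G (\<lambda>x. \<phi> n x - f x) x = conv G (\<phi> n) x - conv G f x"
        using conv_L2(1)[OF G \<phi>(2)[of n]] conv_L2(1)[OF G D(1)]
        by eventually_elim (simp add: conv_def right_diff_distrib)
    qed
    show "(\<lambda>n. norm2 (\<lambda>x. conv G (\<phi> n) x - conv G f x)) \<longlonglongrightarrow> 0"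
      unfolding eq by (rule norm2_bounded_tendsto_0[OF conv_L2(3)[OF G L2_diff(1)[OF \<phi>(2) D(1)]] \<phi>(4)])
    have eq2: "fourier (conv G (\<phi> n)) p - ?m p * g p = ?m p * (fourier (\<phi> n) p - g p)" for n p
      unfolding fourier_conv(2)[OF G \<phi>(1)] by (rule right_diff_distrib[symmetric])
    show "(\<lambda>n. norm2 (\<lambda>p. fourier (conv G (\<phi> n)) p - ?m p * g p)) \<longlonglongrightarrow> 0"
      unfolding eq2 by (rule norm2_bounded_tendsto_0[OF mult(2)[OF L2_diff(1)[OF \<phi>(3) D(2)]] \<phi>(5)])
  qed
qed

section \<open>The fixed point problem\<close>

lemma L2_of_real:
  fixes v :: "real ^ 'n \<Rightarrow> real"
  shows "(\<lambda>x. complex_of_real (v x)) \<in> L2 \<longleftrightarrow> v \<in> L2" "norm2 (\<lambda>x. complex_of_real (v x)) = norm2 v"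
proof -
  have "v \<in> borel_measurable lebesgue" if "(\<lambda>x. complex_of_real (v x)) \<in> borel_measurable lebesgue"
    using measurable_compose[OF that borel_measurable_Re] unfolding Re_complex_of_real .
  moreover have "(\<lambda>x. complex_of_real (v x)) \<in> borel_measurable lebesgue" if "v \<in> borel_measurable lebesgue"
    using that by measurable
  ultimately have "(\<lambda>x. complex_of_real (v x)) \<in> borel_measurable lebesgue \<longleftrightarrow> v \<in> borel_measurable lebesgue"
    by (rule iffI)
  then show "(\<lambda>x. complex_of_real (v x)) \<in> L2 \<longleftrightarrow> v \<in> L2"
    unfolding L2_def mem_Collect_eq norm_of_real real_norm_def by (simp only:)
  show "norm2 (\<lambda>x. complex_of_real (v x)) = norm2 v" by (simp add: norm2_def)
qed

text \<open>Round v down to the grid of width 1/(n+1). The result takes countably many values, so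
  its composition with F is measurable, and the Lipschitz bound makes these compositions converge
  pointwise.\<close>

lemma superposition_measurable:
  fixes F :: "real \<Rightarrow> 'a \<Rightarrow> real"
  assumes F: "\<And>u. F u \<in> borel_measurable M" and lip: "\<And>u1 u2 x. \<bar>F u1 x - F u2 x\<bar> \<le> l * \<bar>u1 - u2\<bar>"
    and v: "v \<in> borel_measurable M"
  shows "(\<lambda>x. F (v x) x) \<in> borel_measurable M"
proof (rule borel_measurable_LIMSEQ_metric)
  note v[measurable]
  let ?s = "\<lambda>n x. real_of_int \<lfloor>real (Suc n) * v x\<rfloor> / real (Suc n)"
  show "(\<lambda>x. F (?s n x) x) \<in> borel_measurable M" for n
  proof (rule measurable_compose_countable[where f = "\<lambda>k x. F (real_of_int k / real (Suc n)) x"])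
    show "(\<lambda>x. \<lfloor>real (Suc n) * v x\<rfloor>) \<in> measurable M (count_space UNIV)" by measurable
  qed (rule F)
  fix x
  have s: "\<bar>?s n x - v x\<bar> \<le> 1 / real (Suc n)" for n
  proof -
    have "?s n x - v x = (real_of_int \<lfloor>real (Suc n) * v x\<rfloor> - real (Suc n) * v x) / real (Suc n)"
      by (simp add: diff_divide_distrib del: of_nat_Suc)
    then have "\<bar>?s n x - v x\<bar> = \<bar>real_of_int \<lfloor>real (Suc n) * v x\<rfloor> - real (Suc n) * v x\<bar> / real (Suc n)"
      by (simp only: abs_divide abs_of_nat)
    also have "\<dots> \<le> 1 / real (Suc n)"
      by (intro divide_right_mono) linarith+
    finally show ?thesis .
  qed
  have "(\<lambda>n. F (?s n x) x - F (v x) x) \<longlonglongrightarrow> 0"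
  proof (rule Lim_null_comparison)
    show "\<forall>\<^sub>F n in sequentially. norm (F (?s n x) x - F (v x) x) \<le> \<bar>l\<bar> * (1 / real (Suc n))"
    proof (intro always_eventually allI)
      fix n
      have "\<bar>F (?s n x) x - F (v x) x\<bar> \<le> l * \<bar>?s n x - v x\<bar>" by (rule lip)
      \<comment> \<open>The sign of l is not among the assumptions here, so the bound is weakened to
        |l| before the inequalities are multiplied.\<close>
      also have "\<dots> \<le> \<bar>l\<bar> * (1 / real (Suc n))" by (intro mult_mono s) auto
      finally show "norm (F (?s n x) x - F (v x) x) \<le> \<bar>l\<bar> * (1 / real (Suc n))" by simp
    qed
    have "(\<lambda>n. \<bar>l\<bar> * (1 / real (Suc n))) \<longlonglongrightarrow> \<bar>l\<bar> * 0"
      by (intro tendsto_intros LIMSEQ_Suc[OF lim_1_over_n])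
    then show "(\<lambda>n. \<bar>l\<bar> * (1 / real (Suc n))) \<longlonglongrightarrow> 0" by simp
  qed
  then show "(\<lambda>n. F (?s n x) x) \<longlonglongrightarrow> F (v x) x" by (simp add: LIM_zero_cancel)
qed

text \<open>Turns smallness in the extended reals into smallness for a real bound r: an infinite
  norm would make the whole product infinite.\<close>

lemma Linf_norm_bound:
  fixes m :: "real ^ 'n \<Rightarrow> complex"
  assumes "ereal c * Linf_norm m * ereal l < 1" "c > 0" "l > 0"
  obtains r where "r \<ge> 0" "AE p in lebesgue. cmod (m p) \<le> r" "c * r * l < 1"
proof -
  have AE: "AE p in lebesgue. ereal (cmod (m p)) \<le> Linf_norm m"
    unfolding Linf_norm_def by (rule esssup_AE)
  have "Linf_norm m \<noteq> \<infinity>"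
  proof
    assume "Linf_norm m = \<infinity>"
    then have "ereal c * Linf_norm m * ereal l = \<infinity>" using assms(2,3) by simp
    with assms(1) show False by (simp only: not_less_iff_gr_or_eq) simp
  qed
  moreover have nn: "Linf_norm m \<ge> 0"
  proof (rule ccontr)
    \<comment> \<open>A negative essential supremum would lie a.e. above a modulus, so falsity would
      hold a.e. and Lebesgue measure would be zero.\<close>
    assume "\<not> 0 \<le> Linf_norm m"
    have "AE p in lebesgue :: (real ^ 'n) measure. False"
      using AE
    proof eventually_elim
      case (elim p)
      have "0 \<le> ereal (cmod (m p))" by simp
      from order_trans[OF this elim] \<open>\<not> 0 \<le> Linf_norm m\<close> show False by contradiction
    qed
    then have "ae_filter (lebesgue :: (real ^ 'n) measure) = bot" by (simp only: trivial_limit_def)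
    then show False unfolding ae_filter_eq_bot_iff by simp
  qed
  ultimately obtain r where r: "Linf_norm m = ereal r"
    by (cases "Linf_norm m") auto
  show ?thesis
  proof (rule that)
    show "r \<ge> 0" using nn by (simp only: r ereal_less_eq(5))
    show "AE p in lebesgue. cmod (m p) \<le> r" using AE by (simp only: r ereal_less_eq(3))
    have "ereal (c * r * l) < ereal 1" using assms(1) by (simp only: r times_ereal.simps one_ereal_def)
    then show "c * r * l < 1" by (simp only: less_ereal.simps)
  qed
qed

text \<open>M is a real bound for the full multiplier, with (2 pi)^(d/2) absorbed, and
  \<open>M * l\<close> is the contraction constant. The theorem instantiates M by (2 pi)^(d/2) times
  the bound r from \<open>Linf_norm_bound\<close>.\<close>

locale log_laplacian_problem =
  fixes a k l M :: real and G h :: "real ^ 'n \<Rightarrow> real" and F :: "real \<Rightarrow> real ^ 'n \<Rightarrow> real"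
  assumes G: "integrable lebesgue G"
    and F_meas: "\<And>u. F u \<in> borel_measurable lebesgue"
    and h: "h \<in> L2"
    and F_growth: "\<And>u x. \<bar>F u x\<bar> \<le> k * \<bar>u\<bar> + h x"
    and l_pos: "l > 0"
    and F_lipschitz: "\<And>u1 u2 x. \<bar>F u1 x - F u2 x\<bar> \<le> l * \<bar>u1 - u2\<bar>"
    and M_nonneg: "M \<ge> 0"
    and M: "AE p in lebesgue. cmod (of_real (fconst TYPE('n)) *
       (fourier (\<lambda>x. of_real (G x)) p / of_real (ln (norm p / exp a)))) \<le> M"
    and contr: "M * l < 1"
begin

abbreviation lift :: "(real ^ 'n \<Rightarrow> real) \<Rightarrow> real ^ 'n \<Rightarrow> complex" where
  "lift v \<equiv> (\<lambda>x. complex_of_real (v x))"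

definition nemytskii :: "(real ^ 'n \<Rightarrow> real) \<Rightarrow> real ^ 'n \<Rightarrow> real" where
  "nemytskii v = (\<lambda>x. F (v x) x)"

text \<open>The factor (2 pi)^(d/2) comes from the convolution theorem. On the sphere of radius exp
  a the logarithm is 0 and the quotient takes the default value 0.\<close>

definition multiplier :: "real ^ 'n \<Rightarrow> complex" where
  "multiplier p = of_real (fconst TYPE('n)) * (fourier (lift G) p / of_real (ln (norm p / exp a)))"

lemma G_lift: "integrable lebesgue (lift G)"
  using G by (simp add: complex_of_real_integrable_eq)

lemma multiplier_measurable: "multiplier \<in> borel_measurable lebesgue"
proof -
  have [measurable]: "fourier (lift G) \<in> borel_measurable borel"
    using fourier_measurable[OF borel_measurable_integrable[OF G_lift]] .
  have "multiplier \<in> borel_measurable borel" unfolding multiplier_def[abs_def] by measurable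
  then show ?thesis by (intro measurable_completion) simp
qed

lemma multiplier_L2:
  assumes "u \<in> L2"
  shows "(\<lambda>p. multiplier p * u p) \<in> L2" "norm2 (\<lambda>p. multiplier p * u p) \<le> M * norm2 u"
proof -
  have m: "(\<lambda>p. multiplier p * u p) \<in> borel_measurable lebesgue"
    using multiplier_measurable L2_D(1)[OF assms] by (rule borel_measurable_times)
  have "AE p in lebesgue. cmod (multiplier p) \<le> M" using M by (simp only: multiplier_def)
  then have "AE p in lebesgue. norm (multiplier p * u p) \<le> M * norm (u p)"
    by eventually_elim (subst norm_mult, rule mult_right_mono, auto)
  from L2_dominated[OF assms m M_nonneg this]
  show "(\<lambda>p. multiplier p * u p) \<in> L2" "norm2 (\<lambda>p. multiplier p * u p) \<le> M * norm2 u" by auto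
qed

lemma nemytskii_L2:
  assumes "v \<in> L2"
  shows "nemytskii v \<in> L2"
proof -
  have m: "nemytskii v \<in> borel_measurable lebesgue"
    unfolding nemytskii_def by (rule superposition_measurable[OF F_meas F_lipschitz L2_D(1)[OF assms]])
  have "(\<lambda>x. k *\<^sub>R norm (v x) + h x) \<in> L2"
    by (intro L2_add(1) L2_scaleR L2_norm assms h)
  moreover have "AE x in lebesgue. norm (nemytskii v x) \<le> 1 * norm (k *\<^sub>R norm (v x) + h x)"
  proof (rule AE_I2)
    show "norm (nemytskii v x) \<le> 1 * norm (k *\<^sub>R norm (v x) + h x)" for x
      using F_growth[of "v x" x] by (simp add: nemytskii_def)
  qed
  ultimately show ?thesis by (intro L2_dominated(1)[OF _ m zero_le_one])
qed

lemma nemytskii_lipschitz: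
  assumes "v1 \<in> L2" "v2 \<in> L2"
  shows "norm2 (\<lambda>x. nemytskii v1 x - nemytskii v2 x) \<le> l * norm2 (\<lambda>x. v1 x - v2 x)"
proof (rule L2_dominated(2)[OF L2_diff(1)[OF assms]])
  show "(\<lambda>x. nemytskii v1 x - nemytskii v2 x) \<in> borel_measurable lebesgue"
    by (rule L2_D(1)[OF L2_diff(1)[OF nemytskii_L2[OF assms(1)] nemytskii_L2[OF assms(2)]]])
  show "AE x in lebesgue. norm (nemytskii v1 x - nemytskii v2 x) \<le> l * norm (v1 x - v2 x)"
    using F_lipschitz by (simp add: nemytskii_def)
qed (use l_pos in simp)

lemma nonlocal_eq_conv: "complex_of_real (nonlocal_term G F v x) = conv (lift G) (lift (nemytskii v)) x"
  unfolding nonlocal_term_def conv_def nemytskii_def of_real_mult[symmetric] by (rule integral_complex_of_real[symmetric])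

text \<open>The origin is excluded along with the sphere, since splitting the logarithm of the
  quotient needs |p| > 0.\<close>

lemma AE_symbol: "AE p in lebesgue. ln (norm p / exp a) = ln (norm p) - a \<and> ln (norm (p :: real ^ 'n)) - a \<noteq> 0"
proof -
  have "negligible ({0} \<union> sphere (0 :: real ^ 'n) (exp a))"
    by (intro negligible_Un negligible_sing negligible_sphere)
  then have "{0} \<union> sphere (0 :: real ^ 'n) (exp a) \<in> null_sets lebesgue" by (simp only: negligible_iff_null_sets)
  from AE_not_in[OF this] show ?thesis
  proof eventually_elim
    case (elim p)
    then have p: "norm p > 0" "norm p \<noteq> exp a" by auto
    have "ln (norm p) \<noteq> a" using p by (metis exp_ln)
    then show ?case using p by (simp add: ln_div)
  qed
qed

lemma lift_L2: "v \<in> L2 \<Longrightarrow> lift v \<in> L2"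
  by (simp add: L2_of_real)

text \<open>The function on the left is what ln(-Delta) u must be if the auxiliary equation holds;
  the factor 2 undoes the one half in that equation.\<close>

lemma rhs_fourier:
  assumes "u \<in> L2" "v \<in> L2"
  shows "has_L2_fourier (\<lambda>x. 2 * (of_real a * lift u x + conv (lift G) (lift (nemytskii v)) x))
    (\<lambda>p. 2 * (of_real a * fourier_L2 (lift u) p +
      of_real (fconst TYPE('n)) * fourier (lift G) p * fourier_L2 (lift (nemytskii v)) p))"
  by (intro has_L2_fourier_scale has_L2_fourier_add has_L2_fourier_conv G_lift
      has_L2_fourier_fourier_L2 lift_L2 nemytskii_L2 assms)

lemma symbol_algebra:
  fixes U g f :: complex and L A c :: real
  assumes "L - A \<noteq> 0"
  shows "of_real (2 * L) * U = 2 * (of_real A * U + of_real c * g * f) \<longleftrightarrow> U = of_real c * (g / of_real (L - A)) * f"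
proof -
  have nz: "complex_of_real (L - A) \<noteq> 0" using assms by (simp del: of_real_diff)
  have "of_real (2 * L) * U = 2 * (of_real L * U)" by simp
  then have "of_real (2 * L) * U = 2 * (of_real A * U + of_real c * g * f) \<longleftrightarrow>
      of_real L * U = of_real A * U + of_real c * g * f"
    by (simp only: mult_cancel_left) simp
  also have "\<dots> \<longleftrightarrow> of_real (L - A) * U = of_real c * g * f"
    unfolding of_real_diff left_diff_distrib diff_eq_eq by (simp only: add.commute)
  also have "\<dots> \<longleftrightarrow> U = of_real c * (g / of_real (L - A)) * f"
    using nz by (auto simp: field_simps simp del: of_real_diff)
  finally show ?thesis .
qed

text \<open>The equation determines w a.e. as \<open>?W\<close>, so the unbounded operator
  disappears: both the domain condition and the equation are contained in one a.e. identity between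
  transforms.\<close>

lemma solves_auxiliary_iff:
  assumes u: "u \<in> L2" and v: "v \<in> L2"
  shows "solves_auxiliary a G F v u \<longleftrightarrow>
    (AE p in lebesgue. fourier_L2 (lift u) p = multiplier p * fourier_L2 (lift (nemytskii v)) p)"
proof -
  let ?W = "\<lambda>x. 2 * (of_real a * lift u x + conv (lift G) (lift (nemytskii v)) x)"
  let ?R = "\<lambda>p. 2 * (of_real a * fourier_L2 (lift u) p +
      of_real (fconst TYPE('n)) * fourier (lift G) p * fourier_L2 (lift (nemytskii v)) p)"
  note W = rhs_fourier[OF u v]
  have *: "(AE p in lebesgue. of_real (2 * ln (norm p)) * fourier_L2 (lift u) p = ?R p) \<longleftrightarrow>
      (AE p in lebesgue. fourier_L2 (lift u) p = multiplier p * fourier_L2 (lift (nemytskii v)) p)"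
    (is "?A \<longleftrightarrow> ?B")
  proof (rule eventually_subst)
    show "AE p in lebesgue. (of_real (2 * ln (norm p)) * fourier_L2 (lift u) p = ?R p) =
        (fourier_L2 (lift u) p = multiplier p * fourier_L2 (lift (nemytskii v)) p)"
      using AE_symbol
    proof eventually_elim
      case (elim p)
      show ?case
        unfolding multiplier_def conjunct1[OF elim] by (rule symbol_algebra[OF conjunct2[OF elim]])
    qed
  qed
  show ?thesis unfolding *[symmetric]
  proof
    assume "solves_auxiliary a G F v u"
    then obtain w where w: "w \<in> L2" "AE p in lebesgue. fourier_L2 w p = of_real (2 * ln (norm p)) * fourier_L2 (lift u) p"
      and eq: "AE x in lebesgue. 1 / 2 * w x - of_real (a * u x) = of_real (nonlocal_term G F v x)"
      unfolding solves_auxiliary_def log_laplacian_def by blast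
    have "AE x in lebesgue. ?W x = w x"
      using eq
    proof eventually_elim
      case (elim x)
      then have "conv (lift G) (lift (nemytskii v)) x = 1 / 2 * w x - of_real (a * u x)"
        by (simp only: nonlocal_eq_conv)
      then show ?case by simp
    qed
    from fourier_L2_eqI[OF W this] w(2) show ?A by eventually_elim simp
  next
    \<comment> \<open>Now \<open>?W\<close> itself serves as w; it lies in L2 by construction, so
      the identity also puts u in the domain.\<close>
    assume A: ?A
    have "AE p in lebesgue. fourier_L2 ?W p = ?R p" by (rule fourier_L2_eqI[OF W]) simp
    with A have "AE p in lebesgue. fourier_L2 ?W p = of_real (2 * ln (norm p)) * fourier_L2 (lift u) p"
      by eventually_elim simp
    then have "log_laplacian (lift u) ?W"
      unfolding log_laplacian_def using lift_L2[OF u] has_L2_fourierD(1)[OF W] by blast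
    moreover have "AE x in lebesgue. 1 / 2 * ?W x - of_real (a * u x) = of_real (nonlocal_term G F v x)"
      by (simp add: nonlocal_eq_conv add_divide_distrib)
    ultimately show "solves_auxiliary a G F v u" unfolding solves_auxiliary_def by blast
  qed
qed

lemma fourier_L2_lift_hermitian:
  assumes "f \<in> L2"
  shows "AE p in lebesgue. cnj (fourier_L2 (lift f) (- p)) = fourier_L2 (lift f) p"
proof -
  have f: "has_L2_fourier (lift f) (fourier_L2 (lift f))"
    by (rule has_L2_fourier_fourier_L2[OF lift_L2[OF assms]])
  from has_L2_fourier_unique[OF has_L2_fourier_cnj[OF f] f] show ?thesis by simp
qed

text \<open>The logarithm is real and even in p, and the transform of the real function G is
  Hermitian.\<close>

lemma multiplier_hermitian: "cnj (multiplier (- p)) = multiplier p"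
  using fourier_cnj[of "lift G" p] by (simp add: multiplier_def)

text \<open>Surjectivity of the transform yields a complex U. Its transform is Hermitian, so the
  conjugate of U has the same transform and the isometry forces U to be real a.e.\<close>

lemma solves_auxiliary_exists:
  assumes v: "v \<in> L2"
  obtains u where "u \<in> L2" "solves_auxiliary a G F v u"
proof -
  let ?f = "fourier_L2 (lift (nemytskii v))"
  let ?g = "\<lambda>p. multiplier p * ?f p"
  have "?f \<in> L2" by (rule has_L2_fourierD(2)[OF has_L2_fourier_fourier_L2[OF lift_L2[OF nemytskii_L2[OF v]]]])
  then have "?g \<in> L2" by (rule multiplier_L2(1))
  then obtain U where U: "has_L2_fourier U ?g" using has_L2_fourier_surj by blast
  have ae: "AE p in lebesgue. cnj (?g (- p)) = ?g p"
    using fourier_L2_lift_hermitian[OF nemytskii_L2[OF v]] by eventually_elim (simp add: multiplier_hermitian)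
  have "has_L2_fourier (\<lambda>x. cnj (U x)) ?g"
    by (rule has_L2_fourier_cong[OF has_L2_fourier_cnj[OF U] _ ae]) simp
  from has_L2_fourier_isometry[OF has_L2_fourier_diff[OF this U]]
  have "norm2 (\<lambda>x. cnj (U x) - U x) = 0" by simp
  then have "AE x in lebesgue. cnj (U x) = U x"
    using norm2_diff_eq_0_iff[OF L2_cnj[OF has_L2_fourierD(1)[OF U]] has_L2_fourierD(1)[OF U]] by simp
  then have eq: "AE x in lebesgue. U x = lift (\<lambda>x. Re (U x)) x"
    by eventually_elim (simp add: complex_eq_iff)
  have u: "(\<lambda>x. Re (U x)) \<in> L2"
    using L2_cong_AE(1)[OF has_L2_fourierD(1)[OF U] eq] by (simp only: L2_of_real)
  show ?thesis
    using that[OF u] fourier_L2_eqI[OF U eq] solves_auxiliary_iff[OF u v] by simp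
qed

text \<open>Stated for arbitrary solutions instead of \<open>t_map\<close>, so that one estimate
  serves uniqueness of u, the Picard iteration and uniqueness of the fixed point. M comes from the
  multiplier, l from F.\<close>

lemma solves_auxiliary_contraction:
  assumes u: "u1 \<in> L2" "u2 \<in> L2" and v: "v1 \<in> L2" "v2 \<in> L2"
    and s: "solves_auxiliary a G F v1 u1" "solves_auxiliary a G F v2 u2"
  shows "norm2 (\<lambda>x. u1 x - u2 x) \<le> M * l * norm2 (\<lambda>x. v1 x - v2 x)"
proof -
  note U = has_L2_fourier_fourier_L2[OF lift_L2[OF u(1)]] has_L2_fourier_fourier_L2[OF lift_L2[OF u(2)]]
  note N = has_L2_fourier_fourier_L2[OF lift_L2[OF nemytskii_L2[OF v(1)]]] has_L2_fourier_fourier_L2[OF lift_L2[OF nemytskii_L2[OF v(2)]]]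
  let ?d = "\<lambda>p. fourier_L2 (lift (nemytskii v1)) p - fourier_L2 (lift (nemytskii v2)) p"
  have d: "?d \<in> L2" by (rule has_L2_fourierD(2)[OF has_L2_fourier_diff[OF N]])
  have "norm2 (\<lambda>x. u1 x - u2 x) = norm2 (\<lambda>x. lift u1 x - lift u2 x)"
    using L2_of_real(2)[of "\<lambda>x. u1 x - u2 x"] by simp
  also have "\<dots> = norm2 (\<lambda>p. fourier_L2 (lift u1) p - fourier_L2 (lift u2) p)"
    by (rule has_L2_fourier_isometry[OF has_L2_fourier_diff[OF U], symmetric])
  also have "\<dots> = norm2 (\<lambda>p. multiplier p * ?d p)"
  proof (rule L2_cong_AE(2)[OF multiplier_L2(1)[OF d]])
    show "AE p in lebesgue. multiplier p * ?d p = fourier_L2 (lift u1) p - fourier_L2 (lift u2) p"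
      using s[unfolded solves_auxiliary_iff[OF u(1) v(1)] solves_auxiliary_iff[OF u(2) v(2)]]
      by eventually_elim (simp add: right_diff_distrib)
  qed
  also have "\<dots> \<le> M * norm2 ?d" by (rule multiplier_L2(2)[OF d])
  also have "norm2 ?d = norm2 (\<lambda>x. lift (nemytskii v1) x - lift (nemytskii v2) x)"
    by (rule has_L2_fourier_isometry[OF has_L2_fourier_diff[OF N]])
  also have "\<dots> = norm2 (\<lambda>x. nemytskii v1 x - nemytskii v2 x)"
    using L2_of_real(2)[of "\<lambda>x. nemytskii v1 x - nemytskii v2 x"] by simp
  also have "M * \<dots> \<le> M * (l * norm2 (\<lambda>x. v1 x - v2 x))"
    by (rule mult_left_mono[OF nemytskii_lipschitz[OF v] M_nonneg])
  finally show ?thesis by (simp add: mult.assoc)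
qed

lemma solves_auxiliary_unique:
  assumes u: "u1 \<in> L2" "u2 \<in> L2" and v: "v1 \<in> L2" "v2 \<in> L2"
    and s: "solves_auxiliary a G F v1 u1" "solves_auxiliary a G F v2 u2"
    and eq: "AE x in lebesgue. v1 x = v2 x"
  shows "AE x in lebesgue. u1 x = u2 x"
proof -
  have "norm2 (\<lambda>x. u1 x - u2 x) \<le> 0"
    using solves_auxiliary_contraction[OF u v s] norm2_diff_eq_0_iff[OF v] eq by simp
  then show ?thesis using norm2_diff_eq_0_iff[OF u] norm2_nonneg[of "\<lambda>x. u1 x - u2 x"] by linarith
qed

text \<open>\<open>t_map\<close> returns some representative, so a fixed point is one only a.e.;
  this lemma lets such an equality be substituted into the equation.\<close>

lemma solves_auxiliary_cong:
  assumes u: "u1 \<in> L2" "u2 \<in> L2" and v: "v \<in> L2"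
    and s: "solves_auxiliary a G F v u1" and eq: "AE x in lebesgue. u1 x = u2 x"
  shows "solves_auxiliary a G F v u2"
proof -
  have "AE x in lebesgue. lift u1 x = lift u2 x" using eq by eventually_elim simp
  from fourier_L2_eqI[OF has_L2_fourier_fourier_L2[OF lift_L2[OF u(1)]] this]
    s[unfolded solves_auxiliary_iff[OF u(1) v]]
  have "AE p in lebesgue. fourier_L2 (lift u2) p = multiplier p * fourier_L2 (lift (nemytskii v)) p"
    by eventually_elim simp
  then show ?thesis unfolding solves_auxiliary_iff[OF u(2) v] .
qed

lemma t_map:
  assumes "v \<in> L2"
  shows "t_map a G F v \<in> L2" "solves_auxiliary a G F v (t_map a G F v)"
proof -
  obtain u where "u \<in> L2 \<and> solves_auxiliary a G F v u" using solves_auxiliary_exists[OF assms] by blast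
  then have "t_map a G F v \<in> L2 \<and> solves_auxiliary a G F v (t_map a G F v)"
    unfolding t_map_def by (rule someI[of "\<lambda>u. u \<in> L2 \<and> solves_auxiliary a G F v u"])
  then show "t_map a G F v \<in> L2" "solves_auxiliary a G F v (t_map a G F v)" by auto
qed

lemma t_map_fixed_iff:
  assumes "v \<in> L2"
  shows "(AE x in lebesgue. t_map a G F v x = v x) \<longleftrightarrow> solves_auxiliary a G F v v"
proof
  assume "AE x in lebesgue. t_map a G F v x = v x"
  then show "solves_auxiliary a G F v v"
    by (rule solves_auxiliary_cong[OF t_map(1)[OF assms] assms assms t_map(2)[OF assms]])
next
  assume "solves_auxiliary a G F v v"
  from solves_auxiliary_unique[OF t_map(1)[OF assms] assms assms assms t_map(2)[OF assms] this]
  show "AE x in lebesgue. t_map a G F v x = v x" by simp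
qed

lemma solves_equation_iff: "solves_equation a G F u \<longleftrightarrow> solves_auxiliary a G F u u"
proof -
  have "- (1 / 2) * w x + of_real (a * u x) + of_real (nonlocal_term G F u x) = 0 \<longleftrightarrow>
      1 / 2 * w x - of_real (a * u x) = of_real (nonlocal_term G F u x)" for w :: "real ^ 'n \<Rightarrow> complex" and x
    by (auto simp: algebra_simps eq_neg_iff_add_eq_0)
  then show ?thesis unfolding solves_equation_def solves_auxiliary_def by simp
qed

text \<open>Banach's argument, started at 0 and carried out by hand because \<open>norm2\<close> is
  only a seminorm on functions.\<close>

lemma fixed_point_exists:
  obtains v where "v \<in> L2" "solves_auxiliary a G F v v"
proof -
  define s where "s n = (t_map a G F ^^ n) (\<lambda>x. 0)" for n
  have sS: "s (Suc n) = t_map a G F (s n)" for n by (simp add: s_def)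
  have sL: "s n \<in> L2" for n by (induction n) (simp_all add: sS t_map(1), simp add: s_def)
  define q where "q = M * l"
  have q: "0 \<le> q" "q < 1" using M_nonneg l_pos contr by (auto simp: q_def)
  have step: "norm2 (\<lambda>x. s (Suc n) x - s n x) \<le> norm2 (\<lambda>x. s 1 x - s 0 x) * q ^ n" for n
  proof (induction n)
    case (Suc n)
    have "norm2 (\<lambda>x. s (Suc (Suc n)) x - s (Suc n) x) \<le> q * norm2 (\<lambda>x. s (Suc n) x - s n x)"
      unfolding q_def sS[of "Suc n"] using t_map[OF sL] unfolding sS[of n, symmetric]
      by (intro solves_auxiliary_contraction sL t_map) (simp add: sS t_map(2) sL)
    also have "\<dots> \<le> q * (norm2 (\<lambda>x. s 1 x - s 0 x) * q ^ n)" by (rule mult_left_mono[OF Suc q(1)])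
    finally show ?case by (simp add: mult_ac)
  qed simp
  obtain v where v: "v \<in> L2" "(\<lambda>n. norm2 (\<lambda>x. s n x - v x)) \<longlonglongrightarrow> 0"
    using L2_complete_geometric[OF sL step q] by blast
  \<comment> \<open>The shifted iterates converge to \<open>t_map\<close> of v as well as to v, so
    the two agree a.e.\<close>
  have "(\<lambda>n. norm2 (\<lambda>x. s (Suc n) x - t_map a G F v x)) \<longlonglongrightarrow> 0"
  proof (rule Lim_null_comparison)
    show "\<forall>\<^sub>F n in sequentially. norm (norm2 (\<lambda>x. s (Suc n) x - t_map a G F v x)) \<le> q * norm2 (\<lambda>x. s n x - v x)"
      unfolding q_def sS using solves_auxiliary_contraction[OF t_map(1)[OF sL] t_map(1)[OF v(1)] sL v(1) t_map(2)[OF sL] t_map(2)[OF v(1)]]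
      by simp
    show "(\<lambda>n. q * norm2 (\<lambda>x. s n x - v x)) \<longlonglongrightarrow> 0" using tendsto_mult_left[OF v(2), of q] by simp
  qed
  from L2_limit_unique[OF t_map(1)[OF v(1)] v(1) sL this LIMSEQ_Suc[OF v(2)]]
  have "AE x in lebesgue. t_map a G F v x = v x" .
  then show ?thesis using that[OF v(1)] t_map_fixed_iff[OF v(1)] by simp
qed

lemma fixed_point_unique:
  assumes "v1 \<in> L2" "v2 \<in> L2" "solves_auxiliary a G F v1 v1" "solves_auxiliary a G F v2 v2"
  shows "AE x in lebesgue. v1 x = v2 x"
proof -
  have "norm2 (\<lambda>x. v1 x - v2 x) \<le> M * l * norm2 (\<lambda>x. v1 x - v2 x)"
    by (rule solves_auxiliary_contraction[OF assms(1,2,1,2,3,4)])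
  then have "(1 - M * l) * norm2 (\<lambda>x. v1 x - v2 x) \<le> 0" by (simp add: algebra_simps)
  then have "norm2 (\<lambda>x. v1 x - v2 x) \<le> 0" using contr by (simp add: mult_le_0_iff)
  then show ?thesis using norm2_diff_eq_0_iff[OF assms(1,2)] norm2_nonneg[of "\<lambda>x. v1 x - v2 x"] by linarith
qed

text \<open>The transform of a vanishing v is 0 a.e., so the multiplier identity makes the product
  of the transforms of F 0 and G vanish up to a factor that is nonzero off the null set of
  \<open>AE_symbol\<close>.\<close>

lemma zero_solution_supports:
  assumes v: "v \<in> L2" and s: "solves_auxiliary a G F v v" and zero: "AE x in lebesgue. v x = 0"
  shows "emeasure lebesgue (supp (fourier_L2 (lift (F 0))) \<inter> supp (fourier (lift G))) = 0"
proof -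
  have "AE x in lebesgue. lift (nemytskii v) x = lift (F 0) x"
    using zero by eventually_elim (simp add: nemytskii_def)
  note f = fourier_L2_eqI[OF has_L2_fourier_fourier_L2[OF lift_L2[OF nemytskii_L2[OF v]]] this]
  have "AE x in lebesgue. lift v x = (\<lambda>x. 0) x" using zero by eventually_elim simp
  note v0 = fourier_L2_eqI[OF has_L2_fourier_fourier_L2[OF lift_L2[OF v]] this]
  \<comment> \<open>Since \<open>fourier_L2\<close> is a choice, even the transform of 0 is known
    only a.e.; scaling by 0 exhibits 0 as one such transform.\<close>
  have "has_L2_fourier (\<lambda>x. 0 * lift v x) (\<lambda>p. 0 * fourier_L2 (lift v) p)"
    by (rule has_L2_fourier_scale[OF has_L2_fourier_fourier_L2[OF lift_L2[OF v]]])
  then have "AE p in lebesgue. fourier_L2 (\<lambda>x :: real ^ 'n. 0) p = 0"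
    by (intro fourier_L2_eqI[of "\<lambda>x. 0"]) simp_all
  with f v0 s[unfolded solves_auxiliary_iff[OF v v]] AE_symbol
  have "AE p in lebesgue. p \<notin> supp (fourier_L2 (lift (F 0))) \<inter> supp (fourier (lift G))"
    by eventually_elim (auto simp: multiplier_def in_support_on)
  then have "supp (fourier_L2 (lift (F 0))) \<inter> supp (fourier (lift G)) \<in> null_sets lebesgue"
    by (simp add: completion.null_sets_iff_AE)
  then show ?thesis by (rule null_setsD1)
qed

end

theorem theorem1:
  fixes a k l :: real
    and G h :: "real ^ 'n \<Rightarrow> real"
    and F :: "real \<Rightarrow> real ^ 'n \<Rightarrow> real"
  assumes G_L1: "G \<in> L1"
    and xG_L1: "(\<lambda>x. norm x * G x) \<in> L1"
    and F_carath: "caratheodory F"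
    and k_pos: "k > 0"
    and h_nonneg: "\<And>x. h x \<ge> 0"
    and h_L2: "h \<in> L2"
    and F_growth: "\<And>u x. \<bar>F u x\<bar> \<le> k * \<bar>u\<bar> + h x"
    and l_pos: "l > 0"
    and F_lipschitz: "\<And>u1 u2 x. \<bar>F u1 x - F u2 x\<bar> \<le> l * \<bar>u1 - u2\<bar>"
    and orth_1: "CARD('n) = 1 \<Longrightarrow> \<forall>i. \<forall>s \<in> {1, - 1}.
        L2_inner (\<lambda>x. of_real (G x))
          (\<lambda>x. exp (\<i> * of_real (s * exp a * x $ i)) / of_real (sqrt (2 * pi))) = 0"
    and orth_ge_2: "CARD('n) \<ge> 2 \<Longrightarrow> \<forall>p \<in> sphere 0 (exp a).
        L2_inner (\<lambda>x. of_real (G x))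
          (\<lambda>x. exp (\<i> * of_real (p \<bullet> x)) / of_real ((2 * pi) powr (real CARD('n) / 2))) = 0"
    and small: "ereal ((2 * pi) powr (real CARD('n) / 2)) *
        Linf_norm (\<lambda>p. fourier (\<lambda>x. of_real (G x)) p / of_real (ln (norm p / exp a))) *
        ereal l < 1"
  shows "(\<forall>v \<in> L2. \<exists>u \<in> L2. solves_auxiliary a G F v u \<and>
            (\<forall>u' \<in> L2. solves_auxiliary a G F v u' \<longrightarrow> (AE x in lebesgue. u' x = u x))) \<and>
         (\<exists>v_a \<in> L2.
            (AE x in lebesgue. t_map a G F v_a x = v_a x) \<and>
            (\<forall>v \<in> L2. (AE x in lebesgue. t_map a G F v x = v x) \<longrightarrow>
               (AE x in lebesgue. v x = v_a x)) \<and>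
            solves_equation a G F v_a \<and>
            (\<forall>u \<in> L2. solves_equation a G F u \<longrightarrow> (AE x in lebesgue. u x = v_a x)) \<and>
            (emeasure lebesgue
               (supp (fourier_L2 (\<lambda>x. of_real (F 0 x))) \<inter> supp (fourier (\<lambda>x. of_real (G x)))) \<noteq> 0 \<longrightarrow>
             \<not> (AE x in lebesgue. v_a x = 0)))"
proof -
  let ?m = "\<lambda>p. fourier (\<lambda>x. of_real (G x)) p / of_real (ln (norm p / exp a))"
  have c: "fconst TYPE('n) > 0" by simp
  obtain r where r: "r \<ge> 0" "AE p in lebesgue. cmod (?m p) \<le> r" "fconst TYPE('n) * r * l < 1"
    using Linf_norm_bound[OF small c l_pos] by blast
  interpret log_laplacian_problem a k l "fconst TYPE('n) * r" G h F
  proof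
    show "integrable lebesgue G" using G_L1 by (simp add: L1_def)
    show "F u \<in> borel_measurable lebesgue" for u using F_carath by (simp add: caratheodory_def)
    show "AE p in lebesgue. cmod (of_real (fconst TYPE('n)) * ?m p) \<le> fconst TYPE('n) * r"
      using r(2)
    proof eventually_elim
      case (elim p)
      have "cmod (of_real (fconst TYPE('n)) * ?m p) = fconst TYPE('n) * cmod (?m p)"
        by (subst norm_mult) simp
      also have "\<dots> \<le> fconst TYPE('n) * r" by (rule mult_left_mono[OF elim less_imp_le[OF c]])
      finally show ?case .
    qed
  qed (use r in \<open>auto intro: h_L2 F_growth l_pos F_lipschitz\<close>)
  obtain v where v: "v \<in> L2" "solves_auxiliary a G F v v" using fixed_point_exists by blast
  show ?thesis
  proof (rule conjI[OF ballI bexI[OF _ v(1)]])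
    fix w :: "real ^ 'n \<Rightarrow> real" assume w: "w \<in> L2"
    obtain u where u: "u \<in> L2" "solves_auxiliary a G F w u" using solves_auxiliary_exists[OF w] by blast
    have "AE x in lebesgue. u' x = u x" if "u' \<in> L2" "solves_auxiliary a G F w u'" for u'
      by (rule solves_auxiliary_unique[OF that(1) u(1) w w that(2) u(2)]) simp
    with u show "\<exists>u\<in>L2. solves_auxiliary a G F w u \<and>
        (\<forall>u'\<in>L2. solves_auxiliary a G F w u' \<longrightarrow> (AE x in lebesgue. u' x = u x))" by blast
  next
    show "(AE x in lebesgue. t_map a G F v x = v x) \<and>
        (\<forall>w \<in> L2. (AE x in lebesgue. t_map a G F w x = w x) \<longrightarrow> (AE x in lebesgue. w x = v x)) \<and>
        solves_equation a G F v \<and>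
        (\<forall>u \<in> L2. solves_equation a G F u \<longrightarrow> (AE x in lebesgue. u x = v x)) \<and>
        (emeasure lebesgue
           (supp (fourier_L2 (\<lambda>x. of_real (F 0 x))) \<inter> supp (fourier (\<lambda>x. of_real (G x)))) \<noteq> 0 \<longrightarrow>
         \<not> (AE x in lebesgue. v x = 0))"
    proof (intro conjI ballI impI)
      show "AE x in lebesgue. t_map a G F v x = v x" using t_map_fixed_iff[OF v(1)] v(2) by simp
      show "AE x in lebesgue. w x = v x" if "w \<in> L2" "AE x in lebesgue. t_map a G F w x = w x" for w
        using fixed_point_unique[OF that(1) v(1) _ v(2)] t_map_fixed_iff[OF that(1)] that(2) by simp
      show "solves_equation a G F v" using v(2) by (simp add: solves_equation_iff)
      show "AE x in lebesgue. u x = v x" if "u \<in> L2" "solves_equation a G F u" for u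
        using fixed_point_unique[OF that(1) v(1) _ v(2)] that(2) by (simp add: solves_equation_iff)
      show "\<not> (AE x in lebesgue. v x = 0)"
        if "emeasure lebesgue (supp (fourier_L2 (\<lambda>x. of_real (F 0 x))) \<inter> supp (fourier (\<lambda>x. of_real (G x)))) \<noteq> 0"
        using zero_solution_supports[OF v] that by blast
    qed
  qed
qed

end
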